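(* Let $M$ be an $n$-dimensional manifold, $E$ an $(n+m)$-dimensional manifold ($n,m\ge1$), $\Gamma$ and $\Theta$ torsion-free linear connections on $TE\to E$ and $TM\to M$. The equation $\mathcal S_{\mathrm{pr}_M}$ of parametrized totally geodesic submanifolds covers the equation $\mathcal S$ of unparametrized totally geodesic submanifolds, with $\mathrm{pr}_E^{(1)}$ as covering map. That is, $\mathrm{pr}_E^{(1)}\colon\mathrm{Imm}\,J^1\mathrm{pr}_M\to J^1(E,n)$ is a surjection and for each $\tilde\theta_1\in\mathrm{Imm}\,J^1\mathrm{pr}_M$ the tangent map $T_{\tilde\theta_1}\mathrm{pr}_E^{(1)}$ maps the $n$-plane $R_{\ddot\Gamma_{\mathrm{pr}_M}(\tilde\theta_1)}$ isomorphically onto the $n$-plane $R_{\ddot\Gamma(\mathrm{pr}_E^{(1)}(\tilde\theta_1))}$.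
   Context: Jets of submanifolds. $J^r(E,n)$ is the manifold of $r$-th order contact classes $[L]^r_p$ of $n$-dimensional embedded submanifolds $L\subset E$ at $p\in L$, with charts $(u^\lambda,u^i_\sigma)$ ($1\le\lambda\le n<i\le n+m$, $|\sigma|\le r$) giving derivatives of $f^i$ when $L$ is $u^i=f^i(u^\lambda)$; $\pi_{k,h}$ are the projections; $L^{(r)}=\{[L]^r_p:p\in L\}$ and $R_{[L]^{r+1}_p}=T_{[L]^r_p}L^{(r)}$. Unparametrized equation. $\mathcal S\subset J^2(E,n)$ is the set of $[L]^2_p$ for which the second fundamental form $(X,Y)\mapsto\nabla_XY\bmod T_pL$ of $L$ with respect to $\Gamma$ vanishes at $p$. $\dot\Gamma$ is the connection on $\pi_{1,0}$ with vertical projection $(du^k_\xi+\dot\Gamma_A{}^k{}_\xi du^A)\otimes\partial_{u^k_\xi}$, $\dot\Gamma_A{}^k{}_\xi=\Gamma_A{}^k{}_\xi+\Gamma_A{}^k{}_iu^i_\xi-u^k_\beta(\Gamma_A{}^\beta{}_\xi+\Gamma_A{}^\beta{}_iu^i_\xi)$ (Christoffel symbols: $\nabla_{\partial_A}\partial_B=\Gamma_A{}^C{}_B\partial_C$). $\ddot\Gamma$ is the section of $\pi_{2,1}$ such that $R_{\ddot\Gamma(\theta_1)}$ is the $\dot\Gamma$-horizontal lift of $R_{\theta_1}$; its image is $\mathcal S$. Parametrized equation. $\mathrm{pr}_M\colon M\times E\to M$ and $\mathrm{pr}_E\colon M\times E\to E$ are the projections; $J^r\mathrm{pr}_M$ is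 the bundle of $r$-jets $[s]^r_x$ of local maps $s\colon M\to E$, with charts $(x^\lambda,u^A_{x^\sigma})$; $\mathrm{Imm}\,J^r\mathrm{pr}_M$ is the open subset of jets of immersions; $R_{[s]^{r+1}_x}$ is the tangent space at $[s]^r_x$ to $\{[s]^r_y\}_y$. $\mathcal S_{\mathrm{pr}_M}\subset\mathrm{Imm}\,J^2\mathrm{pr}_M$ is given by $u^C_{x^\xi x^\lambda}+\Gamma_A{}^C{}_Bu^A_{x^\xi}u^B_{x^\lambda}-\Theta_\xi{}^\eta{}_\lambda u^C_{x^\eta}=0$, and $\ddot\Gamma_{\mathrm{pr}_M}\colon\mathrm{Imm}\,J^1\mathrm{pr}_M\to\mathrm{Imm}\,J^2\mathrm{pr}_M$ is the section of $J^2\mathrm{pr}_M\to J^1\mathrm{pr}_M$ whose image is $\mathcal S_{\mathrm{pr}_M}$. $\mathrm{pr}_E^{(r)}\colon\mathrm{Imm}\,J^r\mathrm{pr}_M\to J^r(E,n)$ sends $[s]^r_x$ to $[\mathrm{im}\,s]^r_{s(x)}$ ($s$ restricted to a small neighbourhood of $x$, where it is an embedding). Covering. In the sense of the theory of differential equations, a covering is a surjection whose tangent maps send the $n$-dimensional distribution isomorphically to the Cartan distribution. Via $\ddot\Gamma$ and $\ddot\Gamma_{\mathrm{pr}_M}$ the equations $\mathcal S$ and $\mathcal S_{\mathrm{pr}_M}$ are identified with $J^1(E,n)$ and $\mathrm{Imm}\,J^1\mathrm{pr}_M$ equipped with the $n$-dimensional distributions $\theta_1\mapsto R_{\ddot\Gamma(\theta_1)}$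 and $\tilde\theta_1\mapsto R_{\ddot\Gamma_{\mathrm{pr}_M}(\tilde\theta_1)}$ (not assumed integrable). *)

theory Defs
  imports "HOL-Analysis.Analysis" "HOL-Library.Function_Algebras"
begin

section \<open>Smooth maps between Euclidean spaces\<close>

primrec Ck_on :: "nat \<Rightarrow> 'a::euclidean_space set \<Rightarrow> ('a \<Rightarrow> 'b::euclidean_space) \<Rightarrow> bool" where
  "Ck_on 0 S f \<longleftrightarrow> continuous_on S f"
| "Ck_on (Suc k) S f \<longleftrightarrow>
     (\<forall>x\<in>S. f differentiable (at x)) \<and>
     (\<forall>v. Ck_on k S (\<lambda>x. frechet_derivative f (at x) v))"

text \<open>Only meaningful for open sets, since the derivatives are taken in the whole space.\<close>

definition smooth_on :: "'a::euclidean_space set \<Rightarrow> ('a \<Rightarrow> 'b::euclidean_space) \<Rightarrow> bool" where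
  "smooth_on S f \<longleftrightarrow> (\<forall>k. Ck_on k S f)"

primrec same_derivs ::
  "nat \<Rightarrow> ('a::euclidean_space \<Rightarrow> 'b::euclidean_space) \<Rightarrow> ('a \<Rightarrow> 'b) \<Rightarrow> 'a \<Rightarrow> bool" where
  "same_derivs 0 f g x \<longleftrightarrow> f x = g x"
| "same_derivs (Suc r) f g x \<longleftrightarrow> f x = g x \<and>
     (\<forall>v. same_derivs r (\<lambda>y. frechet_derivative f (at y) v)
                        (\<lambda>y. frechet_derivative g (at y) v) x)"


section \<open>Smooth manifolds\<close>

text \<open>
  A chart is a pair of its domain and its coordinate map; the values of the map outside the
  domain are irrelevant. The notions below that only depend on a set of charts are used for the
  manifolds \<open>M\<close> and \<open>E\<close> as well as for the jet manifolds.
\<close>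

type_synonym ('a, 'b) chart = "'a set \<times> ('a \<Rightarrow> 'b)"

definition chart_inv :: "('a, 'b) chart \<Rightarrow> 'b \<Rightarrow> 'a" where
  "chart_inv c = inv_into (fst c) (snd c)"

definition transition :: "('a, 'b) chart \<Rightarrow> ('a, 'c) chart \<Rightarrow> 'b \<Rightarrow> 'c" where
  "transition c d = snd d \<circ> chart_inv c"

definition topological_chart ::
  "('a::topological_space, 'b::euclidean_space) chart \<Rightarrow> bool" where
  "topological_chart c \<longleftrightarrow>
     open (fst c) \<and> open (snd c ` fst c) \<and>
     homeomorphism (fst c) (snd c ` fst c) (snd c) (chart_inv c)"

definition compatible ::
  "('a, 'b::euclidean_space) chart \<Rightarrow> ('a, 'b) chart \<Rightarrow> bool" where
  "compatible c d \<longleftrightarrow>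
     smooth_on (snd c ` (fst c \<inter> fst d)) (transition c d) \<and>
     smooth_on (snd d ` (fst c \<inter> fst d)) (transition d c)"

text \<open>
  A smooth manifold modelled on \<open>'b\<close> is a second countable Hausdorff space (the whole type \<open>'a\<close>)
  with a maximal smooth atlas.
\<close>

definition smooth_manifold ::
  "('a::{t2_space, second_countable_topology}, 'b::euclidean_space) chart set \<Rightarrow> bool" where
  "smooth_manifold A \<longleftrightarrow>
     (\<forall>c\<in>A. topological_chart c) \<and>
     (\<Union>c\<in>A. fst c) = UNIV \<and>
     (\<forall>c\<in>A. \<forall>d\<in>A. compatible c d) \<and>
     (\<forall>c. topological_chart c \<and> (\<forall>d\<in>A. compatible c d) \<longrightarrow> c \<in> A)"

definition std_atlas :: "('b, 'b) chart set" where
  "std_atlas = {(UNIV, \<lambda>x. x)}"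

text \<open>The openness clause expresses continuity with respect to the topologies of the atlases.\<close>

definition smooth_map_on ::
  "('a, 'b::euclidean_space) chart set \<Rightarrow> ('c, 'd::euclidean_space) chart set \<Rightarrow>
   'a set \<Rightarrow> ('a \<Rightarrow> 'c) \<Rightarrow> bool" where
  "smooth_map_on A B U F \<longleftrightarrow>
     (\<forall>c\<in>A. \<forall>d\<in>B.
        open (snd c ` {p \<in> U \<inter> fst c. F p \<in> fst d}) \<and>
        smooth_on (snd c ` {p \<in> U \<inter> fst c. F p \<in> fst d}) (snd d \<circ> F \<circ> chart_inv c))"


section \<open>Tangent vectors\<close>

instantiation "fun" :: (type, real_vector) real_vector
begin

definition scaleR_fun :: "real \<Rightarrow> ('a \<Rightarrow> 'b) \<Rightarrow> 'a \<Rightarrow> 'b" where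
  "scaleR_fun r f = (\<lambda>x. r *\<^sub>R f x)"

instance
  by standard (simp_all add: scaleR_fun_def fun_eq_iff scaleR_add_right scaleR_add_left)

end

text \<open>
  A tangent vector at \<open>p\<close> is the family of its coordinate vectors in all charts around \<open>p\<close>
  (and \<open>0\<close> at all other arguments), transforming by the Jacobians of the transition maps.
\<close>

type_synonym ('a, 'b) tvec = "('a, 'b) chart \<Rightarrow> 'b"

definition tangent_space ::
  "('a, 'b::euclidean_space) chart set \<Rightarrow> 'a \<Rightarrow> ('a, 'b) tvec set" where
  "tangent_space A p =
     {v. (\<forall>c. \<not> (c \<in> A \<and> p \<in> fst c) \<longrightarrow> v c = 0) \<and>
         (\<forall>c\<in>A. \<forall>d\<in>A. p \<in> fst c \<inter> fst d \<longrightarrow>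
            v d = frechet_derivative (transition c d) (at (snd c p)) (v c))}"

text \<open>The value does not depend on the chosen chart if \<open>v\<close> is a tangent vector at \<open>p\<close>.\<close>

definition tangent_map ::
  "('a, 'b::euclidean_space) chart set \<Rightarrow> ('c, 'd::euclidean_space) chart set \<Rightarrow>
   ('a \<Rightarrow> 'c) \<Rightarrow> 'a \<Rightarrow> ('a, 'b) tvec \<Rightarrow> ('c, 'd) tvec" where
  "tangent_map A B F p v =
     (let c = (SOME c. c \<in> A \<and> p \<in> fst c) in
      (\<lambda>d. if d \<in> B \<and> F p \<in> fst d
           then frechet_derivative (snd d \<circ> F \<circ> chart_inv c) (at (snd c p)) (v c)
           else 0))"

definition velocity ::
  "('a, 'b::euclidean_space) chart set \<Rightarrow> (real \<Rightarrow> 'a) \<Rightarrow> ('a, 'b) tvec" where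
  "velocity A \<gamma> =
     (\<lambda>c. if c \<in> A \<and> \<gamma> 0 \<in> fst c then vector_derivative (snd c \<circ> \<gamma>) (at 0) else 0)"

text \<open>For an embedded submanifold \<open>N\<close> this is the image of \<open>T\<^sub>pN\<close> in \<open>T\<^sub>p\<close> of the ambient manifold.\<close>

definition tangent_to ::
  "('a, 'b::euclidean_space) chart set \<Rightarrow> 'a set \<Rightarrow> 'a \<Rightarrow> ('a, 'b) tvec set" where
  "tangent_to A N p =
     {velocity A \<gamma> | \<gamma>. \<exists>\<epsilon>>0. \<gamma> 0 = p \<and> \<gamma> ` {-\<epsilon><..<\<epsilon>} \<subseteq> N \<and>
                          smooth_map_on std_atlas A {-\<epsilon><..<\<epsilon>} \<gamma>}"

definition maps_isomorphically_onto ::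
  "('a::real_vector \<Rightarrow> 'b::real_vector) \<Rightarrow> 'a set \<Rightarrow> 'b set \<Rightarrow> bool" where
  "maps_isomorphically_onto F P Q \<longleftrightarrow>
     subspace P \<and> subspace Q \<and> bij_betw F P Q \<and>
     (\<forall>v\<in>P. \<forall>w\<in>P. F (v + w) = F v + F w) \<and> (\<forall>r. \<forall>v\<in>P. F (r *\<^sub>R v) = r *\<^sub>R F v)"


section \<open>Torsion-free linear connections\<close>

definition smooth_vector_field_on ::
  "('a::topological_space, 'b::euclidean_space) chart set \<Rightarrow> 'a set \<Rightarrow>
   ('a \<Rightarrow> ('a, 'b) tvec) \<Rightarrow> bool" where
  "smooth_vector_field_on A U Y \<longleftrightarrow>
     open U \<and> (\<forall>q\<in>U. Y q \<in> tangent_space A q) \<and>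
     (\<forall>c\<in>A. smooth_on (snd c ` (U \<inter> fst c)) (\<lambda>y. Y (chart_inv c y) c))"

definition derivative_along ::
  "('a, 'b::euclidean_space) chart set \<Rightarrow> 'a \<Rightarrow> ('a, 'b) tvec \<Rightarrow> ('a \<Rightarrow> real) \<Rightarrow> real" where
  "derivative_along A p v f = tangent_map A std_atlas f p v (UNIV, \<lambda>x. x)"

definition lie_bracket ::
  "('a, 'b::euclidean_space) chart set \<Rightarrow> ('a \<Rightarrow> ('a, 'b) tvec) \<Rightarrow> ('a \<Rightarrow> ('a, 'b) tvec) \<Rightarrow>
   'a \<Rightarrow> ('a, 'b) tvec" where
  "lie_bracket A X Y p =
     (\<lambda>c. if c \<in> A \<and> p \<in> fst c
          then frechet_derivative (\<lambda>y. Y (chart_inv c y) c) (at (snd c p)) (X p c)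
             - frechet_derivative (\<lambda>y. X (chart_inv c y) c) (at (snd c p)) (Y p c)
          else 0)"

text \<open>
  A linear connection is given by its covariant derivative: \<open>\<Gamma> p v Y\<close> is the covariant derivative
  at \<open>p\<close>, in direction \<open>v\<close>, of a vector field \<open>Y\<close> that is defined and smooth near \<open>p\<close>.
\<close>

type_synonym ('a, 'b) connection =
  "'a \<Rightarrow> ('a, 'b) tvec \<Rightarrow> ('a \<Rightarrow> ('a, 'b) tvec) \<Rightarrow> ('a, 'b) tvec"

definition linear_connection ::
  "('a::topological_space, 'b::euclidean_space) chart set \<Rightarrow> ('a, 'b) connection \<Rightarrow> bool" where
  "linear_connection A \<Gamma> \<longleftrightarrow>
     (\<forall>U X Y. smooth_vector_field_on A U X \<and> smooth_vector_field_on A U Y \<longrightarrow>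
        smooth_vector_field_on A U (\<lambda>q. \<Gamma> q (X q) Y)) \<and>
     (\<forall>U Y p. smooth_vector_field_on A U Y \<and> p \<in> U \<longrightarrow>
        (\<forall>v\<in>tangent_space A p. \<Gamma> p v Y \<in> tangent_space A p) \<and>
        (\<forall>v\<in>tangent_space A p. \<forall>w\<in>tangent_space A p. \<Gamma> p (v + w) Y = \<Gamma> p v Y + \<Gamma> p w Y) \<and>
        (\<forall>r. \<forall>v\<in>tangent_space A p. \<Gamma> p (r *\<^sub>R v) Y = r *\<^sub>R \<Gamma> p v Y)) \<and>
     (\<forall>U Y Z p. smooth_vector_field_on A U Y \<and> smooth_vector_field_on A U Z \<and> p \<in> U \<longrightarrow>
        (\<forall>v\<in>tangent_space A p.
           \<Gamma> p v (\<lambda>q. Y q + Z q) = \<Gamma> p v Y + \<Gamma> p v Z \<and>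
           ((\<forall>q\<in>U. Y q = Z q) \<longrightarrow> \<Gamma> p v Y = \<Gamma> p v Z))) \<and>
     (\<forall>U Y f p. smooth_vector_field_on A U Y \<and> smooth_map_on A std_atlas U f \<and> p \<in> U \<longrightarrow>
        (\<forall>v\<in>tangent_space A p.
           \<Gamma> p v (\<lambda>q. f q *\<^sub>R Y q) = derivative_along A p v f *\<^sub>R Y p + f p *\<^sub>R \<Gamma> p v Y))"

definition torsion_free ::
  "('a::topological_space, 'b::euclidean_space) chart set \<Rightarrow> ('a, 'b) connection \<Rightarrow> bool" where
  "torsion_free A \<Gamma> \<longleftrightarrow>
     (\<forall>U X Y p. smooth_vector_field_on A U X \<and> smooth_vector_field_on A U Y \<and> p \<in> U \<longrightarrow>
        \<Gamma> p (X p) Y - \<Gamma> p (Y p) X = lie_bracket A X Y p)"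

definition coord_field ::
  "('a, real^'k) chart set \<Rightarrow> ('a, real^'k) chart \<Rightarrow> 'k::finite \<Rightarrow> 'a \<Rightarrow> ('a, real^'k) tvec" where
  "coord_field A c K q =
     (\<lambda>d. if d \<in> A \<and> q \<in> fst c \<inter> fst d
          then frechet_derivative (transition c d) (at (snd c q)) (axis K 1)
          else 0)"

text \<open>\<open>christoffel A \<Gamma> c p I K J\<close> is the coefficient of \<open>\<partial>\<^sub>K\<close> in the covariant derivative of \<open>\<partial>\<^sub>J\<close> in direction \<open>\<partial>\<^sub>I\<close> at \<open>p\<close>,
  in the chart \<open>c\<close>.\<close>

definition christoffel ::
  "('a, real^'k) chart set \<Rightarrow> ('a, real^'k) connection \<Rightarrow> ('a, real^'k) chart \<Rightarrow> 'a \<Rightarrow>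
   'k::finite \<Rightarrow> 'k \<Rightarrow> 'k \<Rightarrow> real" where
  "christoffel A \<Gamma> c p I K J = \<Gamma> p (coord_field A c I p) (coord_field A c J) c $ K"


section \<open>Jets of submanifolds\<close>

text \<open>
  The ambient manifold \<open>E\<close> is modelled on \<open>real^('n + 'm)\<close>, so that \<open>n = CARD('n)\<close> and
  \<open>m = CARD('m)\<close>. The coordinates with index \<open>Inl \<mu>\<close> are the \<open>u\<^sup>\<mu>\<close>, those with index \<open>Inr i\<close> are
  the \<open>u\<^sup>i\<close>. As the atlas of \<open>E\<close> is maximal, it contains all charts obtained from a given one by
  regrouping the coordinates.
\<close>

definition horiz :: "real^('n::finite + 'm::finite) \<Rightarrow> real^'n" where
  "horiz y = (\<chi> \<mu>. y $ Inl \<mu>)"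

definition vert :: "real^('n::finite + 'm::finite) \<Rightarrow> real^'m" where
  "vert y = (\<chi> i. y $ Inr i)"

definition submanifold :: "('e, real^('n::finite + 'm::finite)) chart set \<Rightarrow> 'e set \<Rightarrow> bool" where
  "submanifold A L \<longleftrightarrow>
     (\<forall>p\<in>L. \<exists>c\<in>A. p \<in> fst c \<and> snd c ` (fst c \<inter> L) = {y \<in> snd c ` fst c. vert y = 0})"

text \<open>Near \<open>p\<close>, and in the chart \<open>c\<close>, \<open>L\<close> is given by \<open>u\<^sup>i = f\<^sup>i(u\<^sup>\<mu>)\<close>.\<close>

definition graph_at ::
  "('e, real^('n::finite + 'm::finite)) chart \<Rightarrow> 'e set \<Rightarrow> 'e \<Rightarrow> (real^'n \<Rightarrow> real^'m) \<Rightarrow> bool" where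
  "graph_at c L p f \<longleftrightarrow>
     p \<in> L \<inter> fst c \<and>
     (\<exists>V. open V \<and> snd c p \<in> V \<and> V \<subseteq> snd c ` fst c \<and> smooth_on (horiz ` V) f \<and>
          (\<forall>y\<in>V. chart_inv c y \<in> L \<longleftrightarrow> vert y = f (horiz y)))"

text \<open>The condition is independent of the chart in which both submanifolds are graphs.\<close>

definition contact ::
  "('e, real^('n::finite + 'm::finite)) chart set \<Rightarrow> nat \<Rightarrow> 'e \<Rightarrow> 'e set \<Rightarrow> 'e set \<Rightarrow> bool" where
  "contact A r p L L' \<longleftrightarrow>
     (\<exists>c\<in>A. \<exists>f f'. graph_at c L p f \<and> graph_at c L' p f' \<and>
        same_derivs r f f' (horiz (snd c p)))"

type_synonym 'e jet = "'e \<times> 'e set set"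

definition jet ::
  "('e, real^('n::finite + 'm::finite)) chart set \<Rightarrow> nat \<Rightarrow> 'e set \<Rightarrow> 'e \<Rightarrow> 'e jet" where
  "jet A r L p = (p, {L'. submanifold A L' \<and> p \<in> L' \<and> contact A r p L L'})"

definition Jet :: "('e, real^('n::finite + 'm::finite)) chart set \<Rightarrow> nat \<Rightarrow> 'e jet set" where
  "Jet A r = {jet A r L p | L p. submanifold A L \<and> p \<in> L}"

text \<open>The constructions on jets below do not depend on the chosen representative.\<close>

definition jet_rep :: "'e jet \<Rightarrow> 'e set" where
  "jet_rep \<theta> = (SOME L. L \<in> snd \<theta>)"

definition jet_proj ::
  "('e, real^('n::finite + 'm::finite)) chart set \<Rightarrow> nat \<Rightarrow> 'e jet \<Rightarrow> 'e jet" where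
  "jet_proj A h \<theta> = jet A h (jet_rep \<theta>) (fst \<theta>)"

definition jet_prolongation ::
  "('e, real^('n::finite + 'm::finite)) chart set \<Rightarrow> nat \<Rightarrow> 'e set \<Rightarrow> 'e jet set" where
  "jet_prolongation A r L = jet A r L ` L"

text \<open>
  The chart \<open>(u\<^sup>\<mu>, u\<^sup>i, u\<^sup>i\<^sub>\<mu>)\<close> on first order jets induced by a chart of \<open>E\<close>; the coordinate \<open>u\<^sup>i\<^sub>\<mu>\<close>
  is \<open>snd (_) $ i $ \<mu>\<close>.
\<close>

definition jet1_chart ::
  "('e, real^('n::finite + 'm::finite)) chart set \<Rightarrow> ('e, real^('n + 'm)) chart \<Rightarrow>
   ('e jet, (real^('n + 'm)) \<times> (real^'n^'m)) chart" where
  "jet1_chart A c =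
     ({jet A 1 L p | L p. submanifold A L \<and> (\<exists>f. graph_at c L p f)},
      \<lambda>\<theta>. THE y. \<exists>L p f. submanifold A L \<and> graph_at c L p f \<and> \<theta> = jet A 1 L p \<and>
        y = (snd c p,
             \<chi> i \<mu>. frechet_derivative f (at (horiz (snd c p))) (axis \<mu> 1) $ i))"

definition jet1_atlas ::
  "('e, real^('n::finite + 'm::finite)) chart set \<Rightarrow>
   ('e jet, (real^('n + 'm)) \<times> (real^'n^'m)) chart set" where
  "jet1_atlas A = jet1_chart A ` A"

text \<open>
  The planes \<open>R\<^sub>\<theta>\<close> for \<open>\<theta>\<close> of first order (as subsets of the tangent space of \<open>E\<close>) and of second
  order (as subsets of the tangent space of the manifold of first order jets).
\<close>

definition R_plane1 ::
  "('e, real^('n::finite + 'm::finite)) chart set \<Rightarrow> 'e jet \<Rightarrow> ('e, real^('n + 'm)) tvec set" where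
  "R_plane1 A \<theta> = tangent_to A (jet_rep \<theta>) (fst \<theta>)"

definition R_plane2 ::
  "('e, real^('n::finite + 'm::finite)) chart set \<Rightarrow> 'e jet \<Rightarrow>
   ('e jet, (real^('n + 'm)) \<times> (real^'n^'m)) tvec set" where
  "R_plane2 A \<theta> =
     tangent_to (jet1_atlas A) (jet_prolongation A 1 (jet_rep \<theta>)) (jet_proj A 1 \<theta>)"


section \<open>The unparametrized equation\<close>

text \<open>Here \<open>Y\<close> is a local vector field on \<open>E\<close> extending a vector field on \<open>L\<close>.\<close>

definition second_fundamental_form_vanishes ::
  "('e::topological_space, real^('n::finite + 'm::finite)) chart set \<Rightarrow>
   ('e, real^('n + 'm)) connection \<Rightarrow> 'e set \<Rightarrow> 'e \<Rightarrow> bool" where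
  "second_fundamental_form_vanishes A \<Gamma> L p \<longleftrightarrow>
     (\<forall>X\<in>tangent_to A L p. \<forall>U Y.
        p \<in> U \<and> smooth_vector_field_on A U Y \<and> (\<forall>q\<in>L \<inter> U. Y q \<in> tangent_to A L q) \<longrightarrow>
        \<Gamma> p X Y \<in> tangent_to A L p)"

definition geod_eq ::
  "('e::topological_space, real^('n::finite + 'm::finite)) chart set \<Rightarrow>
   ('e, real^('n + 'm)) connection \<Rightarrow> 'e jet set" where
  "geod_eq A \<Gamma> =
     {jet A 2 L p | L p. submanifold A L \<and> p \<in> L \<and> second_fundamental_form_vanishes A \<Gamma> L p}"

definition dot_coeff ::
  "('e, real^('n::finite + 'm::finite)) chart set \<Rightarrow> ('e, real^('n + 'm)) connection \<Rightarrow>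
   ('e, real^('n + 'm)) chart \<Rightarrow> 'e jet \<Rightarrow> 'n + 'm \<Rightarrow> 'm \<Rightarrow> 'n \<Rightarrow> real" where
  "dot_coeff A \<Gamma> c \<theta> I k \<xi> =
     (let G = christoffel A \<Gamma> c (fst \<theta>);
          u = snd (snd (jet1_chart A c) \<theta>)
      in G I (Inr k) (Inl \<xi>) + (\<Sum>i\<in>UNIV. G I (Inr k) (Inr i) * u $ i $ \<xi>)
         - (\<Sum>\<beta>\<in>UNIV. u $ k $ \<beta> *
              (G I (Inl \<beta>) (Inl \<xi>) + (\<Sum>i\<in>UNIV. G I (Inl \<beta>) (Inr i) * u $ i $ \<xi>))))"

text \<open>
  The components along \<open>\<partial>/\<partial>u\<^sup>k\<^sub>\<xi>\<close> of the vertical projection of a tangent vector at \<open>\<theta>\<close>, in the jet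
  chart induced by \<open>c\<close>, and the horizontal vectors.
\<close>

definition dot_vertical ::
  "('e, real^('n::finite + 'm::finite)) chart set \<Rightarrow> ('e, real^('n + 'm)) connection \<Rightarrow>
   ('e, real^('n + 'm)) chart \<Rightarrow> 'e jet \<Rightarrow>
   ('e jet, (real^('n + 'm)) \<times> (real^'n^'m)) tvec \<Rightarrow> real^'n^'m" where
  "dot_vertical A \<Gamma> c \<theta> v =
     (\<chi> k \<xi>. snd (v (jet1_chart A c)) $ k $ \<xi>
        + (\<Sum>I\<in>UNIV. dot_coeff A \<Gamma> c \<theta> I k \<xi> * fst (v (jet1_chart A c)) $ I))"

definition dot_horizontal ::
  "('e, real^('n::finite + 'm::finite)) chart set \<Rightarrow> ('e, real^('n + 'm)) connection \<Rightarrow>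
   'e jet \<Rightarrow> ('e jet, (real^('n + 'm)) \<times> (real^'n^'m)) tvec set" where
  "dot_horizontal A \<Gamma> \<theta> =
     {v \<in> tangent_space (jet1_atlas A) \<theta>.
        \<forall>c\<in>A. \<theta> \<in> fst (jet1_chart A c) \<longrightarrow> dot_vertical A \<Gamma> c \<theta> v = 0}"

text \<open>The projection of first order jets to \<open>E\<close> is \<open>fst\<close>.\<close>

definition dot_lift ::
  "('e, real^('n::finite + 'm::finite)) chart set \<Rightarrow> ('e, real^('n + 'm)) connection \<Rightarrow>
   'e jet \<Rightarrow> ('e, real^('n + 'm)) tvec set \<Rightarrow>
   ('e jet, (real^('n + 'm)) \<times> (real^'n^'m)) tvec set" where
  "dot_lift A \<Gamma> \<theta> P = {v \<in> dot_horizontal A \<Gamma> \<theta>. tangent_map (jet1_atlas A) A fst \<theta> v \<in> P}"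

definition ddot ::
  "('e, real^('n::finite + 'm::finite)) chart set \<Rightarrow> ('e, real^('n + 'm)) connection \<Rightarrow>
   'e jet \<Rightarrow> 'e jet" where
  "ddot A \<Gamma> \<theta>\<^sub>1 =
     (THE \<theta>\<^sub>2. \<theta>\<^sub>2 \<in> Jet A 2 \<and> jet_proj A 1 \<theta>\<^sub>2 = \<theta>\<^sub>1 \<and>
        R_plane2 A \<theta>\<^sub>2 = dot_lift A \<Gamma> \<theta>\<^sub>1 (R_plane1 A \<theta>\<^sub>1))"


section \<open>Jets of local maps\<close>

text \<open>
  A local map around \<open>x\<close> is represented by a function on all of \<open>M\<close> that is smooth near \<open>x\<close>.
\<close>

definition smooth_at ::
  "('x::topological_space, 'b::euclidean_space) chart set \<Rightarrow> ('e, 'd::euclidean_space) chart set \<Rightarrow>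
   ('x \<Rightarrow> 'e) \<Rightarrow> 'x \<Rightarrow> bool" where
  "smooth_at AtM AtE s x \<longleftrightarrow> (\<exists>U. open U \<and> x \<in> U \<and> smooth_map_on AtM AtE U s)"

definition immersive_at ::
  "('x, 'b::euclidean_space) chart set \<Rightarrow> ('e, 'd::euclidean_space) chart set \<Rightarrow>
   ('x \<Rightarrow> 'e) \<Rightarrow> 'x \<Rightarrow> bool" where
  "immersive_at AtM AtE s x \<longleftrightarrow> inj_on (tangent_map AtM AtE s x) (tangent_space AtM x)"

definition smooth_embedding_on ::
  "('x::topological_space, 'b::euclidean_space) chart set \<Rightarrow>
   ('e::topological_space, 'd::euclidean_space) chart set \<Rightarrow> 'x set \<Rightarrow> ('x \<Rightarrow> 'e) \<Rightarrow> bool" where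
  "smooth_embedding_on AtM AtE U s \<longleftrightarrow>
     open U \<and> smooth_map_on AtM AtE U s \<and> (\<forall>x\<in>U. immersive_at AtM AtE s x) \<and>
     (\<exists>g. homeomorphism U (s ` U) s g)"

definition mcontact ::
  "('x, 'b::euclidean_space) chart set \<Rightarrow> ('e, 'd::euclidean_space) chart set \<Rightarrow> nat \<Rightarrow> 'x \<Rightarrow>
   ('x \<Rightarrow> 'e) \<Rightarrow> ('x \<Rightarrow> 'e) \<Rightarrow> bool" where
  "mcontact AtM AtE r x s s' \<longleftrightarrow>
     s x = s' x \<and>
     (\<forall>c\<in>AtM. \<forall>d\<in>AtE. x \<in> fst c \<and> s x \<in> fst d \<longrightarrow>
        same_derivs r (snd d \<circ> s \<circ> chart_inv c) (snd d \<circ> s' \<circ> chart_inv c) (snd c x))"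

type_synonym ('x, 'e) mjet = "'x \<times> ('x \<Rightarrow> 'e) set"

definition mjet ::
  "('x::topological_space, 'b::euclidean_space) chart set \<Rightarrow> ('e, 'd::euclidean_space) chart set \<Rightarrow>
   nat \<Rightarrow> ('x \<Rightarrow> 'e) \<Rightarrow> 'x \<Rightarrow> ('x, 'e) mjet" where
  "mjet AtM AtE r s x = (x, {s'. smooth_at AtM AtE s' x \<and> mcontact AtM AtE r x s s'})"

text \<open>Being immersive is a condition on the jet only if \<open>r \<ge> 1\<close>.\<close>

definition ImmJet ::
  "('x::topological_space, 'b::euclidean_space) chart set \<Rightarrow> ('e, 'd::euclidean_space) chart set \<Rightarrow>
   nat \<Rightarrow> ('x, 'e) mjet set" where
  "ImmJet AtM AtE r = {mjet AtM AtE r s x | s x. smooth_at AtM AtE s x \<and> immersive_at AtM AtE s x}"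

definition mjet_rep :: "('x, 'e) mjet \<Rightarrow> 'x \<Rightarrow> 'e" where
  "mjet_rep \<theta> = (SOME s. s \<in> snd \<theta>)"

definition mjet_proj ::
  "('x::topological_space, 'b::euclidean_space) chart set \<Rightarrow> ('e, 'd::euclidean_space) chart set \<Rightarrow>
   nat \<Rightarrow> ('x, 'e) mjet \<Rightarrow> ('x, 'e) mjet" where
  "mjet_proj AtM AtE h \<theta> = mjet AtM AtE h (mjet_rep \<theta>) (fst \<theta>)"

text \<open>
  The charts \<open>(x\<^sup>\<mu>, u\<^sup>A, u\<^sup>A\<^sub>\<mu>)\<close> on the manifold of first order jets of all local maps; the jets of
  immersions form an open subset, with the same tangent spaces.
\<close>

definition mjet1_chart ::
  "('x::topological_space, real^'n::finite) chart set \<Rightarrow> ('e, real^'k::finite) chart set \<Rightarrow>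
   ('x, real^'n) chart \<Rightarrow> ('e, real^'k) chart \<Rightarrow>
   (('x, 'e) mjet, (real^'n) \<times> (real^'k) \<times> (real^'n^'k)) chart" where
  "mjet1_chart AtM AtE c d =
     ({mjet AtM AtE 1 s x | s x. smooth_at AtM AtE s x \<and> x \<in> fst c \<and> s x \<in> fst d},
      \<lambda>\<theta>. let x = fst \<theta>; s = mjet_rep \<theta> in
        (snd c x, snd d (s x),
         \<chi> I \<mu>. frechet_derivative (snd d \<circ> s \<circ> chart_inv c) (at (snd c x)) (axis \<mu> 1) $ I))"

definition mjet1_atlas ::
  "('x::topological_space, real^'n::finite) chart set \<Rightarrow> ('e, real^'k::finite) chart set \<Rightarrow>
   (('x, 'e) mjet, (real^'n) \<times> (real^'k) \<times> (real^'n^'k)) chart set" where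
  "mjet1_atlas AtM AtE = {mjet1_chart AtM AtE c d | c d. c \<in> AtM \<and> d \<in> AtE}"

definition R_plane_param2 ::
  "('x::topological_space, real^'n::finite) chart set \<Rightarrow> ('e, real^'k::finite) chart set \<Rightarrow>
   ('x, 'e) mjet \<Rightarrow> (('x, 'e) mjet, (real^'n) \<times> (real^'k) \<times> (real^'n^'k)) tvec set" where
  "R_plane_param2 AtM AtE \<theta> =
     (let s = mjet_rep \<theta> in
      tangent_to (mjet1_atlas AtM AtE) {mjet AtM AtE 1 s y | y. smooth_at AtM AtE s y}
        (mjet_proj AtM AtE 1 \<theta>))"


section \<open>The parametrized equation\<close>

definition geod_eq_param ::
  "('x::topological_space, real^'n::finite) chart set \<Rightarrow> ('e, real^'k::finite) chart set \<Rightarrow>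
   ('x, real^'n) connection \<Rightarrow> ('e, real^'k) connection \<Rightarrow> ('x, 'e) mjet set" where
  "geod_eq_param AtM AtE \<Theta> \<Gamma> =
     {mjet AtM AtE 2 s x | s x. smooth_at AtM AtE s x \<and> immersive_at AtM AtE s x \<and>
        (\<forall>c\<in>AtM. \<forall>d\<in>AtE. x \<in> fst c \<and> s x \<in> fst d \<longrightarrow>
          (let F = snd d \<circ> s \<circ> chart_inv c;
               D = (\<lambda>\<xi> y. frechet_derivative F (at y) (axis \<xi> 1));
               u1 = (\<lambda>\<xi>. D \<xi> (snd c x));
               u2 = (\<lambda>\<xi> \<mu>. frechet_derivative (D \<mu>) (at (snd c x)) (axis \<xi> 1))
           in \<forall>C \<xi> \<mu>.
                u2 \<xi> \<mu> $ C
                + (\<Sum>A\<in>UNIV. \<Sum>B\<in>UNIV. christoffel AtE \<Gamma> d (s x) A C B * u1 \<xi> $ A * u1 \<mu> $ B)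
                - (\<Sum>\<eta>\<in>UNIV. christoffel AtM \<Theta> c x \<xi> \<eta> \<mu> * u1 \<eta> $ C) = 0))}"

definition ddot_param ::
  "('x::topological_space, real^'n::finite) chart set \<Rightarrow> ('e, real^'k::finite) chart set \<Rightarrow>
   ('x, real^'n) connection \<Rightarrow> ('e, real^'k) connection \<Rightarrow> ('x, 'e) mjet \<Rightarrow> ('x, 'e) mjet" where
  "ddot_param AtM AtE \<Theta> \<Gamma> \<theta>\<^sub>1 =
     (THE \<theta>\<^sub>2. \<theta>\<^sub>2 \<in> geod_eq_param AtM AtE \<Theta> \<Gamma> \<and> mjet_proj AtM AtE 1 \<theta>\<^sub>2 = \<theta>\<^sub>1)"


section \<open>The projection from parametrized to unparametrized jets\<close>

text \<open>The jet of the image does not depend on the representative \<open>s\<close> and the neighbourhood \<open>U\<close>.\<close>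

definition prE ::
  "('x::topological_space, real^'n::finite) chart set \<Rightarrow>
   ('e::topological_space, real^('n + 'm::finite)) chart set \<Rightarrow> nat \<Rightarrow>
   ('x, 'e) mjet \<Rightarrow> 'e jet" where
  "prE AtM AtE r \<theta> =
     (THE \<theta>'. \<exists>s U. s \<in> snd \<theta> \<and> fst \<theta> \<in> U \<and> smooth_embedding_on AtM AtE U s \<and>
        \<theta>' = jet AtE r (s ` U) (s (fst \<theta>)))"

definition section_with_image ::
  "('b \<Rightarrow> 'a) \<Rightarrow> ('a \<Rightarrow> 'b) \<Rightarrow> 'b set \<Rightarrow> 'a set \<Rightarrow> 'a set \<Rightarrow> bool" where
  "section_with_image \<sigma> \<pi> B J S \<longleftrightarrow>
     S \<subseteq> J \<and> \<sigma> ` B = S \<and> (\<forall>\<theta>\<in>B. \<pi> (\<sigma> \<theta>) = \<theta>)"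

end

theory Submission
  imports Defs
begin

text \<open>
  The proof rests on two facts about planes in spaces of first order jets and on one computation.

  \<^bold>\<open>Planes.\<close> Let \<open>N\<close> be a subset of a space with charts that is the image of a smooth map \<open>P\<close> with a
  differentiable local left inverse. A smooth curve in \<open>N\<close> is then the image of a differentiable curve in the
  parameters, so that the velocities of the curves in \<open>N\<close> form the image of the tangent map of \<open>P\<close>
  (\<open>tangent_to_param\<close>). This applies to a submanifold \<open>L\<close>, to its prolongation \<open>L\<^sup>(\<^sup>1\<^sup>)\<close>, and to the prolongation of
  a map \<open>s\<close>. If \<open>L\<close> is the image of an immersion \<open>s\<close>, with \<open>x\<close> ranging over the coordinates of \<open>M\<close>, the planes to
  be compared are the images of the tangent maps of \<open>x \<mapsto> [s]\<^sup>1\<^sub>x\<close> and of \<open>x \<mapsto> [L]\<^sup>1\<^sub>s\<^sub>(\<^sub>x\<^sub>)\<close>. The projection sends the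
  first parametrization to the second one, and by the chain rule its tangent map sends the first plane to
  the second one, vector by vector (\<open>tangent_map_prE\<close>). Both tangent maps are injective and linear, which gives
  the dimension \<open>n\<close> and the isomorphism. The chain rule needs the projection to be differentiable: if the
  \<open>n\<close>-plane spanned by the derivative of \<open>s\<close> is transversal to the vertical space of a chart of \<open>E\<close>, it is the
  graph of its \<open>slope\<close>, which is a rational function of the derivative.

  \<^bold>\<open>Jets as planes.\<close> Two submanifolds have the same first order jet iff they have the same tangent space
  (\<open>contact_1_iff\<close>), and the same second order jet iff moreover their prolongations have the same tangent space
  (\<open>contact_2_iff\<close>). The condition that defines \<open>ddot\<close> therefore has at most one solution. In a chart where \<open>L\<close> is
  a graph, the vertical projection of the connection on \<open>\<pi>\<^sub>1\<^sub>,\<^sub>0\<close>, applied to a tangent vector of \<open>L\<^sup>(\<^sup>1\<^sup>)\<close>, is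
  the second fundamental form (\<open>dot_vertical_graph\<close>). So the tangent space of \<open>L\<^sup>(\<^sup>1\<^sup>)\<close> is the horizontal lift if the
  second fundamental form vanishes (\<open>plane2_eq_dot_lift\<close>), and such an \<open>L\<close> is found through each first order
  jet: the graph of a quadratic polynomial whose second derivative is prescribed by the equation, namely as a bilinear
  map that is symmetric since \<open>\<Gamma>\<close> is torsion-free (\<open>section_ddot\<close>). On the parametrized side quadratic polynomials
  in one chart likewise solve the equation in that chart, and the left hand side of the equation is a tensor
  (\<open>hess_change\<close>), hence they solve it in all charts (\<open>section_ddot_param\<close>).

  \<^bold>\<open>The computation.\<close> If \<open>s\<close> solves the parametrized equation at \<open>x\<close>, its image is totally geodesic at
  \<open>s(x)\<close> (\<open>param_geodesic_image\<close>): modulo the tangent space of the image the term with \<open>\<Theta>\<close> drops out, and what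
  remains is the second fundamental form. Hence the second of the two planes above is the one that the
  unparametrized equation assigns to the projected jet.
\<close>

section \<open>Smooth calculus\<close>

abbreviation dif :: "('a::euclidean_space \<Rightarrow> 'b::euclidean_space) \<Rightarrow> 'a \<Rightarrow> 'a \<Rightarrow> 'b" where
  "dif f x \<equiv> frechet_derivative f (at x)"

text \<open>
  The field \<open>y \<mapsto> dif f y b\<close> is differentiated in the direction \<open>a\<close>: this is the order in which the iterated
  derivatives of the jet coordinates and of the equations are taken.
\<close>

abbreviation dif2 :: "('a::euclidean_space \<Rightarrow> 'b::euclidean_space) \<Rightarrow> 'a \<Rightarrow> 'a \<Rightarrow> 'a \<Rightarrow> 'b" where
  "dif2 f x a b \<equiv> dif (\<lambda>y. dif f y b) x a"

lemma dif_eqI: "(f has_derivative f') (at x) \<Longrightarrow> dif f x = f'"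
  using frechet_derivative_at by metis

lemma has_dif: "f differentiable (at x) \<Longrightarrow> (f has_derivative dif f x) (at x)"
  using frechet_derivative_works by blast

lemma linear_dif: "f differentiable (at x) \<Longrightarrow> linear (dif f x)"
  using has_dif has_derivative_linear by blast

lemma differentiable_cong_open:
  assumes "f differentiable (at x)" "open S" "x \<in> S" "\<And>y. y \<in> S \<Longrightarrow> f y = g y"
  shows "g differentiable (at x)"
  using assms has_derivative_transform_within_open unfolding differentiable_def by blast

lemma dif_cong_open:
  assumes "open S" "x \<in> S" "\<And>y. y \<in> S \<Longrightarrow> f y = g y"
  shows "dif f x = dif g x"
proof -
  have "(f has_derivative D) (at x) \<longleftrightarrow> (g has_derivative D) (at x)" for D
    using has_derivative_transform_within_open[of f D x UNIV S g]
      has_derivative_transform_within_open[of g D x UNIV S f] assms by auto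
  then show ?thesis by (simp add: frechet_derivative_def)
qed

lemma Ck_on_cong:
  assumes "open S" "\<And>x. x \<in> S \<Longrightarrow> f x = g x" "Ck_on k S f"
  shows "Ck_on k S g"
  using assms
proof (induction k arbitrary: f g)
  case 0
  then show ?case using continuous_on_cong[of S S f g] by simp
next
  case (Suc k)
  have "dif f x v = dif g x v" if "x \<in> S" for x v
    using dif_cong_open[of S x f g] Suc.prems that by simp
  then have "Ck_on k S (\<lambda>x. dif g x v)" for v
    using Suc.IH[of "\<lambda>x. dif f x v" "\<lambda>x. dif g x v"] Suc.prems by simp
  then show ?case using Suc.prems differentiable_cong_open[of f _ S g] by auto
qed

lemma Ck_on_subset: "Ck_on k S f \<Longrightarrow> T \<subseteq> S \<Longrightarrow> Ck_on k T f"
  by (induction k arbitrary: f) (auto intro: continuous_on_subset)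

lemma Ck_on_SucD: "Ck_on (Suc k) S f \<Longrightarrow> Ck_on k S f"
proof (induction k arbitrary: f)
  case 0
  then show ?case
    by (auto intro!: continuous_at_imp_continuous_on differentiable_imp_continuous_within)
next
  case (Suc k)
  then show ?case by (metis Ck_on.simps(2))
qed

text \<open>
  All closure properties below have the same proof: the derivative of the new function is given by a formula,
  to which the induction hypothesis applies.
\<close>

lemma Ck_on_SucI:
  assumes "open S" "\<And>x. x \<in> S \<Longrightarrow> (f has_derivative f' x) (at x)" "\<And>v. Ck_on k S (\<lambda>x. f' x v)"
  shows "Ck_on (Suc k) S f"
  using assms(2) Ck_on_cong[OF assms(1) _ assms(3)] dif_eqI[OF assms(2)]
  by (auto simp: differentiable_def)

lemma Ck_on_const: "Ck_on k S (\<lambda>x. c)"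
  by (induction k arbitrary: c) auto

lemma Ck_on_linear_comp:
  assumes "linear h" "open S" "Ck_on k S f"
  shows "Ck_on k S (\<lambda>x. h (f x))"
  using assms(3)
proof (induction k arbitrary: f)
  case 0
  then show ?case
    using linear_continuous_on_compose[OF _ assms(1)] by simp
next
  case (Suc k)
  have d: "((\<lambda>x. h (f x)) has_derivative (\<lambda>v. h (dif f x v))) (at x)" if "x \<in> S" for x
    using Suc.prems that assms(1)
    by (auto intro!: has_derivative_compose[OF has_dif] linear_imp_has_derivative)
  show ?case using Suc by (intro Ck_on_SucI[OF assms(2) d]) auto
qed

lemma Ck_on_add:
  assumes "open S" "Ck_on k S f" "Ck_on k S g"
  shows "Ck_on k S (\<lambda>x. f x + g x)"
  using assms(2,3)
proof (induction k arbitrary: f g)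
  case 0
  then show ?case by (auto intro: continuous_intros)
next
  case (Suc k)
  have d: "((\<lambda>x. f x + g x) has_derivative (\<lambda>v. dif f x v + dif g x v)) (at x)" if "x \<in> S" for x
    using Suc.prems that by (auto intro!: has_derivative_add has_dif)
  show ?case using Suc by (intro Ck_on_SucI[OF assms(1) d]) auto
qed

lemma Ck_on_bilinear:
  assumes "bounded_bilinear h" "open S" "Ck_on k S f" "Ck_on k S g"
  shows "Ck_on k S (\<lambda>x. h (f x) (g x))"
  using assms(3,4)
proof (induction k arbitrary: f g)
  case 0
  then show ?case using bounded_bilinear.continuous_on[OF assms(1)] by auto
next
  case (Suc k)
  have d: "((\<lambda>x. h (f x) (g x)) has_derivative (\<lambda>v. h (f x) (dif g x v) + h (dif f x v) (g x))) (at x)"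
    if "x \<in> S" for x
    using Suc.prems that by (auto intro!: bounded_bilinear.FDERIV[OF assms(1)] has_dif)
  have "Ck_on k S f" "Ck_on k S g" using Suc.prems Ck_on_SucD by blast+
  then show ?case
    using Suc.IH Suc.prems by (intro Ck_on_SucI[OF assms(2) d] Ck_on_add[OF assms(2)]) auto
qed

lemma Ck_on_sum:
  assumes "open S" "finite I" "\<And>i. i \<in> I \<Longrightarrow> Ck_on k S (f i)"
  shows "Ck_on k S (\<lambda>x. \<Sum>i\<in>I. f i x)"
  using assms(2,3) by (induction I rule: finite_induct) (auto intro: Ck_on_const Ck_on_add[OF assms(1)])

lemma dif_expand:
  assumes "f differentiable (at x)"
  shows "dif f x v = (\<Sum>b\<in>Basis. (v \<bullet> b) *\<^sub>R dif f x b)"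
proof -
  have l: "linear (dif f x)" by (rule linear_dif[OF assms])
  have "dif f x (\<Sum>b\<in>Basis. (v \<bullet> b) *\<^sub>R b) = (\<Sum>b\<in>Basis. (v \<bullet> b) *\<^sub>R dif f x b)"
    by (simp add: linear_sum[OF l] linear_cmul[OF l])
  then show ?thesis by (simp add: euclidean_representation)
qed

text \<open>
  In the chain rule the derivative of the outer function is evaluated at \<open>f x\<close> and at a vector that also depends
  on \<open>x\<close>. Expanding this vector in a basis separates the two dependences, and the induction hypothesis applies
  to each derivative of the outer function.
\<close>

lemma Ck_on_compose:
  assumes "open S" "open T" "f ` S \<subseteq> T" "Ck_on k T g" "Ck_on k S f"
  shows "Ck_on k S (\<lambda>x. g (f x))"
  using assms(4,5)
proof (induction k arbitrary: g)
  case 0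
  then show ?case using assms(3) by (auto intro: continuous_on_compose2)
next
  case (Suc k)
  have gd: "g differentiable (at (f x))" if "x \<in> S" for x
    using that Suc.prems assms(3) by auto
  have d: "((\<lambda>x. g (f x)) has_derivative (\<lambda>v. dif g (f x) (dif f x v))) (at x)" if "x \<in> S" for x
    using Suc.prems that gd by (auto intro!: has_derivative_compose[OF has_dif] has_dif)
  have "Ck_on k S f" using Suc.prems Ck_on_SucD by blast
  then have *: "Ck_on k S (\<lambda>x. dif g (f x) b)" for b
    using Suc.IH[of "\<lambda>y. dif g y b"] Suc.prems by simp
  have "Ck_on k S (\<lambda>x. \<Sum>b\<in>Basis. (dif f x v \<bullet> b) *\<^sub>R dif g (f x) b)" for v
    using Suc.prems
    by (intro Ck_on_sum Ck_on_bilinear[OF bounded_bilinear_scaleR] * assms(1) finite_Basis)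
       (auto intro!: Ck_on_linear_comp[where h="\<lambda>z. z \<bullet> _"] assms(1) bounded_linear.linear bounded_linear_inner_left)
  then have "Ck_on k S (\<lambda>x. dif g (f x) (dif f x v))" for v
    by (rule Ck_on_cong[OF assms(1), rotated]) (use dif_expand[OF gd] in simp)
  then show ?case by (intro Ck_on_SucI[OF assms(1) d])
qed

lemma smooth_on_cong: "open S \<Longrightarrow> (\<And>x. x \<in> S \<Longrightarrow> f x = g x) \<Longrightarrow> smooth_on S f \<Longrightarrow> smooth_on S g"
  unfolding smooth_on_def using Ck_on_cong by metis

lemma smooth_on_subset: "smooth_on S f \<Longrightarrow> T \<subseteq> S \<Longrightarrow> smooth_on T f"
  unfolding smooth_on_def using Ck_on_subset by metis

lemma smooth_on_const [intro!, simp]: "smooth_on S (\<lambda>x. c)"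
  unfolding smooth_on_def using Ck_on_const by metis

lemma smooth_on_linear_comp: "linear h \<Longrightarrow> open S \<Longrightarrow> smooth_on S f \<Longrightarrow> smooth_on S (\<lambda>x. h (f x))"
  unfolding smooth_on_def using Ck_on_linear_comp by metis

lemma smooth_on_add: "open S \<Longrightarrow> smooth_on S f \<Longrightarrow> smooth_on S g \<Longrightarrow> smooth_on S (\<lambda>x. f x + g x)"
  unfolding smooth_on_def using Ck_on_add by metis

lemma smooth_on_bilinear:
  "bounded_bilinear h \<Longrightarrow> open S \<Longrightarrow> smooth_on S f \<Longrightarrow> smooth_on S g \<Longrightarrow> smooth_on S (\<lambda>x. h (f x) (g x))"
  unfolding smooth_on_def using Ck_on_bilinear by metis

lemma smooth_on_sum:
  "open S \<Longrightarrow> finite I \<Longrightarrow> (\<And>i. i \<in> I \<Longrightarrow> smooth_on S (f i)) \<Longrightarrow> smooth_on S (\<lambda>x. \<Sum>i\<in>I. f i x)"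
  unfolding smooth_on_def by (blast intro: Ck_on_sum)

lemma smooth_on_compose:
  "smooth_on T g \<Longrightarrow> smooth_on S f \<Longrightarrow> open S \<Longrightarrow> open T \<Longrightarrow> f ` S \<subseteq> T \<Longrightarrow> smooth_on S (\<lambda>x. g (f x))"
  unfolding smooth_on_def using Ck_on_compose by metis

lemma smooth_on_minus: "open S \<Longrightarrow> smooth_on S f \<Longrightarrow> smooth_on S g \<Longrightarrow> smooth_on S (\<lambda>x. f x - g x)"
  using smooth_on_add[of S f "\<lambda>x. - g x"] smooth_on_linear_comp[of uminus S g]
  by (simp add: linear_uminus)

lemma smooth_on_mult:
  fixes f g :: "'a::euclidean_space \<Rightarrow> real"
  shows "open S \<Longrightarrow> smooth_on S f \<Longrightarrow> smooth_on S g \<Longrightarrow> smooth_on S (\<lambda>x. f x * g x)"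
  by (rule smooth_on_bilinear[OF bounded_bilinear_mult])

lemma smooth_on_prod:
  fixes f :: "'i \<Rightarrow> 'a::euclidean_space \<Rightarrow> real"
  assumes "open S" "finite I" "\<And>i. i \<in> I \<Longrightarrow> smooth_on S (f i)"
  shows "smooth_on S (\<lambda>x. \<Prod>i\<in>I. f i x)"
  using assms(2,3) by (induction I rule: finite_induct) (auto intro: smooth_on_mult[OF assms(1)])

lemma smooth_on_linear: "linear f \<Longrightarrow> smooth_on S f"
proof -
  assume l: "linear f"
  have "Ck_on k S f" for k
  proof (cases k)
    case 0
    then show ?thesis using l linear_continuous_on linear_conv_bounded_linear by auto
  next
    case (Suc j)
    have "dif f x = f" for x using l by (intro dif_eqI linear_imp_has_derivative)
    then show ?thesis using Suc l by (auto simp: Ck_on_const linear_imp_differentiable)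
  qed
  then show ?thesis by (simp add: smooth_on_def)
qed

lemma smooth_on_id: "smooth_on S (\<lambda>x. x)"
  by (rule smooth_on_linear) (rule linear_ident)

lemma smooth_onD: "smooth_on S f \<Longrightarrow> x \<in> S \<Longrightarrow> f differentiable (at x)"
  unfolding smooth_on_def by (metis Ck_on.simps(2))

lemma smooth_on_continuous: "smooth_on S f \<Longrightarrow> continuous_on S f"
  unfolding smooth_on_def by (metis Ck_on.simps(1))

lemma smooth_on_dif: "smooth_on S f \<Longrightarrow> smooth_on S (\<lambda>x. dif f x v)"
  unfolding smooth_on_def by (metis Ck_on.simps(2))

lemma smooth_on_vec:
  fixes f :: "'a::euclidean_space \<Rightarrow> 'b::euclidean_space ^ 'i"
  assumes "open S" "\<And>i. smooth_on S (\<lambda>x. f x $ i)"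
  shows "smooth_on S f"
proof -
  have l: "linear (axis i :: 'b \<Rightarrow> 'b^'i)" for i
    by (auto intro!: linearI simp: axis_def vec_eq_iff)
  have "smooth_on S (\<lambda>x. \<Sum>i\<in>UNIV. axis i (f x $ i))"
    by (intro smooth_on_sum smooth_on_linear_comp[OF l] assms) simp
  moreover have "(\<Sum>i\<in>UNIV. axis i (f x $ i)) = f x" for x
    by (simp add: vec_eq_iff axis_def if_distrib cong: if_cong)
  ultimately show ?thesis by simp
qed

lemma smooth_on_nth: "open S \<Longrightarrow> smooth_on S f \<Longrightarrow> smooth_on S (\<lambda>x. f x $ i)"
  for f :: "'a::euclidean_space \<Rightarrow> 'b::euclidean_space ^ 'i"
  by (rule smooth_on_linear_comp[where h="\<lambda>z. z $ i"]) (auto intro: linearI)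

lemma smooth_on_Pair: "open S \<Longrightarrow> smooth_on S f \<Longrightarrow> smooth_on S g \<Longrightarrow> smooth_on S (\<lambda>x. (f x, g x))"
  using smooth_on_add[of S "\<lambda>x. (f x, 0)" "\<lambda>x. (0, g x)"]
    smooth_on_linear_comp[of "\<lambda>z. (z, 0)" S f] smooth_on_linear_comp[of "\<lambda>z. (0, z)" S g]
  by (auto simp: linear_iff)

text \<open>
  The derivative of the inversion is a polynomial in the inversion, so the order of differentiability
  can be raised step by step.
\<close>

lemma smooth_on_inverse_real: "smooth_on {x::real. x \<noteq> 0} inverse"
proof -
  have o: "open {x::real. x \<noteq> 0}" by (simp add: open_Collect_neq)
  have d: "(inverse has_derivative (\<lambda>v. - (inverse x * v * inverse x))) (at x)" if "x \<noteq> 0" for x::real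
    using has_derivative_inverse'[OF that] by simp
  have "Ck_on k {x::real. x \<noteq> 0} inverse" for k
  proof (induction k)
    case 0
    then show ?case by (auto intro!: continuous_intros)
  next
    case (Suc k)
    have "Ck_on k {x::real. x \<noteq> 0} (\<lambda>x. (- v) * (inverse x * inverse x))" for v :: real
      using Suc by (intro Ck_on_bilinear[OF bounded_bilinear_mult o] Ck_on_const)
    then show ?case by (intro Ck_on_SucI[OF o d]) (simp_all add: algebra_simps)
  qed
  then show ?thesis by (simp add: smooth_on_def)
qed

lemma smooth_on_divide:
  fixes f g :: "'a::euclidean_space \<Rightarrow> real"
  assumes "open S" "smooth_on S f" "smooth_on S g" "\<And>x. x \<in> S \<Longrightarrow> g x \<noteq> 0"
  shows "smooth_on S (\<lambda>x. f x / g x)"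
  unfolding divide_inverse
  by (intro smooth_on_mult assms smooth_on_compose[OF smooth_on_inverse_real])
     (use assms(4) in \<open>auto simp: open_Collect_neq\<close>)

lemma smooth_on_det:
  fixes f :: "'a::euclidean_space \<Rightarrow> real^'n^'n"
  assumes "open S" "smooth_on S f"
  shows "smooth_on S (\<lambda>x. det (f x))"
  unfolding det_def
  by (intro smooth_on_sum smooth_on_mult smooth_on_prod smooth_on_nth assms smooth_on_const finite_permutations) auto

text \<open>
  Tangent maps in coordinates have this form: the derivative of a transition map at a moving point, applied
  to a moving vector.
\<close>

lemma smooth_on_dif_apply:
  assumes "smooth_on T \<phi>" "smooth_on S \<psi>" "smooth_on S Z" "open S" "open T" "\<psi> ` S \<subseteq> T"
  shows "smooth_on S (\<lambda>y. dif \<phi> (\<psi> y) (Z y))"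
proof -
  have "smooth_on S (\<lambda>y. \<Sum>b\<in>Basis. (Z y \<bullet> b) *\<^sub>R dif \<phi> (\<psi> y) b)"
    by (intro smooth_on_sum smooth_on_bilinear[OF bounded_bilinear_scaleR]
          smooth_on_compose[OF smooth_on_dif[OF assms(1)]] assms finite_Basis
          smooth_on_linear_comp[where h="\<lambda>z. z \<bullet> _"] bounded_linear.linear bounded_linear_inner_left)
  then show ?thesis
    by (rule smooth_on_cong[OF assms(4), rotated])
       (use assms(6) in \<open>auto intro!: dif_expand[symmetric] smooth_onD[OF assms(1)]\<close>)
qed

lemma dif_compose:
  assumes "f differentiable (at x)" "g differentiable (at (f x))"
  shows "dif (\<lambda>x. g (f x)) x v = dif g (f x) (dif f x v)"
  using frechet_derivative_compose[OF assms] by (simp add: o_def)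

lemma has_derivative_dif_apply:
  assumes "open T" "smooth_on T \<phi>" "\<psi> x \<in> T" "\<psi> differentiable (at x)" "Z differentiable (at x)"
  shows "((\<lambda>y. dif \<phi> (\<psi> y) (Z y)) has_derivative
     (\<lambda>a. dif2 \<phi> (\<psi> x) (dif \<psi> x a) (Z x) + dif \<phi> (\<psi> x) (dif Z x a))) (at x)"
proof -
  have sb: "(\<lambda>y. dif \<phi> y b) differentiable (at (\<psi> x))" for b
    using smooth_onD[OF smooth_on_dif[OF assms(2)] assms(3)] .
  obtain S where S: "open S" "x \<in> S" "\<And>y. y \<in> S \<Longrightarrow> \<psi> y \<in> T"
    using differentiable_imp_continuous_within[OF assms(4)] assms(1,3)
    by (metis continuous_at_open)
  have e: "dif \<phi> z w = (\<Sum>b\<in>Basis. (w \<bullet> b) *\<^sub>R dif \<phi> z b)" if "z \<in> T" for z w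
    by (rule dif_expand) (rule smooth_onD[OF assms(2) that])
  have d: "((\<lambda>y. \<Sum>b\<in>Basis. (Z y \<bullet> b) *\<^sub>R dif \<phi> (\<psi> y) b) has_derivative
     (\<lambda>a. \<Sum>b\<in>Basis. (Z x \<bullet> b) *\<^sub>R dif2 \<phi> (\<psi> x) (dif \<psi> x a) b + (dif Z x a \<bullet> b) *\<^sub>R dif \<phi> (\<psi> x) b)) (at x)"
    by (intro has_derivative_sum has_derivative_scaleR has_derivative_inner_left has_dif assms(5)
        has_derivative_compose[OF has_dif[OF assms(4)] has_dif[OF sb]])
  have e2: "dif2 \<phi> (\<psi> x) c w = (\<Sum>b\<in>Basis. (w \<bullet> b) *\<^sub>R dif2 \<phi> (\<psi> x) c b)" for c w
  proof -
    have "((\<lambda>y. \<Sum>b\<in>Basis. (w \<bullet> b) *\<^sub>R dif \<phi> y b) has_derivative (\<lambda>c. \<Sum>b\<in>Basis. (w \<bullet> b) *\<^sub>R dif2 \<phi> (\<psi> x) c b)) (at (\<psi> x))"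
      by (intro has_derivative_sum has_derivative_scaleR_right has_dif sb)
    then have "((\<lambda>y. dif \<phi> y w) has_derivative (\<lambda>c. \<Sum>b\<in>Basis. (w \<bullet> b) *\<^sub>R dif2 \<phi> (\<psi> x) c b)) (at (\<psi> x))"
      by (rule has_derivative_transform_within_open[OF _ assms(1,3)]) (simp add: e)
    from dif_eqI[OF this] show ?thesis by simp
  qed
  have "(\<lambda>a. \<Sum>b\<in>Basis. (Z x \<bullet> b) *\<^sub>R dif2 \<phi> (\<psi> x) (dif \<psi> x a) b + (dif Z x a \<bullet> b) *\<^sub>R dif \<phi> (\<psi> x) b)
      = (\<lambda>a. dif2 \<phi> (\<psi> x) (dif \<psi> x a) (Z x) + dif \<phi> (\<psi> x) (dif Z x a))"
    by (subst e2, subst (2) e[OF assms(3)]) (simp add: sum.distrib)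
  then show ?thesis
    using d by (auto intro: has_derivative_transform_within_open[OF _ S(1,2)] simp: e S(3))
qed

lemma dif2_compose:
  assumes "open T" "smooth_on T g" "f x \<in> T" "open S" "smooth_on S f" "x \<in> S"
  shows "dif2 (\<lambda>x. g (f x)) x a b = dif2 g (f x) (dif f x a) (dif f x b) + dif g (f x) (dif2 f x a b)"
proof -
  have "continuous_on S f" using smooth_on_continuous assms by blast
  then have o: "open (S \<inter> f -` T)" using assms by (metis continuous_open_preimage)
  have eq: "dif (\<lambda>x. g (f x)) y b = dif g (f y) (dif f y b)" if "y \<in> S \<inter> f -` T" for y
    using that by (intro dif_compose smooth_onD[OF assms(5)] smooth_onD[OF assms(2)]) auto
  have "dif2 (\<lambda>x. g (f x)) x a b = dif (\<lambda>y. dif g (f y) (dif f y b)) x a"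
    by (subst dif_cong_open[OF o _ eq]) (use assms in auto)
  also have "\<dots> = dif2 g (f x) (dif f x a) (dif f x b) + dif g (f x) (dif2 f x a b)"
  proof -
    have "((\<lambda>y. dif g (f y) (dif f y b)) has_derivative
      (\<lambda>a. dif2 g (f x) (dif f x a) (dif f x b) + dif g (f x) (dif2 f x a b))) (at x)"
      by (rule has_derivative_dif_apply[where \<psi>=f and Z="\<lambda>y. dif f y b", OF assms(1-3)])
         (use assms smooth_onD smooth_on_dif in blast)+
    from dif_eqI[OF this] show ?thesis by simp
  qed
  finally show ?thesis .
qed

lemma linear_dif2_left: "smooth_on S f \<Longrightarrow> x \<in> S \<Longrightarrow> linear (\<lambda>a. dif2 f x a b)"
  by (rule linear_dif) (metis smooth_onD smooth_on_dif)

lemma linear_dif2_right: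
  assumes "open S" "smooth_on S f" "x \<in> S"
  shows "linear (\<lambda>b. dif2 f x a b)"
proof (rule linearI)
  have db: "(\<lambda>y. dif f y b) differentiable (at x)" for b
    using smooth_onD smooth_on_dif assms by metis
  show "dif2 f x a (b + c) = dif2 f x a b + dif2 f x a c" for b c
  proof -
    have "dif2 f x a (b + c) = dif (\<lambda>y. dif f y b + dif f y c) x a"
      by (subst dif_cong_open[OF assms(1,3)])
         (auto intro: linear_add linear_dif smooth_onD[OF assms(2)])
    then show ?thesis
      using dif_eqI[OF has_derivative_add[OF has_dif has_dif], OF db db] by simp
  qed
  show "dif2 f x a (r *\<^sub>R b) = r *\<^sub>R dif2 f x a b" for r b
  proof -
    have "dif2 f x a (r *\<^sub>R b) = dif (\<lambda>y. r *\<^sub>R dif f y b) x a"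
      by (subst dif_cong_open[OF assms(1,3)])
         (auto intro: linear_cmul linear_dif smooth_onD[OF assms(2)])
    then show ?thesis
      using dif_eqI[OF has_derivative_scaleR_right[OF has_dif], OF db] by simp
  qed
qed


section \<open>Inverse functions and slopes of planes\<close>

lemma linear_horiz: "linear horiz" and linear_vert: "linear vert"
  by (auto intro!: linearI simp: horiz_def vert_def vec_eq_iff)

definition join :: "real^'n::finite \<Rightarrow> real^'m::finite \<Rightarrow> real^('n + 'm)" where
  "join a b = (\<chi> I. case I of Inl \<mu> \<Rightarrow> a $ \<mu> | Inr i \<Rightarrow> b $ i)"

lemma join_simps [simp]:
  "horiz (join a b) = a" "vert (join a b) = b" "join (horiz y) (vert y) = y"
  "join a b $ Inl \<mu> = a $ \<mu>" "join a b $ Inr i = b $ i"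
  by (auto simp: join_def horiz_def vert_def vec_eq_iff split: sum.splits)

lemma join_eq_iff: "y = z \<longleftrightarrow> horiz y = horiz z \<and> vert y = vert z"
  by (metis join_simps(3))

lemma linear_join: "linear (\<lambda>p. join (fst p) (snd p))"
  by (auto intro!: linearI simp: join_eq_iff linear_add[OF linear_horiz] linear_add[OF linear_vert]
      linear_cmul[OF linear_horiz] linear_cmul[OF linear_vert])

lemma join_add: "join a b + join c d = join (a + c) (b + d)"
  by (simp add: join_eq_iff linear_add[OF linear_horiz] linear_add[OF linear_vert])

lemma join_scale: "r *\<^sub>R join a b = join (r *\<^sub>R a) (r *\<^sub>R b)"
  by (simp add: join_eq_iff linear_cmul[OF linear_horiz] linear_cmul[OF linear_vert])

lemma smooth_on_join:
  assumes "open S" "smooth_on S f" "smooth_on S g"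
  shows "smooth_on S (\<lambda>x. join (f x) (g x))"
  using smooth_on_linear_comp[OF linear_join assms(1) smooth_on_Pair[OF assms]] by simp

lemma has_derivative_join:
  assumes "(f has_derivative f') (at x)" "(g has_derivative g') (at x)"
  shows "((\<lambda>x. join (f x) (g x)) has_derivative (\<lambda>v. join (f' v) (g' v))) (at x)"
  using has_derivative_compose[OF has_derivative_Pair[OF assms]
      linear_imp_has_derivative[OF linear_join]] by simp

lemma dif_linear_comp:
  assumes "linear h" "f differentiable (at x)"
  shows "dif (\<lambda>x. h (f x)) x v = h (dif f x v)"
proof -
  have "dif h (f x) = h" using assms(1) by (intro dif_eqI linear_imp_has_derivative)
  then show ?thesis using assms by (simp add: dif_compose linear_imp_differentiable)
qed

lemma open_horiz_image: "open V \<Longrightarrow> open (horiz ` V)"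
proof -
  assume V: "open V"
  have "surj (horiz :: real^('a + 'b) \<Rightarrow> real^'a)" by (rule surjI[of _ "\<lambda>a. join a 0"]) simp
  then show ?thesis using open_surjective_linear_image[OF V linear_horiz] by blast
qed

lemma continuous_on_horiz [continuous_intros]: "continuous_on S f \<Longrightarrow> continuous_on S (\<lambda>x. horiz (f x))"
  by (rule bounded_linear.continuous_on) (simp add: linear_horiz flip: linear_conv_bounded_linear)

definition hmat :: "real^'n^('n::finite + 'm::finite) \<Rightarrow> real^'n^'n" where
  "hmat B = (\<chi> i. B $ Inl i)"

definition vmat :: "real^'n^('n::finite + 'm::finite) \<Rightarrow> real^'n^'m" where
  "vmat B = (\<chi> i. B $ Inr i)"

text \<open>
  If the horizontal part of \<open>B\<close> is invertible, the range of \<open>B\<close> is the graph of \<open>slope B\<close>.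
\<close>

definition slope :: "real^'n^('n::finite + 'm::finite) \<Rightarrow> real^'n^'m" where
  "slope B = vmat B ** matrix_inv (hmat B)"

lemma horiz_mult: "horiz (B *v w) = hmat B *v w"
  by (simp add: horiz_def hmat_def matrix_vector_mult_def vec_eq_iff)

lemma vert_mult: "vert (B *v w) = vmat B *v w"
  by (simp add: vert_def vmat_def matrix_vector_mult_def vec_eq_iff)

lemma matrix_inv_right: "det A \<noteq> 0 \<Longrightarrow> A ** matrix_inv A = mat 1"
  and matrix_inv_left: "det A \<noteq> 0 \<Longrightarrow> matrix_inv A ** A = mat 1" for A :: "real^'n^'n"
  using someI_ex[of "\<lambda>A'. A ** A' = mat 1 \<and> A' ** A = mat 1"]
  unfolding invertible_det_nz[symmetric] invertible_def matrix_inv_def by auto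

lemma slope_eqI:
  assumes "det (hmat B) \<noteq> 0" "\<And>w. vert (B *v w) = M *v horiz (B *v w)"
  shows "slope B = M"
proof -
  have inv: "hmat B ** matrix_inv (hmat B) = mat 1"
    using assms(1) by (rule matrix_inv_right)
  have "vmat B = M ** hmat B"
    unfolding matrix_eq using assms(2) by (simp add: horiz_mult vert_mult matrix_vector_mul_assoc)
  then have "slope B = M ** (hmat B ** matrix_inv (hmat B))"
    by (simp add: slope_def matrix_mul_assoc)
  then show ?thesis by (simp add: inv)
qed

lemma det_hmat_iff: "det (hmat B) \<noteq> 0 \<longleftrightarrow> inj (\<lambda>w. horiz (B *v w))"
  unfolding horiz_mult using inj_matrix_vector_mult invertible_det_nz
    invertible_left_inverse matrix_left_invertible_injective by metis

lemma matrix_inv_cramer: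
  assumes "det A \<noteq> (0::real)"
  shows "matrix_inv A *v v = (\<chi> k. det (\<chi> i j. if j = k then v $ i else A $ i $ j) / det A)"
proof -
  have "A *v (matrix_inv A *v v) = v"
    using assms by (simp add: matrix_vector_mul_assoc matrix_inv_right)
  then show ?thesis using cramer[OF assms] by blast
qed

lemma smooth_on_cramer:
  fixes M :: "'a::euclidean_space \<Rightarrow> real^'n^'n"
  assumes "open S" "smooth_on S M" "\<And>x. x \<in> S \<Longrightarrow> det (M x) \<noteq> 0"
  shows "smooth_on S (\<lambda>x. matrix_inv (M x) *v v)"
proof -
  have "smooth_on S (\<lambda>x. \<chi> k. det (\<chi> i j. if j = k then v $ i else M x $ i $ j) / det (M x))"
  proof (rule smooth_on_vec[OF assms(1)])
    fix k
    have "smooth_on S (\<lambda>x. (\<chi> i j. if j = k then v $ i else M x $ i $ j) :: real^'n^'n)"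
    proof (intro smooth_on_vec[OF assms(1)])
      fix i j
      have "smooth_on S (\<lambda>x. M x $ i $ j)" by (intro smooth_on_nth assms)
      then show "smooth_on S (\<lambda>x. ((\<chi> i j. if j = k then v $ i else M x $ i $ j) :: real^'n^'n) $ i $ j)"
        by (cases "j = k") simp_all
    qed
    then show "smooth_on S (\<lambda>x. (\<chi> k. det (\<chi> i j. if j = k then v $ i else M x $ i $ j) / det (M x)) $ k)"
      using smooth_on_divide[OF assms(1) smooth_on_det[OF assms(1)] smooth_on_det[OF assms(1,2)] assms(3)]
      by simp
  qed
  then show ?thesis
    by (rule smooth_on_cong[OF assms(1), rotated]) (simp add: matrix_inv_cramer assms(3))
qed

lemma smooth_on_slope:
  fixes B :: "'a::euclidean_space \<Rightarrow> real^'n^('n::finite + 'm::finite)"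
  assumes "open S" "smooth_on S B" "\<And>x. x \<in> S \<Longrightarrow> det (hmat (B x)) \<noteq> 0"
  shows "smooth_on S (\<lambda>x. slope (B x))"
proof (intro smooth_on_vec[OF assms(1)])
  fix i j
  have "smooth_on S (\<lambda>x. hmat (B x))" unfolding hmat_def
    by (intro smooth_on_vec[OF assms(1)]) (simp add: smooth_on_nth assms)
  from smooth_on_cramer[OF assms(1) this assms(3), of "axis j 1"]
  have "smooth_on S (\<lambda>x. matrix_inv (hmat (B x)) *v axis j 1)" .
  then have "smooth_on S (\<lambda>x. \<Sum>k\<in>UNIV. B x $ Inr i $ k * (matrix_inv (hmat (B x)) *v axis j 1) $ k)"
    by (intro smooth_on_sum smooth_on_mult smooth_on_nth assms) auto
  then show "smooth_on S (\<lambda>x. slope (B x) $ i $ j)"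
    by (simp add: slope_def vmat_def matrix_matrix_mult_def matrix_vector_mult_basis column_def)
qed

lemma smooth_on_matrix_dif:
  fixes f :: "real^'n \<Rightarrow> real^'k"
  assumes "open S" "smooth_on S f"
  shows "smooth_on S (\<lambda>x. matrix (dif f x))"
  unfolding matrix_def
  by (intro smooth_on_vec[OF assms(1)]) (simp add: smooth_on_nth smooth_on_dif assms)

lemma matrix_dif_works: "f differentiable (at x) \<Longrightarrow> matrix (dif f x) *v v = dif f x v"
  for f :: "real^'n \<Rightarrow> real^'k"
  by (rule matrix_works) (simp add: linear_dif linear_def[symmetric] linear_matrix_vector_mul_eq)

text \<open>
  The inverse function theorem of class \<open>C\<^sup>1\<close> provides a differentiable inverse \<open>g\<close>. By Cramer's rule
  its derivative is a smooth function of \<open>g y\<close>, so \<open>g\<close> is as often differentiable as its derivative, hence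
  smooth.
\<close>

theorem smooth_inverse_function:
  fixes f :: "real^'n \<Rightarrow> real^'n"
  assumes S: "open S" and f: "smooth_on S f" and x0: "x0 \<in> S" and inj: "inj (dif f x0)"
  obtains U V g where "open U" "U \<subseteq> S" "x0 \<in> U" "open V" "\<And>x. x \<in> U \<Longrightarrow> f x \<in> V \<and> g (f x) = x"
    "\<And>y. y \<in> V \<Longrightarrow> g y \<in> U \<and> f (g y) = y" "smooth_on V g" "\<And>x. x \<in> U \<Longrightarrow> inj (dif f x)"
proof -
  define f' where "f' x = Blinfun (dif f x)" for x
  have fd: "f differentiable (at x)" if "x \<in> S" for x using smooth_onD[OF f that] .
  have f'[simp]: "blinfun_apply (f' x) = dif f x" if "x \<in> S" for x
    unfolding f'_def
    by (rule bounded_linear_Blinfun_apply) (metis fd that linear_dif linear_conv_bounded_linear)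
  have cont: "continuous_on S f'"
  proof (rule continuous_on_blinfun_componentwise)
    fix i :: "real^'n"
    have "continuous_on S (\<lambda>x. dif f x i)" using smooth_on_continuous smooth_on_dif f by blast
    then show "continuous_on S (\<lambda>x. blinfun_apply (f' x) i)"
      by (rule continuous_on_cong[THEN iffD1, rotated 2]) auto
  qed
  obtain h where h: "linear h" "h \<circ> dif f x0 = id"
    using linear_injective_left_inverse[OF linear_dif[OF fd[OF x0]] inj] by blast
  have bh: "blinfun_apply (Blinfun h) = h"
    using h(1) by (intro bounded_linear_Blinfun_apply) (simp add: linear_conv_bounded_linear)
  have inv: "Blinfun h o\<^sub>L f' x0 = id_blinfun"
    using h(2) x0 by (intro blinfun_eqI) (simp add: bh fun_eq_iff)
  obtain U V g g' where ift: "open U" "U \<subseteq> S" "x0 \<in> U" "open V" "homeomorphism U V f g"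
    "\<And>y. y \<in> V \<Longrightarrow> (g has_derivative (g' y)) (at y)"
    "\<And>y. y \<in> V \<Longrightarrow> g' y = inv (blinfun_apply (f'(g y)))"
    "\<And>y. y \<in> V \<Longrightarrow> bij (blinfun_apply (f'(g y)))"
    using inverse_function_theorem[OF S _ cont x0 inv] f' has_dif[OF fd] by metis
  have gU: "g y \<in> U \<and> f (g y) = y" if "y \<in> V" for y
    using ift(5) that by (force simp: homeomorphism_def)
  have fV: "f x \<in> V \<and> g (f x) = x" if "x \<in> U" for x
    using ift(5) that by (force simp: homeomorphism_def)
  have injU: "inj (dif f x)" if "x \<in> U" for x
    using ift(8)[of "f x"] fV[OF that] that ift(2) by (auto simp: bij_def)
  have det: "det (matrix (dif f x)) \<noteq> 0" if "x \<in> U" for x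
    using det_nz_iff_inj[OF linear_dif[OF fd]] injU[OF that] that ift(2) by blast
  have dg: "dif g y v = matrix_inv (matrix (dif f (g y))) *v v" if "y \<in> V" for y v
  proof -
    have gS: "g y \<in> S" using gU that ift(2) by blast
    have "dif g y v = inv (dif f (g y)) v"
      using dif_eqI[OF ift(6)[OF that]] ift(7)[OF that] f'[OF gS] by simp
    then have "matrix (dif f (g y)) *v dif g y v = v"
      using ift(8)[OF that] f'[OF gS] matrix_dif_works[OF fd[OF gS]]
      by (simp add: bij_is_surj surj_f_inv_f)
    then have "matrix_inv (matrix (dif f (g y))) ** matrix (dif f (g y)) *v dif g y v
        = matrix_inv (matrix (dif f (g y))) *v v"
      by (simp flip: matrix_vector_mul_assoc)
    then show ?thesis
      using det[of "g y"] gU[OF that] by (simp add: matrix_inv_left)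
  qed
  have "Ck_on k V g" for k
  proof (induction k)
    case 0
    then show ?case using ift(5) by (simp add: homeomorphism_def)
  next
    case (Suc k)
    have "smooth_on U (\<lambda>x. matrix_inv (matrix (dif f x)) *v v)" for v
      using det by (intro smooth_on_cramer smooth_on_matrix_dif ift smooth_on_subset[OF f])
    then have "Ck_on k V (\<lambda>y. matrix_inv (matrix (dif f (g y))) *v v)" for v
      using gU by (intro Ck_on_compose[OF ift(4,1) _ _ Suc]) (auto simp: smooth_on_def)
    then have "Ck_on k V (\<lambda>y. dif g y v)" for v
      by (rule Ck_on_cong[OF ift(4), rotated]) (simp add: dg)
    then show ?case using ift(6) by (auto simp: differentiable_def)
  qed
  then show ?thesis
    using that[OF ift(1-4) fV gU _ injU] by (simp add: smooth_on_def)
qed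

section \<open>Curves in parametrized subsets\<close>

text \<open>
  Smoothness of a map from an open subset of a Euclidean space, without the trivial atlas of the domain.
\<close>

definition smooth_into :: "('a, 'b::euclidean_space) chart set \<Rightarrow> 'p::euclidean_space set \<Rightarrow> ('p \<Rightarrow> 'a) \<Rightarrow> bool" where
  "smooth_into B \<Omega> P \<longleftrightarrow>
     (\<forall>d\<in>B. open {x \<in> \<Omega>. P x \<in> fst d} \<and> smooth_on {x \<in> \<Omega>. P x \<in> fst d} (\<lambda>x. snd d (P x)))"

text \<open>
  The tangent map of \<open>P\<close>, with values in families of coordinate vectors.
\<close>

definition push :: "('a, 'b::euclidean_space) chart set \<Rightarrow> ('p::euclidean_space \<Rightarrow> 'a) \<Rightarrow> 'p \<Rightarrow> 'p \<Rightarrow> ('a, 'b) tvec" where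
  "push B P x w = (\<lambda>d. if d \<in> B \<and> P x \<in> fst d then dif (\<lambda>y. snd d (P y)) x w else 0)"

lemma chart_inv_std: "chart_inv (UNIV, \<lambda>x. x) = (\<lambda>y. y)"
  by (auto simp: chart_inv_def fun_eq_iff intro!: inv_into_f_eq)

lemma smooth_map_on_std: "smooth_map_on std_atlas B \<Omega> P \<longleftrightarrow> smooth_into B \<Omega> P"
  by (simp add: smooth_map_on_def smooth_into_def std_atlas_def chart_inv_std o_def)

lemma smooth_intoD:
  assumes "smooth_into B \<Omega> P" "d \<in> B"
  shows "open {x \<in> \<Omega>. P x \<in> fst d}" "smooth_on {x \<in> \<Omega>. P x \<in> fst d} (\<lambda>x. snd d (P x))"
  using assms by (auto simp: smooth_into_def)

lemma smooth_into_differentiable: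
  assumes "smooth_into B \<Omega> P" "d \<in> B" "x \<in> \<Omega>" "P x \<in> fst d"
  shows "(\<lambda>y. snd d (P y)) differentiable (at x)"
  using smooth_onD[OF smooth_intoD(2)[OF assms(1,2)]] assms by auto

lemma smooth_into_compose:
  assumes P: "smooth_into B \<Omega> P" and S: "open S" "smooth_on S \<xi>" "\<xi> ` S \<subseteq> \<Omega>"
  shows "smooth_into B S (\<lambda>t. P (\<xi> t))"
  unfolding smooth_into_def
proof (intro ballI conjI)
  fix d assume d: "d \<in> B"
  have eq: "{x \<in> S. P (\<xi> x) \<in> fst d} = S \<inter> \<xi> -` {x \<in> \<Omega>. P x \<in> fst d}"
    using S(3) by auto
  show o: "open {x \<in> S. P (\<xi> x) \<in> fst d}" unfolding eq
    using continuous_open_preimage[OF smooth_on_continuous[OF S(2)] S(1) smooth_intoD(1)[OF P d]] .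
  show "smooth_on {x \<in> S. P (\<xi> x) \<in> fst d} (\<lambda>x. snd d (P (\<xi> x)))"
    by (rule smooth_on_compose[OF smooth_intoD(2)[OF P d] smooth_on_subset[OF S(2)] o smooth_intoD(1)[OF P d]])
       (use S(3) in auto)
qed

lemma smooth_into_subset:
  "smooth_into B \<Omega> P \<Longrightarrow> open S \<Longrightarrow> S \<subseteq> \<Omega> \<Longrightarrow> smooth_into B S P"
  using smooth_into_compose[of B \<Omega> P S "\<lambda>x. x"] by (simp add: smooth_on_id)

lemma linear_push:
  assumes "smooth_into B \<Omega> P" "x \<in> \<Omega>"
  shows "linear (push B P x)"
  using linear_dif[OF smooth_into_differentiable[OF assms(1) _ assms(2)]]
  by (auto intro!: linearI simp: push_def fun_eq_iff scaleR_fun_def linear_add linear_cmul)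

text \<open>
  A curve that factors through \<open>P\<close> has the velocity prescribed by the chain rule, in all charts at once. The curve
  of parameters \<open>\<xi>\<close> is only assumed to be differentiable at \<open>0\<close>.
\<close>

lemma velocity_param:
  assumes P: "smooth_into B \<Omega> P" "\<xi> 0 \<in> \<Omega>"
    and \<xi>: "(\<xi> has_vector_derivative w) (at 0)"
    and S: "open S" "0 \<in> S" "\<And>t. t \<in> S \<Longrightarrow> \<gamma> t = P (\<xi> t)"
  shows "velocity B \<gamma> = push B P (\<xi> 0) w"
proof
  fix d
  show "velocity B \<gamma> d = push B P (\<xi> 0) w d"
  proof (cases "d \<in> B \<and> P (\<xi> 0) \<in> fst d")
    case True
    have "((\<lambda>t. snd d (P (\<xi> t))) has_derivative (\<lambda>t. dif (\<lambda>y. snd d (P y)) (\<xi> 0) (t *\<^sub>R w))) (at 0)"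
      using \<xi> True P by (intro has_derivative_compose[OF _ has_dif] smooth_into_differentiable[where \<Omega>=\<Omega>])
        (auto simp: has_vector_derivative_def)
    moreover have "linear (dif (\<lambda>y. snd d (P y)) (\<xi> 0))"
      using True P by (intro linear_dif smooth_into_differentiable[where \<Omega>=\<Omega>]) auto
    ultimately have "((\<lambda>t. snd d (P (\<xi> t))) has_vector_derivative dif (\<lambda>y. snd d (P y)) (\<xi> 0) w) (at 0)"
      by (simp add: has_vector_derivative_def linear_cmul)
    then have "((snd d \<circ> \<gamma>) has_vector_derivative dif (\<lambda>y. snd d (P y)) (\<xi> 0) w) (at 0)"
      by (rule has_vector_derivative_transform_within_open[OF _ S(1,2)]) (simp add: S(3))
    then show ?thesis
      using True S(2,3) by (simp add: velocity_def push_def vector_derivative_at)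
  next
    case False
    then show ?thesis using S(2,3) by (auto simp: velocity_def push_def)
  qed
qed

text \<open>
  Composing with the left inverse \<open>h\<close> turns a smooth curve in \<open>N\<close> into a differentiable curve of
  parameters; conversely, lines in the parameter space give curves in \<open>N\<close>. Only the values of \<open>P\<close> in the charts
  enter, so that \<open>B\<close> may be any set of charts, such as those of first order jets.
\<close>

theorem tangent_to_param:
  fixes P :: "'p::euclidean_space \<Rightarrow> 'a" and B :: "('a, 'b::euclidean_space) chart set"
  assumes \<Omega>: "open \<Omega>" "x0 \<in> \<Omega>" and P: "smooth_into B \<Omega> P" and N: "P ` \<Omega> \<subseteq> N"
    and C: "C \<in> B" "P x0 \<in> fst C" and W: "open W" "snd C (P x0) \<in> W"
    and h: "h differentiable (at (snd C (P x0)))"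
    and inv: "\<And>q. q \<in> N \<Longrightarrow> q \<in> fst C \<Longrightarrow> snd C q \<in> W \<Longrightarrow> h (snd C q) \<in> \<Omega> \<and> P (h (snd C q)) = q"
    and left: "\<And>x. x \<in> \<Omega> \<Longrightarrow> P x \<in> fst C \<Longrightarrow> snd C (P x) \<in> W \<Longrightarrow> h (snd C (P x)) = x"
  shows "tangent_to B N (P x0) = range (push B P x0)" "inj (push B P x0)"
proof -
  have CP: "(\<lambda>y. snd C (P y)) differentiable (at x0)"
    by (rule smooth_into_differentiable[OF P C(1) \<Omega>(2) C(2)])
  show "inj (push B P x0)"
  proof -
    have o: "open ({x \<in> \<Omega>. P x \<in> fst C} \<inter> (\<lambda>x. snd C (P x)) -` W)"
      by (rule continuous_open_preimage[OF smooth_on_continuous[OF smooth_intoD(2)[OF P C(1)]]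
          smooth_intoD(1)[OF P C(1)] W(1)])
    have "dif (\<lambda>x. h (snd C (P x))) x0 w = dif (\<lambda>x. x) x0 w" for w
      by (rule arg_cong[where f="\<lambda>f. f w"], rule dif_cong_open[OF o]) (use left \<Omega> C W in auto)
    then have id: "dif h (snd C (P x0)) (dif (\<lambda>y. snd C (P y)) x0 w) = w" for w
      using dif_compose[OF CP h] by (simp add: frechet_derivative_ident)
    show ?thesis
    proof (rule injI)
      fix v w assume "push B P x0 v = push B P x0 w"
      then have "push B P x0 v C = push B P x0 w C" by simp
      then show "v = w" using C id by (simp add: push_def) metis
    qed
  qed
  show "tangent_to B N (P x0) = range (push B P x0)"
  proof (intro equalityI subsetI)
    fix v assume "v \<in> tangent_to B N (P x0)"
    then obtain \<gamma> \<epsilon> where \<gamma>: "v = velocity B \<gamma>" "\<epsilon> > 0" "\<gamma> 0 = P x0" "\<gamma> ` {-\<epsilon><..<\<epsilon>} \<subseteq> N"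
      "smooth_into B {-\<epsilon><..<\<epsilon>} \<gamma>"
      unfolding tangent_to_def smooth_map_on_std by blast
    let ?S = "{t \<in> {-\<epsilon><..<\<epsilon>}. \<gamma> t \<in> fst C} \<inter> (\<lambda>t. snd C (\<gamma> t)) -` W"
    have S: "open ?S"
      by (rule continuous_open_preimage[OF smooth_on_continuous[OF smooth_intoD(2)[OF \<gamma>(5) C(1)]]
          smooth_intoD(1)[OF \<gamma>(5) C(1)] W(1)])
    have 0: "0 \<in> ?S" using \<gamma> C W by auto
    define \<xi> where "\<xi> = (\<lambda>t. h (snd C (\<gamma> t)))"
    have "(\<lambda>t. snd C (\<gamma> t)) differentiable (at 0)"
      by (rule smooth_into_differentiable[OF \<gamma>(5) C(1)]) (use \<gamma> C in auto)
    then have "\<xi> differentiable (at 0)"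
      using h \<gamma>(3) differentiable_chain_at[of "\<lambda>t. snd C (\<gamma> t)" 0 h] by (simp add: \<xi>_def o_def)
    then obtain w where w: "(\<xi> has_vector_derivative w) (at 0)"
      using vector_derivative_works by blast
    have x0: "\<xi> 0 = x0" using left[OF \<Omega>(2) C(2) W(2)] \<gamma>(3) by (simp add: \<xi>_def)
    have "\<gamma> t = P (\<xi> t)" if "t \<in> ?S" for t
      using inv[of "\<gamma> t"] \<gamma>(4) that by (auto simp: \<xi>_def image_subset_iff)
    then have "v = push B P x0 w"
      using velocity_param[OF P _ w S 0] \<Omega> \<gamma>(1) x0 by metis
    then show "v \<in> range (push B P x0)" by simp
  next
    fix v assume "v \<in> range (push B P x0)"
    then obtain w where v: "v = push B P x0 w" by blast
    define \<xi> where "\<xi> t = x0 + t *\<^sub>R w" for t :: real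
    have "continuous_on UNIV \<xi>" unfolding \<xi>_def by (intro continuous_intros)
    then have "open (\<xi> -` \<Omega>)" using \<Omega>(1) open_vimage by blast
    moreover have "0 \<in> \<xi> -` \<Omega>" using \<Omega> by (simp add: \<xi>_def)
    ultimately obtain \<epsilon> where \<epsilon>: "\<epsilon> > 0" "ball 0 \<epsilon> \<subseteq> \<xi> -` \<Omega>" using openE by blast
    have I: "{-\<epsilon><..<\<epsilon>} = ball 0 \<epsilon>" by (auto simp: dist_real_def)
    have "smooth_on {-\<epsilon><..<\<epsilon>} \<xi>" unfolding \<xi>_def
      by (intro smooth_on_add smooth_on_const smooth_on_linear) (auto intro: linearI simp: algebra_simps)
    then have sm: "smooth_into B {-\<epsilon><..<\<epsilon>} (\<lambda>t. P (\<xi> t))"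
      using smooth_into_compose[OF P, of "{-\<epsilon><..<\<epsilon>}" \<xi>] \<epsilon> I by (metis image_subset_iff_subset_vimage open_ball)
    have "(\<xi> has_vector_derivative w) (at 0)" unfolding \<xi>_def
      by (auto intro!: derivative_eq_intros simp: has_vector_derivative_def)
    then have "velocity B (\<lambda>t. P (\<xi> t)) = push B P x0 w"
      using velocity_param[OF P, of \<xi> w UNIV "\<lambda>t. P (\<xi> t)"] \<Omega> by (simp add: \<xi>_def)
    then show "v \<in> tangent_to B N (P x0)"
      unfolding tangent_to_def smooth_map_on_std v
      using sm \<epsilon> I N by (intro CollectI exI[of _ "\<lambda>t. P (\<xi> t)"]) (auto simp: \<xi>_def image_subset_iff intro!: exI[of _ \<epsilon>])
  qed
qed

lemma range_linear_inj:
  fixes f :: "real^'n \<Rightarrow> 'v::real_vector"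
  assumes "linear f" "inj f"
  shows "subspace (range f)" "dim (range f) = CARD('n)"
proof -
  show "subspace (range f)" using linear_subspace_image[OF assms(1) subspace_UNIV] .
  have ind: "independent (f ` Basis)"
    using linear_independent_injective_image[OF assms(1) independent_Basis] assms(2) inj_on_subset by blast
  have "range f = span (f ` Basis)"
    using linear_span_image[OF assms(1), of Basis] by simp
  then have "dim (range f) = card (f ` (Basis :: (real^'n) set))"
    using dim_span_eq_card_independent[OF ind] by simp
  also have "\<dots> = card (Basis :: (real^'n) set)"
    using assms(2) card_image inj_on_subset by blast
  finally show "dim (range f) = CARD('n)" by simp
qed

section \<open>Charts of a smooth manifold\<close>

lemma manifold_chart: "smooth_manifold A \<Longrightarrow> c \<in> A \<Longrightarrow> topological_chart c"
  by (simp add: smooth_manifold_def)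

lemma manifold_cover: "smooth_manifold A \<Longrightarrow> \<exists>c\<in>A. p \<in> fst c"
  unfolding smooth_manifold_def by blast

lemma chart_inv_works:
  assumes "topological_chart c"
  shows "q \<in> fst c \<Longrightarrow> chart_inv c (snd c q) = q"
    and "y \<in> snd c ` fst c \<Longrightarrow> snd c (chart_inv c y) = y"
    and "y \<in> snd c ` fst c \<Longrightarrow> chart_inv c y \<in> fst c"
  using assms by (force simp: topological_chart_def homeomorphism_def)+

lemma chart_open: "topological_chart c \<Longrightarrow> open (fst c)" "topological_chart c \<Longrightarrow> open (snd c ` fst c)"
  by (auto simp: topological_chart_def)

lemma chart_inj: "topological_chart c \<Longrightarrow> inj_on (snd c) (fst c)"
  by (metis chart_inv_works(1) inj_onI)

lemma chart_continuous:
  assumes "topological_chart c"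
  shows "continuous_on (fst c) (snd c)" "continuous_on (snd c ` fst c) (chart_inv c)"
  using assms by (auto simp: topological_chart_def homeomorphism_def)

lemma open_chart_image:
  assumes "topological_chart c" "open W"
  shows "open (snd c ` (fst c \<inter> W))"
proof -
  have "homeomorphism (fst c) (snd c ` fst c) (snd c) (chart_inv c)"
    using assms(1) by (simp add: topological_chart_def)
  then have "openin (top_of_set (snd c ` fst c)) (snd c ` (fst c \<inter> W))"
    using homeomorphism_imp_open_map openin_open_Int assms(2) by blast
  then show ?thesis using chart_open(2)[OF assms(1)] openin_open_trans by blast
qed

lemma open_chart_inv_image:
  assumes "topological_chart c" "open V" "V \<subseteq> snd c ` fst c"
  shows "open (chart_inv c ` V)"
proof -
  have "chart_inv c ` V = fst c \<inter> snd c -` V"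
    using chart_inv_works[OF assms(1)] assms(3) by (auto simp: image_iff subset_iff) metis+
  then show ?thesis
    using continuous_open_preimage[OF chart_continuous(1) chart_open(1)] assms by simp
qed

lemma transition_apply: "transition c d y = snd d (chart_inv c y)"
  by (simp add: transition_def)

lemma transition_snd: "topological_chart c \<Longrightarrow> p \<in> fst c \<Longrightarrow> transition c d (snd c p) = snd d p"
  by (simp add: transition_apply chart_inv_works)

lemma smooth_transition:
  "smooth_manifold A \<Longrightarrow> c \<in> A \<Longrightarrow> d \<in> A \<Longrightarrow> smooth_on (snd c ` (fst c \<inter> fst d)) (transition c d)"
  by (auto simp: smooth_manifold_def compatible_def)

lemma open_overlap:
  "smooth_manifold A \<Longrightarrow> c \<in> A \<Longrightarrow> d \<in> A \<Longrightarrow> open (snd c ` (fst c \<inter> fst d))"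
  by (intro open_chart_image manifold_chart chart_open(1))

lemma transition_differentiable:
  "smooth_manifold A \<Longrightarrow> c \<in> A \<Longrightarrow> d \<in> A \<Longrightarrow> p \<in> fst c \<Longrightarrow> p \<in> fst d \<Longrightarrow>
     transition c d differentiable (at (snd c p))"
  by (rule smooth_onD[OF smooth_transition]) auto

lemma dif_transition_cocycle:
  assumes A: "smooth_manifold A" and "c \<in> A" "d \<in> A" "e \<in> A" "p \<in> fst c" "p \<in> fst d" "p \<in> fst e"
  shows "dif (transition d e) (snd d p) (dif (transition c d) (snd c p) z) = dif (transition c e) (snd c p) z"
proof -
  note [simp] = chart_inv_works[OF manifold_chart[OF A \<open>c \<in> A\<close>]] chart_inv_works[OF manifold_chart[OF A \<open>d \<in> A\<close>]]
  have "dif (\<lambda>y. transition d e (transition c d y)) (snd c p) = dif (transition c e) (snd c p)"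
    by (rule dif_cong_open[OF open_overlap[OF A assms(2,3)]]) (use assms in \<open>auto simp: transition_apply\<close>)
  moreover have "transition c d (snd c p) = snd d p" using assms by (simp add: transition_apply)
  ultimately show ?thesis
    using dif_compose[of "transition c d" "snd c p" "transition d e"] transition_differentiable[OF A] assms
    by metis
qed

lemma dif_transition_self:
  assumes A: "smooth_manifold A" and "c \<in> A" "p \<in> fst c"
  shows "dif (transition c c) (snd c p) z = z"
proof -
  have "dif (transition c c) (snd c p) = dif (\<lambda>y. y) (snd c p)"
    by (rule dif_cong_open[OF open_overlap[OF A assms(2,2)]])
       (use assms chart_inv_works[OF manifold_chart[OF A \<open>c \<in> A\<close>]] in \<open>auto simp: transition_apply\<close>)
  then show ?thesis by (simp add: frechet_derivative_ident)
qed

text \<open>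
  The tangent vector with coordinates \<open>z\<close> in the chart \<open>c\<close>.
\<close>

definition tvec_of :: "('a, 'b::euclidean_space) chart set \<Rightarrow> ('a, 'b) chart \<Rightarrow> 'a \<Rightarrow> 'b \<Rightarrow> ('a, 'b) tvec" where
  "tvec_of A c p z = (\<lambda>d. if d \<in> A \<and> p \<in> fst d then dif (transition c d) (snd c p) z else 0)"

lemma tvec_of_same: "smooth_manifold A \<Longrightarrow> c \<in> A \<Longrightarrow> p \<in> fst c \<Longrightarrow> tvec_of A c p z c = z"
  by (simp add: tvec_of_def dif_transition_self)

lemma tvec_of_tangent:
  "smooth_manifold A \<Longrightarrow> c \<in> A \<Longrightarrow> p \<in> fst c \<Longrightarrow> tvec_of A c p z \<in> tangent_space A p"
  by (auto simp: tangent_space_def tvec_of_def dif_transition_cocycle)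

lemma tangent_vec_change:
  "v \<in> tangent_space A p \<Longrightarrow> c \<in> A \<Longrightarrow> d \<in> A \<Longrightarrow> p \<in> fst c \<Longrightarrow> p \<in> fst d \<Longrightarrow>
    v d = dif (transition c d) (snd c p) (v c)"
  unfolding tangent_space_def by blast

lemma tangent_vec_outside: "v \<in> tangent_space A p \<Longrightarrow> \<not> (c \<in> A \<and> p \<in> fst c) \<Longrightarrow> v c = 0"
  unfolding tangent_space_def by blast

lemma tangent_space_eqI:
  assumes "v \<in> tangent_space B p" "w \<in> tangent_space B p" "c \<in> B" "p \<in> fst c" "v c = w c"
  shows "v = w"
proof
  fix d show "v d = w d"
    using assms tangent_vec_change[of _ B p c d] tangent_vec_outside[of _ B p d]
    by (cases "d \<in> B \<and> p \<in> fst d") metis+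
qed

lemma tangent_vec_eq:
  "smooth_manifold A \<Longrightarrow> c \<in> A \<Longrightarrow> p \<in> fst c \<Longrightarrow> v \<in> tangent_space A p \<Longrightarrow> v = tvec_of A c p (v c)"
  by (rule tangent_space_eqI[OF _ tvec_of_tangent]) (auto simp: tvec_of_same)

lemma subspace_tangent_space:
  assumes A: "smooth_manifold A"
  shows "subspace (tangent_space A p)"
proof -
  have l: "linear (dif (transition c d) (snd c p))" if "c \<in> A" "d \<in> A" "p \<in> fst c \<inter> fst d" for c d
    using linear_dif[OF transition_differentiable[OF A]] that by blast
  show ?thesis
    unfolding subspace_def
  proof (intro conjI ballI allI)
    show "0 \<in> tangent_space A p"
      unfolding tangent_space_def by (simp add: linear_0[OF l])
  next
    fix v w assume vw: "v \<in> tangent_space A p" "w \<in> tangent_space A p"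
    have "(v + w) d = dif (transition c d) (snd c p) ((v + w) c)"
      if "c \<in> A" "d \<in> A" "p \<in> fst c \<inter> fst d" for c d
      using linear_add[OF l[OF that]] tangent_vec_change[OF vw(1), of c d]
        tangent_vec_change[OF vw(2), of c d] that by (simp del: split_paired_All)
    moreover have "(v + w) c = 0" if "\<not> (c \<in> A \<and> p \<in> fst c)" for c
      using tangent_vec_outside[OF vw(1) that] tangent_vec_outside[OF vw(2) that] by simp
    ultimately show "v + w \<in> tangent_space A p"
      unfolding tangent_space_def by blast
  next
    fix r v assume v: "v \<in> tangent_space A p"
    have "(r *\<^sub>R v) d = dif (transition c d) (snd c p) ((r *\<^sub>R v) c)"
      if "c \<in> A" "d \<in> A" "p \<in> fst c \<inter> fst d" for c d
      using linear_cmul[OF l[OF that]] tangent_vec_change[OF v, of c d] that by (simp add: scaleR_fun_def)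
    moreover have "(r *\<^sub>R v) c = 0" if "\<not> (c \<in> A \<and> p \<in> fst c)" for c
      using tangent_vec_outside[OF v that] by (simp add: scaleR_fun_def)
    ultimately show "r *\<^sub>R v \<in> tangent_space A p"
      unfolding tangent_space_def by blast
  qed
qed

lemma tvec_of_add:
  assumes "smooth_manifold A" "c \<in> A" "p \<in> fst c"
  shows "tvec_of A c p (y + z) = tvec_of A c p y + tvec_of A c p z"
    and "tvec_of A c p (r *\<^sub>R y) = r *\<^sub>R tvec_of A c p y"
proof -
  have l: "linear (dif (transition c d) (snd c p))" if "d \<in> A" "p \<in> fst d" for d
    by (rule linear_dif[OF transition_differentiable[OF assms(1,2) that(1) assms(3) that(2)]])
  show "tvec_of A c p (y + z) = tvec_of A c p y + tvec_of A c p z"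
    by (rule ext) (simp add: tvec_of_def linear_add[OF l])
  show "tvec_of A c p (r *\<^sub>R y) = r *\<^sub>R tvec_of A c p y"
    by (rule ext) (simp add: tvec_of_def scaleR_fun_def linear_cmul[OF l])
qed

text \<open>As transition maps are smooth, smoothness in a single chart suffices.\<close>

lemma smooth_into_chartI:
  assumes A: "smooth_manifold A" "c \<in> A" and F: "open \<Omega>" "smooth_on \<Omega> F" "F ` \<Omega> \<subseteq> snd c ` fst c"
  shows "smooth_into A \<Omega> (\<lambda>x. chart_inv c (F x))"
  unfolding smooth_into_def
proof (intro ballI conjI)
  fix d assume d: "d \<in> A"
  note tc = chart_inv_works[OF manifold_chart[OF A]]
  have "y \<in> snd c ` fst c \<Longrightarrow> chart_inv c y \<in> fst d \<longleftrightarrow> y \<in> snd c ` (fst c \<inter> fst d)" for y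
    using tc by (auto simp: image_iff)
  then have eq: "{x \<in> \<Omega>. chart_inv c (F x) \<in> fst d} = \<Omega> \<inter> F -` (snd c ` (fst c \<inter> fst d))"
    using F(3) by auto
  show o: "open {x \<in> \<Omega>. chart_inv c (F x) \<in> fst d}" unfolding eq
    by (rule continuous_open_preimage[OF smooth_on_continuous[OF F(2)] F(1) open_overlap[OF A d]])
  have "smooth_on {x \<in> \<Omega>. chart_inv c (F x) \<in> fst d} (\<lambda>x. transition c d (F x))"
    by (rule smooth_on_compose[OF smooth_transition[OF A d] smooth_on_subset[OF F(2)] o open_overlap[OF A d]])
       (use eq in auto)
  then show "smooth_on {x \<in> \<Omega>. chart_inv c (F x) \<in> fst d} (\<lambda>x. snd d (chart_inv c (F x)))"
    by (simp add: transition_apply)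
qed

lemma dif_chart_change:
  assumes A: "smooth_manifold A" "c \<in> A" "d \<in> A"
    and G: "smooth_into A \<Omega> G" "x \<in> \<Omega>" "G x \<in> fst c" "G x \<in> fst d"
  shows "dif (\<lambda>y. snd d (G y)) x w = dif (transition c d) (snd c (G x)) (dif (\<lambda>y. snd c (G y)) x w)"
proof -
  note tc = chart_inv_works[OF manifold_chart[OF A(1,2)]]
  have "dif (\<lambda>y. snd d (G y)) x = dif (\<lambda>y. transition c d (snd c (G y))) x"
    by (rule dif_cong_open[OF smooth_intoD(1)[OF G(1) A(2)]]) (use G tc in \<open>auto simp: transition_apply\<close>)
  then show ?thesis
    by (simp add: dif_compose[OF smooth_into_differentiable[OF G(1) A(2) G(2,3)]
          transition_differentiable[OF A G(3,4)]])
qed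

lemma push_eq_tvec_of:
  assumes A: "smooth_manifold A" "c \<in> A"
    and G: "smooth_into A \<Omega> G" "x \<in> \<Omega>" "G x \<in> fst c"
  shows "push A G x w = tvec_of A c (G x) (dif (\<lambda>y. snd c (G y)) x w)"
  by (rule ext) (simp add: push_def tvec_of_def dif_chart_change[OF A(1,2) _ G])

lemma inj_push_iff:
  assumes A: "smooth_manifold A" "c \<in> A"
    and G: "smooth_into A \<Omega> G" "x \<in> \<Omega>" "G x \<in> fst c"
  shows "inj (push A G x) \<longleftrightarrow> inj (dif (\<lambda>y. snd c (G y)) x)"
  unfolding inj_def push_eq_tvec_of[OF A G] using tvec_of_same[OF A G(3)] by metis

text \<open>
  Here the maximality of the atlas enters: charts may be composed with diffeomorphisms.
\<close>

lemma new_chart: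
  assumes A: "smooth_manifold A" "c \<in> A"
    and V: "open V" "V \<subseteq> snd c ` fst c" "smooth_on V \<Phi>"
    and V': "open V'" "\<Phi> ` V = V'" "smooth_on V' \<Psi>" and inv: "\<And>y. y \<in> V \<Longrightarrow> \<Psi> (\<Phi> y) = y"
  shows "(chart_inv c ` V, \<lambda>q. \<Phi> (snd c q)) \<in> A"
proof -
  let ?d = "(chart_inv c ` V, \<lambda>q. \<Phi> (snd c q))"
  note cc = manifold_chart[OF A]
  note tc[simp] = chart_inv_works[OF cc]
  have sc[simp]: "snd c (chart_inv c y) = y" if "y \<in> V" for y using that V(2) by auto
  have fd: "chart_inv c ` V \<subseteq> fst c" using V(2) by auto
  have im: "snd ?d ` fst ?d = V'" using V'(2) by (force simp: image_image)
  have cinv: "chart_inv ?d y = chart_inv c (\<Psi> y)" if yV: "y \<in> V'" for y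
  proof -
    obtain z where z: "z \<in> V" "y = \<Phi> z" using yV V'(2) by blast
    have "inj_on (\<lambda>q. \<Phi> (snd c q)) (chart_inv c ` V)"
      by (rule inj_on_inverseI[where g="\<lambda>y. chart_inv c (\<Psi> y)"]) (auto simp: inv)
    then show ?thesis unfolding chart_inv_def[of ?d]
      using z by (intro inv_into_f_eq) (auto simp: inv)
  qed
  have \<Psi>V: "\<Psi> y \<in> V" "\<Phi> (\<Psi> y) = y" if "y \<in> V'" for y using that V'(2) inv by auto
  have od: "open (chart_inv c ` V)" by (rule open_chart_inv_image[OF cc V(1,2)])
  have top: "topological_chart ?d"
    unfolding topological_chart_def im
  proof (intro conjI homeomorphismI)
    show "open (fst ?d)" using od by simp
    show "open V'" by fact
    show "continuous_on (fst ?d) (snd ?d)"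
      using continuous_on_compose2[OF smooth_on_continuous[OF V(3)] continuous_on_subset[OF chart_continuous(1)[OF cc] fd]]
      by (simp add: image_subset_iff)
    have "continuous_on V' (\<lambda>y. chart_inv c (\<Psi> y))"
      using continuous_on_compose2[OF chart_continuous(2)[OF cc] smooth_on_continuous[OF V'(3)]] \<Psi>V V(2) by auto
    then show "continuous_on V' (chart_inv ?d)"
      by (rule continuous_on_eq) (simp add: cinv)
  qed (use \<Psi>V cinv inv V'(2) in auto)
  have "compatible ?d e" if e: "e \<in> A" for e
    unfolding compatible_def
  proof
    have eq: "snd ?d ` (fst ?d \<inter> fst e) = V' \<inter> \<Psi> -` (snd c ` (fst c \<inter> fst e))" (is "?l = ?r")
    proof (intro equalityI subsetI)
      fix y assume "y \<in> ?l"
      then obtain z where "z \<in> V" "chart_inv c z \<in> fst e" "y = \<Phi> z" by auto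
      then show "y \<in> ?r" using inv V'(2) fd by (auto simp: image_iff intro!: bexI[of _ "chart_inv c z"])
    next
      fix y assume y: "y \<in> ?r"
      then have "chart_inv c (\<Psi> y) \<in> fst e" by auto
      moreover have "snd ?d (chart_inv c (\<Psi> y)) = y" using y \<Psi>V by simp
      ultimately show "y \<in> ?l" using y \<Psi>V by (intro image_eqI[of _ _ "chart_inv c (\<Psi> y)"]) auto
    qed
    have o: "open (V' \<inter> \<Psi> -` (snd c ` (fst c \<inter> fst e)))"
      by (rule continuous_open_preimage[OF smooth_on_continuous[OF V'(3)] V'(1) open_overlap[OF A e]])
    have "smooth_on (V' \<inter> \<Psi> -` (snd c ` (fst c \<inter> fst e))) (\<lambda>y. transition c e (\<Psi> y))"
      by (rule smooth_on_compose[OF smooth_transition[OF A e] smooth_on_subset[OF V'(3)] o open_overlap[OF A e]]) auto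
    then show "smooth_on (snd ?d ` (fst ?d \<inter> fst e)) (transition ?d e)"
      unfolding eq by (rule smooth_on_cong[OF o, rotated]) (simp add: transition_apply cinv)
  next
    have o: "open (snd e ` (fst ?d \<inter> fst e))"
      using open_chart_image[OF manifold_chart[OF A(1) e] od] by (simp add: Int_commute)
    have "smooth_on (snd e ` (fst ?d \<inter> fst e)) (\<lambda>y. \<Phi> (transition e c y))"
      by (rule smooth_on_compose[OF V(3) smooth_on_subset[OF smooth_transition[OF A(1) e A(2)]] o V(1)])
         (use fd chart_inv_works(1)[OF manifold_chart[OF A(1) e]] in \<open>auto simp: transition_apply\<close>)
    then show "smooth_on (snd e ` (fst ?d \<inter> fst e)) (transition e ?d)"
      by (simp add: transition_def o_def)
  qed
  then show ?thesis using A(1) top unfolding smooth_manifold_def by blast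
qed

section \<open>Submanifolds and their local parametrizations\<close>

text \<open>
  \<open>G\<close> is an immersion and an open map onto its image in \<open>L\<close>. Graphs and images of embeddings provide such
  maps, so that both can be treated at once.
\<close>

definition parametrizes :: "('e::topological_space, real^('n::finite + 'm::finite)) chart set \<Rightarrow> 'e set \<Rightarrow>
   (real^'n) set \<Rightarrow> (real^'n \<Rightarrow> 'e) \<Rightarrow> bool" where
  "parametrizes A L \<Omega> G \<longleftrightarrow> open \<Omega> \<and> smooth_into A \<Omega> G \<and> (\<forall>x\<in>\<Omega>. inj (push A G x)) \<and>
     (\<forall>S. open S \<and> S \<subseteq> \<Omega> \<longrightarrow> (\<exists>W. open W \<and> W \<inter> L = G ` S))"

lemma parametrizesD:
  assumes "parametrizes A L \<Omega> G"
  shows "open \<Omega>" "smooth_into A \<Omega> G" "x \<in> \<Omega> \<Longrightarrow> inj (push A G x)" "x \<in> \<Omega> \<Longrightarrow> G x \<in> L"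
    "open S \<Longrightarrow> S \<subseteq> \<Omega> \<Longrightarrow> \<exists>W. open W \<and> W \<inter> L = G ` S"
proof -
  show 1: "open \<Omega>" and "smooth_into A \<Omega> G" and "x \<in> \<Omega> \<Longrightarrow> inj (push A G x)"
    and 2: "open S \<Longrightarrow> S \<subseteq> \<Omega> \<Longrightarrow> \<exists>W. open W \<and> W \<inter> L = G ` S" for S
    using assms by (simp_all add: parametrizes_def)
  show "G x \<in> L" if "x \<in> \<Omega>" using 2[OF 1 order_refl] that by blast
qed

lemma parametrizes_subset:
  "parametrizes A L \<Omega> G \<Longrightarrow> open S \<Longrightarrow> S \<subseteq> \<Omega> \<Longrightarrow> parametrizes A L S G"
  by (auto simp: parametrizes_def intro: smooth_into_subset)

text \<open>
  The inverse function theorem for \<open>hl \<circ> c \<circ> G\<close>, where \<open>hl\<close> may be any linear projection whose restriction to the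
  tangent plane is injective. With a left inverse of the derivative as \<open>hl\<close> it gives local left inverses of
  \<open>G\<close>, with the horizontal projection it shows that \<open>L\<close> is a graph.
\<close>

lemma parametrizes_local_inverse:
  fixes G :: "real^'n \<Rightarrow> 'e::topological_space" and A :: "('e, real^('n::finite + 'm::finite)) chart set"
    and hl :: "real^('n + 'm) \<Rightarrow> real^'n"
  assumes A: "c \<in> A" and G: "parametrizes A L \<Omega> G" "x0 \<in> \<Omega>" "G x0 \<in> fst c"
    and hl: "linear hl" "inj (\<lambda>w. hl (dif (\<lambda>x. snd c (G x)) x0 w))"
  obtains S V g W where "open S" "x0 \<in> S" "S \<subseteq> {x \<in> \<Omega>. G x \<in> fst c}" "open V" "smooth_on V g"
    "\<And>x. x \<in> S \<Longrightarrow> hl (snd c (G x)) \<in> V \<and> g (hl (snd c (G x))) = x"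
    "\<And>y. y \<in> V \<Longrightarrow> g y \<in> S \<and> hl (snd c (G (g y))) = y"
    "\<And>x. x \<in> S \<Longrightarrow> inj (\<lambda>w. hl (dif (\<lambda>x. snd c (G x)) x w))"
    "open W" "W \<inter> L = G ` S"
proof -
  let ?O = "{x \<in> \<Omega>. G x \<in> fst c}"
  note sm = smooth_intoD[OF parametrizesD(2)[OF G(1)] A]
  have dd: "dif (\<lambda>x. hl (snd c (G x))) x w = hl (dif (\<lambda>x. snd c (G x)) x w)" if "x \<in> ?O" for x w
    by (rule dif_linear_comp[OF hl(1) smooth_onD[OF sm(2) that]])
  have x0: "x0 \<in> ?O" using G by simp
  then have "inj (dif (\<lambda>x. hl (snd c (G x))) x0)" using hl(2) dd[OF x0] by (simp add: inj_def)
  note ift = smooth_inverse_function[OF sm(1) smooth_on_linear_comp[OF hl(1) sm] x0 this]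
  obtain S V g where *: "open S" "S \<subseteq> ?O" "x0 \<in> S" "open V"
      "\<And>x. x \<in> S \<Longrightarrow> hl (snd c (G x)) \<in> V \<and> g (hl (snd c (G x))) = x"
      "\<And>y. y \<in> V \<Longrightarrow> g y \<in> S \<and> hl (snd c (G (g y))) = y" "smooth_on V g"
      "\<And>x. x \<in> S \<Longrightarrow> inj (dif (\<lambda>x. hl (snd c (G x))) x)"
    by (rule ift) (rule that; assumption)
  obtain W where W: "open W" "W \<inter> L = G ` S"
  proof -
    have "S \<subseteq> \<Omega>" using *(2) by auto
    from parametrizesD(5)[OF G(1) *(1) this] show ?thesis by (elim exE conjE) (rule that)
  qed
  have "inj (\<lambda>w. hl (dif (\<lambda>x. snd c (G x)) x w))" if "x \<in> S" for x
    using *(8)[OF that] dd[of x] *(2) that by (auto simp: inj_def)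
  from that[OF *(1,3,2,4,7,5,6) this W] show ?thesis .
qed

theorem tangent_to_parametrizes:
  assumes A: "smooth_manifold A" and G: "parametrizes A L \<Omega> G" "x0 \<in> \<Omega>"
  shows "tangent_to A L (G x0) = range (push A G x0)"
proof -
  obtain c where c: "c \<in> A" "G x0 \<in> fst c" using manifold_cover[OF A] by blast
  note tc = manifold_chart[OF A c(1)]
  have inj: "inj (dif (\<lambda>x. snd c (G x)) x0)"
    using inj_push_iff[OF A c(1) parametrizesD(2)[OF G(1)] G(2) c(2)] parametrizesD(3)[OF G] by simp
  have lin: "linear (dif (\<lambda>x. snd c (G x)) x0)"
    by (rule linear_dif[OF smooth_into_differentiable[OF parametrizesD(2)[OF G(1)] c(1) G(2) c(2)]])
  obtain hl where hl: "linear hl" "hl \<circ> dif (\<lambda>x. snd c (G x)) x0 = id"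
    using linear_injective_left_inverse[OF lin inj] by blast
  have "inj (\<lambda>w. hl (dif (\<lambda>x. snd c (G x)) x0 w))"
    using hl(2) by (metis (no_types, lifting) comp_apply id_apply injI)
  note pli = parametrizes_local_inverse[OF c(1) G c(2) hl(1) this]
  obtain S V g W where S: "open S" "x0 \<in> S" "S \<subseteq> {x \<in> \<Omega>. G x \<in> fst c}" and V: "open V" "smooth_on V g"
    and gl: "\<And>x. x \<in> S \<Longrightarrow> hl (snd c (G x)) \<in> V \<and> g (hl (snd c (G x))) = x"
    and "\<And>y. y \<in> V \<Longrightarrow> g y \<in> S \<and> hl (snd c (G (g y))) = y"
    and "\<And>x. x \<in> S \<Longrightarrow> inj (\<lambda>w. hl (dif (\<lambda>x. snd c (G x)) x w))"
    and W: "open W" "W \<inter> L = G ` S" by (rule pli) (rule that; assumption)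
  \<comment> \<open>in this open set the points of \<open>L\<close> lie in \<open>G ` S\<close>\<close>
  let ?W = "snd c ` (fst c \<inter> W)"
  have qW: "q \<in> G ` S" if "q \<in> L" "q \<in> fst c" "snd c q \<in> ?W" for q
    using that W(2) chart_inj[OF tc] by (auto dest!: inj_onD)
  show ?thesis
  proof (rule tangent_to_param(1)[where \<Omega>=S and W="?W" and h="\<lambda>y. g (hl y)" and C=c])
    show "smooth_into A S G" using smooth_into_subset[OF parametrizesD(2)[OF G(1)] S(1)] S(3) by blast
    show "G ` S \<subseteq> L" using W by blast
    show "open ?W" by (rule open_chart_image[OF tc W(1)])
    show "snd c (G x0) \<in> ?W" using W S c by blast
    have "g differentiable at (hl (snd c (G x0)))" using smooth_onD[OF V(2)] gl[OF S(2)] by blast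
    then show "(\<lambda>y. g (hl y)) differentiable at (snd c (G x0))"
      using differentiable_chain_at[where f=hl and g=g, OF linear_imp_differentiable[OF hl(1)]] by (simp add: o_def)
    fix q assume "q \<in> L" "q \<in> fst c" "snd c q \<in> ?W"
    from qW[OF this] gl show "g (hl (snd c q)) \<in> S \<and> G (g (hl (snd c q))) = q" by auto
  next
    fix x assume "x \<in> S"
    then show "g (hl (snd c (G x))) = x" using gl by blast
  qed (use S c in auto)
qed

text \<open>
  Where the tangent plane projects isomorphically to the horizontal space, the horizontal coordinates are
  parameters, and the vertical coordinates are functions of them.
\<close>

lemma parametrizes_graph:
  fixes G :: "real^'n \<Rightarrow> 'e::{t2_space,second_countable_topology}" and A :: "('e, real^('n::finite + 'm::finite)) chart set"
  assumes A: "smooth_manifold A" "c \<in> A" and G: "parametrizes A L \<Omega> G" "x0 \<in> \<Omega>" "G x0 \<in> fst c"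
    and inj: "inj (\<lambda>w. horiz (dif (\<lambda>x. snd c (G x)) x0 w))"
  obtains f S V g where "graph_at c L (G x0) f" "open S" "x0 \<in> S" "S \<subseteq> {x \<in> \<Omega>. G x \<in> fst c}"
    "open V" "smooth_on V g" "smooth_on V f"
    "\<And>x. x \<in> S \<Longrightarrow> horiz (snd c (G x)) \<in> V \<and> g (horiz (snd c (G x))) = x \<and> vert (snd c (G x)) = f (horiz (snd c (G x)))"
    "\<And>y. y \<in> V \<Longrightarrow> g y \<in> S \<and> horiz (snd c (G (g y))) = y"
proof -
  note tc = manifold_chart[OF A]
  note ci = chart_inv_works[OF tc]
  obtain S V g W where S: "open S" "x0 \<in> S" "S \<subseteq> {x \<in> \<Omega>. G x \<in> fst c}" and V: "open V" "smooth_on V g"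
    and gl: "\<And>x. x \<in> S \<Longrightarrow> horiz (snd c (G x)) \<in> V \<and> g (horiz (snd c (G x))) = x"
    and gr: "\<And>y. y \<in> V \<Longrightarrow> g y \<in> S \<and> horiz (snd c (G (g y))) = y"
    and "\<And>x. x \<in> S \<Longrightarrow> inj (\<lambda>w. horiz (dif (\<lambda>x. snd c (G x)) x w))"
    and W: "open W" "W \<inter> L = G ` S"
    by (rule parametrizes_local_inverse[OF A(2) G linear_horiz inj]) (rule that; assumption)
  define f where "f y = vert (snd c (G (g y)))" for y
  note sm = smooth_intoD[OF parametrizesD(2)[OF G(1)] A(2)]
  have fV: "smooth_on V f" unfolding f_def
    by (rule smooth_on_linear_comp[OF linear_vert V(1)], rule smooth_on_compose[OF sm(2) V(2,1) sm(1)])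
       (use gr S(3) in auto)
  \<comment> \<open>near \<open>G x0\<close> the points of \<open>L\<close> lie in the image of the domain of the inverse\<close>
  let ?V = "snd c ` (fst c \<inter> W) \<inter> horiz -` V"
  have "continuous_on UNIV (horiz :: real^('n + 'm) \<Rightarrow> _)" by (intro continuous_intros)
  then have oV: "open ?V" using open_chart_image[OF tc W(1)] V(1) open_vimage by blast
  have iff: "chart_inv c y \<in> L \<longleftrightarrow> vert y = f (horiz y)" if "y \<in> ?V" for y
  proof
    have y: "y \<in> snd c ` fst c" "chart_inv c y \<in> W" "horiz y \<in> V" using that ci by auto
    show "vert y = f (horiz y)" if yL: "chart_inv c y \<in> L"
    proof -
      have "chart_inv c y \<in> G ` S" using yL y(2) W(2) by (metis IntI)
      then obtain x where x: "x \<in> S" "chart_inv c y = G x" by (elim imageE) (rule that)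
      then have "y = snd c (G x)" using y ci by metis
      then show ?thesis using gl[OF x(1)] by (simp add: f_def)
    qed
    show "chart_inv c y \<in> L" if "vert y = f (horiz y)"
    proof -
      have "y = snd c (G (g (horiz y)))"
        using gr[OF y(3)] that by (simp add: join_eq_iff[of y] f_def)
      then have "chart_inv c y = G (g (horiz y))" using gr[OF y(3)] S(3) ci by (metis (no_types, lifting) mem_Collect_eq subsetD)
      then show ?thesis using gr[OF y(3)] W(2) by auto
    qed
  qed
  have "graph_at c L (G x0) f"
    unfolding graph_at_def
    by (intro conjI exI[of _ ?V])
       (use oV iff gl[OF S(2)] S W(2) G parametrizesD(4)[OF G(1,2)] in \<open>auto intro: smooth_on_subset[OF fV]\<close>)
  then show ?thesis
    using that[OF _ S V fV _ gr] gl by (simp add: f_def)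
qed

lemma graph_atD: "graph_at c L p f \<Longrightarrow> p \<in> L" "graph_at c L p f \<Longrightarrow> p \<in> fst c"
  by (auto simp: graph_at_def)

lemma graph_parametrizes:
  fixes A :: "('e::{t2_space,second_countable_topology}, real^('n::finite + 'm::finite)) chart set"
  assumes A: "smooth_manifold A" "c \<in> A" and gr: "graph_at c L p f"
  obtains \<Omega> where "parametrizes A L \<Omega> (\<lambda>x. chart_inv c (join x (f x)))" "horiz (snd c p) \<in> \<Omega>"
    "smooth_on \<Omega> f" "join (horiz (snd c p)) (f (horiz (snd c p))) = snd c p"
    "\<And>x. x \<in> \<Omega> \<Longrightarrow> join x (f x) \<in> snd c ` fst c"
    "\<And>x. x \<in> \<Omega> \<Longrightarrow> graph_at c L (chart_inv c (join x (f x))) f"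
    "\<And>x w. x \<in> \<Omega> \<Longrightarrow> dif (\<lambda>x. snd c (chart_inv c (join x (f x)))) x w = join w (dif f x w)"
    "\<exists>W. open W \<and> p \<in> W \<and> W \<subseteq> fst c \<and> (\<forall>q\<in>L \<inter> W. horiz (snd c q) \<in> \<Omega> \<and> graph_at c L q f \<and>
         q = chart_inv c (join (horiz (snd c q)) (f (horiz (snd c q)))))"
proof -
  note tc = manifold_chart[OF A]
  note ci = chart_inv_works[OF tc]
  obtain V where V: "open V" "snd c p \<in> V" "V \<subseteq> snd c ` fst c" "smooth_on (horiz ` V) f"
    "\<And>y. y \<in> V \<Longrightarrow> chart_inv c y \<in> L \<longleftrightarrow> vert y = f (horiz y)"
    using gr unfolding graph_at_def by blast
  have p: "p \<in> L" "p \<in> fst c" using graph_atD[OF gr] by auto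
  define F where "F x = join x (f x)" for x
  define \<Omega> where "\<Omega> = horiz ` V \<inter> F -` V"
  have oh: "open (horiz ` V)" by (rule open_horiz_image[OF V(1)])
  have Fsm: "smooth_on (horiz ` V) F"
    unfolding F_def by (rule smooth_on_join[OF oh smooth_on_id V(4)])
  have \<Omega>: "open \<Omega>" unfolding \<Omega>_def
    by (rule continuous_open_preimage[OF smooth_on_continuous[OF Fsm] oh V(1)])
  have fsm: "smooth_on \<Omega> f" using smooth_on_subset[OF V(4)] by (simp add: \<Omega>_def)
  have F\<Omega>: "smooth_on \<Omega> F" using smooth_on_subset[OF Fsm] by (simp add: \<Omega>_def)
  have FV: "F x \<in> V" "chart_inv c (F x) \<in> L" "snd c (chart_inv c (F x)) = F x" if "x \<in> \<Omega>" for x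
  proof -
    show x: "F x \<in> V" using that by (simp add: \<Omega>_def)
    then show "chart_inv c (F x) \<in> L" using V(5) by (simp add: F_def)
    show "snd c (chart_inv c (F x)) = F x" using x V(3) ci by auto
  qed
  have cp: "join (horiz (snd c p)) (f (horiz (snd c p))) = snd c p"
    using V(5)[OF V(2)] p ci by (simp add: join_eq_iff[of _ "snd c p"])
  have x0: "horiz (snd c p) \<in> \<Omega>" using V(2) cp by (auto simp: \<Omega>_def F_def)
  have into: "smooth_into A \<Omega> (\<lambda>x. chart_inv c (F x))"
    by (rule smooth_into_chartI[OF A \<Omega> F\<Omega>]) (use FV V(3) in auto)
  have dF: "dif (\<lambda>x. snd c (chart_inv c (F x))) x w = join w (dif f x w)" if "x \<in> \<Omega>" for x w
  proof -
    have "dif (\<lambda>x. snd c (chart_inv c (F x))) x = dif F x"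
      by (rule dif_cong_open[OF \<Omega> that]) (rule FV)
    also have "\<dots> = (\<lambda>w. join w (dif f x w))" unfolding F_def
      by (rule dif_eqI, rule has_derivative_join[OF has_derivative_ident has_dif[OF smooth_onD[OF fsm that]]])
    finally show ?thesis by simp
  qed
  have "inj (push A (\<lambda>x. chart_inv c (F x)) x)" if "x \<in> \<Omega>" for x
  proof (subst inj_push_iff[OF A into that])
    show "chart_inv c (F x) \<in> fst c" using FV(1)[OF that] V(3) ci by auto
    show "inj (dif (\<lambda>y. snd c (chart_inv c (F y))) x)"
    proof (rule injI)
      fix v w assume "dif (\<lambda>y. snd c (chart_inv c (F y))) x v = dif (\<lambda>y. snd c (chart_inv c (F y))) x w"
      then have "horiz (join v (dif f x v)) = horiz (join w (dif f x w))" unfolding dF[OF that] by simp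
      then show "v = w" by simp
    qed
  qed
  moreover have "\<exists>W. open W \<and> W \<inter> L = (\<lambda>x. chart_inv c (F x)) ` S" if S: "open S" "S \<subseteq> \<Omega>" for S
  proof -
    have "continuous_on UNIV (horiz :: real^('n + 'm) \<Rightarrow> _)" by (intro continuous_intros)
    then have o: "open (V \<inter> horiz -` S)" using V(1) S(1) open_vimage by blast
    let ?W = "chart_inv c ` (V \<inter> horiz -` S)"
    have "open ?W" by (rule open_chart_inv_image[OF tc o]) (use V(3) in auto)
    moreover have "?W \<inter> L = (\<lambda>x. chart_inv c (F x)) ` S"
    proof (intro equalityI subsetI)
      fix q assume "q \<in> ?W \<inter> L"
      then obtain y where y: "y \<in> V" "horiz y \<in> S" "q = chart_inv c y" "chart_inv c y \<in> L" by auto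
      then have "F (horiz y) = y" using V(5)[OF y(1)] by (simp add: F_def join_eq_iff[of _ y])
      then show "q \<in> (\<lambda>x. chart_inv c (F x)) ` S" using y by force
    next
      fix q assume "q \<in> (\<lambda>x. chart_inv c (F x)) ` S"
      then obtain x where x: "x \<in> S" "q = chart_inv c (F x)" by auto
      then have "x \<in> \<Omega>" using S by auto
      then show "q \<in> ?W \<inter> L" using FV[of x] x by (auto simp: F_def)
    qed
    ultimately show ?thesis by blast
  qed
  ultimately have par: "parametrizes A L \<Omega> (\<lambda>x. chart_inv c (F x))"
    unfolding parametrizes_def using \<Omega> into by blast
  have gq: "graph_at c L q f" if "q \<in> L" "q \<in> fst c" "snd c q \<in> V" for q
    unfolding graph_at_def using that V by blast
  have gx: "graph_at c L (chart_inv c (F x)) f" if "x \<in> \<Omega>" for x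
    using gq[of "chart_inv c (F x)"] FV[OF that] ci V(3) by auto
  have "open (chart_inv c ` V)" "p \<in> chart_inv c ` V" "chart_inv c ` V \<subseteq> fst c"
    using open_chart_inv_image[OF tc V(1,3)] V(2,3) ci p by (auto simp: image_iff intro!: bexI[of _ "snd c p"])
  moreover have "horiz (snd c q) \<in> \<Omega> \<and> graph_at c L q f \<and> q = chart_inv c (F (horiz (snd c q)))"
    if q: "q \<in> L \<inter> chart_inv c ` V" for q
  proof -
    obtain y where y: "y \<in> V" "q = chart_inv c y" using q by blast
    then have yq: "snd c q = y" using V(3) ci by auto
    have "F (horiz y) = y" using V(5)[OF y(1)] q y by (simp add: F_def join_eq_iff[of _ y])
    then show ?thesis
      using y yq q V(3) ci gq[of q] by (auto simp: \<Omega>_def)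
  qed
  ultimately have "\<exists>W. open W \<and> p \<in> W \<and> W \<subseteq> fst c \<and> (\<forall>q\<in>L \<inter> W. horiz (snd c q) \<in> \<Omega> \<and> graph_at c L q f \<and>
         q = chart_inv c (F (horiz (snd c q))))" by blast
  note W = this
  have FV': "join x (f x) \<in> snd c ` fst c" if "x \<in> \<Omega>" for x using FV(1)[OF that] V(3) by (auto simp: F_def)
  show ?thesis
    by (rule that[OF par[unfolded F_def] x0 fsm cp FV' gx[unfolded F_def] dF[unfolded F_def] W[unfolded F_def]])
qed

text \<open>
  An isomorphism of the vertical space with the orthogonal complement of the range extends \<open>B\<close> to an
  automorphism, whose inverse is \<open>T\<close>.
\<close>

lemma linear_straighten:
  fixes B :: "real^'n \<Rightarrow> real^('n::finite + 'm::finite)"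
  assumes "linear B" "inj B"
  obtains T T' :: "real^('n + 'm) \<Rightarrow> real^('n + 'm)" where
    "linear T" "linear T'" "\<And>y. T' (T y) = y" "\<And>y. T (T' y) = y" "\<And>w. T (B w) = join w 0"
proof -
  let ?K = "{y \<in> UNIV. \<forall>x\<in>range B. orthogonal x y}"
  have sr: "subspace (range B)" using linear_subspace_image[OF assms(1) subspace_UNIV] .
  have sK: "subspace ?K" using subspace_orthogonal_to_vectors[of "range B"] by simp
  have "dim ?K + dim (range B) = DIM(real^('n + 'm))"
    using dim_subspace_orthogonal_to_vectors[OF sr subspace_UNIV] by simp
  then have "dim (UNIV :: (real^'m) set) = dim ?K"
    using range_linear_inj(2)[OF assms] by simp
  then obtain k :: "real^'m \<Rightarrow> real^('n + 'm)" where k: "linear k" "k ` UNIV = ?K" "inj_on k UNIV"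
    using subspace_isomorphism[OF subspace_UNIV sK] by blast
  define S where "S z = B (horiz z) + k (vert z)" for z
  have S: "linear S" unfolding S_def
    by (intro linear_compose_add linear_compose[OF linear_horiz assms(1), unfolded o_def]
        linear_compose[OF linear_vert k(1), unfolded o_def])
  have "inj S"
  proof (subst linear_injective_0[OF S], intro allI impI)
    fix z assume "S z = 0"
    then have e: "B (horiz z) = - k (vert z)" by (simp add: S_def eq_neg_iff_add_eq_0)
    have "orthogonal (B (horiz z)) (k (vert z))" using k(2) by blast
    then have "k (vert z) = 0" unfolding e by (simp add: orthogonal_def)
    then have "k (vert z) = 0" "B (horiz z) = 0" using e by auto
    then have "vert z = 0" "horiz z = 0"
      using linear_injective_0[OF k(1)] k(3) linear_injective_0[OF assms(1)] assms(2) by auto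
    then show "z = 0" using join_eq_iff[of z 0] linear_0[OF linear_horiz] linear_0[OF linear_vert] by metis
  qed
  then obtain T where T: "linear T" "\<And>x. T (S x) = x" "\<And>x. S (T x) = x"
    using linear_injective_isomorphism[OF S] by blast
  have "S (join w 0) = B w" for w using linear_0[OF k(1)] by (simp add: S_def)
  then have "T (B w) = join w 0" for w using T(2) by metis
  then show ?thesis using that[OF T(1) S T(3,2)] by blast
qed

text \<open>
  A linear change of coordinates makes the tangent plane horizontal.
\<close>

lemma exists_graph_chart:
  fixes G :: "real^'n \<Rightarrow> 'e::{t2_space,second_countable_topology}" and A :: "('e, real^('n::finite + 'm::finite)) chart set"
  assumes A: "smooth_manifold A" and G: "parametrizes A L \<Omega> G" "x0 \<in> \<Omega>"
  shows "\<exists>c\<in>A. \<exists>f. graph_at c L (G x0) f"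
proof -
  obtain c where c: "c \<in> A" "G x0 \<in> fst c" using manifold_cover[OF A] by blast
  note tc = manifold_chart[OF A c(1)]
  note ci = chart_inv_works[OF tc]
  have df: "(\<lambda>x. snd c (G x)) differentiable at x0"
    by (rule smooth_into_differentiable[OF parametrizesD(2)[OF G(1)] c(1) G(2) c(2)])
  have inj: "inj (dif (\<lambda>x. snd c (G x)) x0)"
    using inj_push_iff[OF A c(1) parametrizesD(2)[OF G(1)] G(2) c(2)] parametrizesD(3)[OF G] by simp
  obtain T T' :: "real^('n + 'm) \<Rightarrow> real^('n + 'm)" where
    T: "linear T" "linear T'" "\<And>y. T' (T y) = y" "\<And>y. T (T' y) = y" "\<And>w. T (dif (\<lambda>x. snd c (G x)) x0 w) = join w 0"
    by (rule linear_straighten[OF linear_dif[OF df] inj]) (rule that; assumption)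
  let ?V = "snd c ` fst c"
  have "T ` ?V = T' -` ?V"
  proof (intro equalityI subsetI)
    fix y assume "y \<in> T ` ?V" then show "y \<in> T' -` ?V" using T(3) by auto
  next
    fix y assume "y \<in> T' -` ?V"
    then have "T (T' y) \<in> T ` ?V" by blast
    then show "y \<in> T ` ?V" by (simp add: T(4))
  qed
  then have "open (T ` ?V)"
    using open_vimage[OF chart_open(2)[OF tc] smooth_on_continuous[OF smooth_on_linear[OF T(2)]]] by simp
  then have "(chart_inv c ` ?V, \<lambda>q. T (snd c q)) \<in> A"
    by (intro new_chart[OF A c(1) chart_open(2)[OF tc] _ smooth_on_linear[OF T(1)] _ refl smooth_on_linear[OF T(2)] T(3)]) auto
  moreover have "chart_inv c ` ?V = fst c" by (simp add: image_image ci(1))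
  ultimately have d: "(fst c, \<lambda>q. T (snd c q)) \<in> A" (is "?d \<in> A") by simp
  have "horiz (dif (\<lambda>x. snd ?d (G x)) x0 w) = w" for w
    using dif_linear_comp[OF T(1) df] by (simp add: T(5))
  then have "inj (\<lambda>w. horiz (dif (\<lambda>x. snd ?d (G x)) x0 w))" by simp
  note inj' = this
  have "G x0 \<in> fst ?d" using c by simp
  then obtain f where "graph_at ?d L (G x0) f"
    by (rule parametrizes_graph[OF A d G _ inj']) (rule that)
  then show ?thesis using d by blast
qed

text \<open>
  Subtracting \<open>f\<close> from the vertical coordinates flattens the graph.
\<close>

lemma graph_slice_chart:
  fixes A :: "('e::{t2_space,second_countable_topology}, real^('n::finite + 'm::finite)) chart set"
  assumes A: "smooth_manifold A" "c \<in> A" and gr: "graph_at c L p f"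
  shows "\<exists>d\<in>A. p \<in> fst d \<and> snd d ` (fst d \<inter> L) = {y \<in> snd d ` fst d. vert y = 0}"
proof -
  note tc = manifold_chart[OF A]
  note ci = chart_inv_works[OF tc]
  obtain V where V: "open V" "snd c p \<in> V" "V \<subseteq> snd c ` fst c" "smooth_on (horiz ` V) f"
    "\<And>y. y \<in> V \<Longrightarrow> chart_inv c y \<in> L \<longleftrightarrow> vert y = f (horiz y)"
    using gr unfolding graph_at_def by blast
  have p: "p \<in> L" "p \<in> fst c" using graph_atD[OF gr] by auto
  define \<Phi> where "\<Phi> y = join (horiz y) (vert y - f (horiz y))" for y :: "real^('n + 'm)"
  define \<Psi> where "\<Psi> y = join (horiz y) (vert y + f (horiz y))" for y :: "real^('n + 'm)"
  have oh: "open (horiz ` V)" by (rule open_horiz_image[OF V(1)])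
  let ?H = "horiz -` (horiz ` V) :: (real^('n + 'm)) set"
  have "continuous_on UNIV (horiz :: real^('n + 'm) \<Rightarrow> _)" by (intro continuous_intros)
  then have oH: "open ?H" using oh open_vimage by blast
  have fH: "smooth_on ?H (\<lambda>y. f (horiz y))"
    by (rule smooth_on_compose[OF V(4) smooth_on_linear[OF linear_horiz] oH oh]) auto
  have \<Psi>H: "smooth_on ?H \<Psi>" unfolding \<Psi>_def
    by (intro smooth_on_join smooth_on_add oH fH smooth_on_linear linear_horiz linear_vert)
  have \<Phi>H: "smooth_on ?H \<Phi>" unfolding \<Phi>_def
    by (intro smooth_on_join smooth_on_minus oH fH smooth_on_linear linear_horiz linear_vert)
  have inv[simp]: "\<Psi> (\<Phi> y) = y" "\<Phi> (\<Psi> y) = y" for y by (simp_all add: \<Psi>_def \<Phi>_def)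
  have im: "\<Phi> ` V = ?H \<inter> \<Psi> -` V"
  proof (intro equalityI subsetI)
    fix y assume "y \<in> \<Phi> ` V" then show "y \<in> ?H \<inter> \<Psi> -` V" by (auto simp: \<Phi>_def[of "_"] \<Psi>_def)
  next
    fix y assume "y \<in> ?H \<inter> \<Psi> -` V"
    then show "y \<in> \<Phi> ` V" by (metis IntE inv(2) imageI vimageD)
  qed
  have o: "open (\<Phi> ` V)" unfolding im
    by (rule continuous_open_preimage[OF smooth_on_continuous[OF \<Psi>H] oH V(1)])
  let ?d = "(chart_inv c ` V, \<lambda>q. \<Phi> (snd c q))"
  have d: "?d \<in> A"
    by (rule new_chart[OF A V(1,3) smooth_on_subset[OF \<Phi>H] o refl smooth_on_subset[OF \<Psi>H]])
       (use im in auto)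
  have sc: "snd c (chart_inv c y) = y" if "y \<in> V" for y using that V(3) ci by auto
  have "snd ?d ` (fst ?d \<inter> L) = {y \<in> snd ?d ` fst ?d. vert y = 0}"
  proof (intro equalityI subsetI)
    fix z assume "z \<in> snd ?d ` (fst ?d \<inter> L)"
    then obtain y where "y \<in> V" "chart_inv c y \<in> L" "z = \<Phi> y" using sc by auto
    then show "z \<in> {y \<in> snd ?d ` fst ?d. vert y = 0}"
      using V(5)[of y] sc by (auto simp: \<Phi>_def image_iff intro!: bexI[of _ y])
  next
    fix z assume "z \<in> {y \<in> snd ?d ` fst ?d. vert y = 0}"
    then obtain y where "y \<in> V" "z = \<Phi> y" "vert z = 0" using sc by auto
    then show "z \<in> snd ?d ` (fst ?d \<inter> L)"
      using V(5)[of y] sc by (auto simp: \<Phi>_def image_iff intro!: bexI[of _ "chart_inv c y"])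
  qed
  moreover have "p \<in> fst ?d" using V(2) p ci by (auto simp: image_iff intro!: bexI[of _ "snd c p"])
  ultimately show ?thesis using d by blast
qed

lemma submanifold_iff_graph:
  assumes A: "smooth_manifold A"
  shows "submanifold A L \<longleftrightarrow> (\<forall>p\<in>L. \<exists>c\<in>A. \<exists>f. graph_at c L p f)"
proof
  assume "\<forall>p\<in>L. \<exists>c\<in>A. \<exists>f. graph_at c L p f"
  then show "submanifold A L" unfolding submanifold_def using graph_slice_chart[OF A] by blast
next
  assume L: "submanifold A L"
  show "\<forall>p\<in>L. \<exists>c\<in>A. \<exists>f. graph_at c L p f"
  proof
    fix p assume p: "p \<in> L"
    obtain c where c: "c \<in> A" "p \<in> fst c" "snd c ` (fst c \<inter> L) = {y \<in> snd c ` fst c. vert y = 0}"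
      using L p unfolding submanifold_def by blast
    note tc = manifold_chart[OF A c(1)]
    have "chart_inv c y \<in> L \<longleftrightarrow> vert y = 0" if y: "y \<in> snd c ` fst c" for y
    proof -
      have "y \<in> snd c ` (fst c \<inter> L) \<longleftrightarrow> vert y = 0" using c(3) y by blast
      moreover have "y \<in> snd c ` (fst c \<inter> L) \<longleftrightarrow> chart_inv c y \<in> L"
      proof
        assume "y \<in> snd c ` (fst c \<inter> L)"
        then show "chart_inv c y \<in> L" using chart_inv_works(1)[OF tc] by auto
      next
        assume "chart_inv c y \<in> L"
        then show "y \<in> snd c ` (fst c \<inter> L)"
          using chart_inv_works(2,3)[OF tc y] by (intro image_eqI[of _ _ "chart_inv c y"]) auto
      qed
      ultimately show ?thesis by simp
    qed
    then have "graph_at c L p (\<lambda>_. 0)"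
      unfolding graph_at_def using p c(2) chart_open(2)[OF tc] by auto
    then show "\<exists>c\<in>A. \<exists>f. graph_at c L p f" using c(1) by blast
  qed
qed

lemma submanifold_parametrizes:
  assumes "smooth_manifold A" "submanifold A L" "p \<in> L"
  obtains \<Omega> G x0 where "parametrizes A L \<Omega> G" "x0 \<in> \<Omega>" "G x0 = p"
proof -
  obtain c f where c: "c \<in> A" "graph_at c L p f"
    using assms submanifold_iff_graph by blast
  obtain \<Omega> where "parametrizes A L \<Omega> (\<lambda>x. chart_inv c (join x (f x)))" "horiz (snd c p) \<in> \<Omega>"
    "join (horiz (snd c p)) (f (horiz (snd c p))) = snd c p"
    by (rule graph_parametrizes[OF assms(1) c]) (rule that; assumption)
  then show ?thesis
    using that chart_inv_works(1)[OF manifold_chart[OF assms(1) c(1)] graph_atD(2)[OF c(2)]] by metis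
qed

lemma submanifold_if_parametrizes:
  assumes "smooth_manifold A" "\<And>p. p \<in> L \<Longrightarrow> \<exists>\<Omega> G. \<exists>x0\<in>\<Omega>. parametrizes A L \<Omega> G \<and> G x0 = p"
  shows "submanifold A L"
  unfolding submanifold_iff_graph[OF assms(1)] using exists_graph_chart[OF assms(1)] assms(2) by metis

lemma tangent_to_graph:
  assumes A: "smooth_manifold A" "c \<in> A" and gr: "graph_at c L p f"
  shows "tangent_to A L p = range (\<lambda>w. tvec_of A c p (join w (dif f (horiz (snd c p)) w)))"
proof -
  let ?x = "horiz (snd c p)" and ?G = "\<lambda>x. chart_inv c (join x (f x))"
  obtain \<Omega> where \<Omega>: "parametrizes A L \<Omega> ?G" "?x \<in> \<Omega>"
    "join ?x (f ?x) = snd c p"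
    "\<And>x w. x \<in> \<Omega> \<Longrightarrow> dif (\<lambda>x. snd c (chart_inv c (join x (f x)))) x w = join w (dif f x w)"
    by (rule graph_parametrizes[OF A gr]) (rule that; assumption)
  have p: "p \<in> fst c" using graph_atD[OF gr] by simp
  have Gp: "?G ?x = p" using \<Omega>(3) chart_inv_works(1)[OF manifold_chart[OF A] p] by simp
  have "push A ?G ?x w = tvec_of A c p (join w (dif f ?x w))" for w
    using push_eq_tvec_of[OF A parametrizesD(2)[OF \<Omega>(1)] \<Omega>(2)] Gp p \<Omega>(4)[OF \<Omega>(2)] by simp
  then show ?thesis using tangent_to_parametrizes[OF A(1) \<Omega>(1,2)] Gp by simp
qed

lemma tangent_to_graph_iff:
  assumes A: "smooth_manifold A" "c \<in> A" and gr: "graph_at c L p f"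
  shows "v \<in> tangent_to A L p \<longleftrightarrow>
    v \<in> tangent_space A p \<and> vert (v c) = dif f (horiz (snd c p)) (horiz (v c))"
proof
  have p: "p \<in> fst c" using graph_atD[OF gr] by simp
  show "v \<in> tangent_space A p \<and> vert (v c) = dif f (horiz (snd c p)) (horiz (v c))"
    if "v \<in> tangent_to A L p"
    using that tvec_of_tangent[OF A p] tvec_of_same[OF A p] unfolding tangent_to_graph[OF A gr] by auto
  assume v: "v \<in> tangent_space A p \<and> vert (v c) = dif f (horiz (snd c p)) (horiz (v c))"
  then have vc: "join (horiz (v c)) (dif f (horiz (snd c p)) (horiz (v c))) = v c"
    by (simp add: join_eq_iff[of _ "v c"])
  have "v = tvec_of A c p (v c)" using tangent_vec_eq[OF A p] v by blast
  then have "v = (\<lambda>w. tvec_of A c p (join w (dif f (horiz (snd c p)) w))) (horiz (v c))" unfolding vc .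
  then show "v \<in> tangent_to A L p" unfolding tangent_to_graph[OF A gr] by (rule range_eqI)
qed

lemma graph_at_if_transversal:
  assumes A: "smooth_manifold A" "c \<in> A" and L: "submanifold A L" "p \<in> L" "p \<in> fst c"
    and tr: "\<And>v. v \<in> tangent_to A L p \<Longrightarrow> horiz (v c) = 0 \<Longrightarrow> v c = 0"
  shows "\<exists>f. graph_at c L p f"
proof -
  obtain \<Omega> G x0 where G: "parametrizes A L \<Omega> G" "x0 \<in> \<Omega>" "G x0 = p"
    by (rule submanifold_parametrizes[OF A(1) L(1,2)]) (rule that; assumption)
  note into = parametrizesD(2)[OF G(1)]
  have Gc: "G x0 \<in> fst c" using G L by simp
  let ?D = "dif (\<lambda>x. snd c (G x)) x0"
  have lin: "linear ?D" by (rule linear_dif[OF smooth_into_differentiable[OF into A(2) G(2) Gc]])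
  have inj: "inj ?D" using inj_push_iff[OF A into G(2) Gc] parametrizesD(3)[OF G(1,2)] by simp
  have "inj (\<lambda>w. horiz (?D w))"
  proof (subst linear_injective_0)
    show "linear (\<lambda>w. horiz (?D w))" using linear_compose[OF lin linear_horiz] by (simp add: o_def)
    show "\<forall>w. horiz (?D w) = 0 \<longrightarrow> w = 0"
    proof (intro allI impI)
      fix w assume w: "horiz (?D w) = 0"
      have "push A G x0 w \<in> tangent_to A L p" using tangent_to_parametrizes[OF A(1) G(1,2)] G(3) by auto
      moreover have "push A G x0 w c = ?D w" using A(2) Gc by (simp add: push_def)
      ultimately have "?D w = 0" using tr[of "push A G x0 w"] w by simp
      then show "w = 0" using linear_injective_0[OF lin] inj by auto
    qed
  qed
  then obtain f where "graph_at c L (G x0) f"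
    by (rule parametrizes_graph[OF A G(1,2) Gc]) (rule that)
  then show ?thesis using G(3) by auto
qed

section \<open>First order jets of submanifolds\<close>

lemma same_derivs_refl: "same_derivs r f f x"
  by (induction r arbitrary: f) auto

lemma same_derivs_sym: "same_derivs r f g x \<Longrightarrow> same_derivs r g f x"
  by (induction r arbitrary: f g) auto

lemma same_derivs_1: "same_derivs 1 f g x \<longleftrightarrow> f x = g x \<and> (\<forall>v. dif f x v = dif g x v)"
  unfolding One_nat_def by auto

lemma same_derivs_2: "same_derivs 2 f g x \<longleftrightarrow>
    f x = g x \<and> (\<forall>v. dif f x v = dif g x v) \<and> (\<forall>v w. dif2 f x v w = dif2 g x v w)"
  unfolding numeral_2_eq_2 by auto

lemma graph_at_value:
  assumes "topological_chart c" "graph_at c L p f"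
  shows "f (horiz (snd c p)) = vert (snd c p)"
proof -
  have "p \<in> L" "p \<in> fst c" using graph_atD[OF assms(2)] by auto
  then show ?thesis
    using assms(2) chart_inv_works(1)[OF assms(1), of p] unfolding graph_at_def by force
qed

lemma graph_at_smooth:
  assumes "graph_at c L p f"
  obtains S where "open S" "horiz (snd c p) \<in> S" "smooth_on S f"
  using assms open_horiz_image unfolding graph_at_def by blast

lemma graph_at_differentiable: "graph_at c L p f \<Longrightarrow> f differentiable (at (horiz (snd c p)))"
  by (metis graph_at_smooth smooth_onD)

lemma contact_refl:
  assumes "smooth_manifold A" "submanifold A L" "p \<in> L"
  shows "contact A r p L L"
proof -
  obtain c f where c: "c \<in> A" "graph_at c L p f" using assms submanifold_iff_graph[OF assms(1)] by blast
  then show ?thesis unfolding contact_def using same_derivs_refl[of r f] by blast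
qed

lemma tangent_to_graph_dif_eq:
  assumes A: "smooth_manifold A" "c \<in> A" and gr: "graph_at c L p f" "graph_at c L' p f'"
    and eq: "tangent_to A L p = tangent_to A L' p"
  shows "dif f (horiz (snd c p)) = dif f' (horiz (snd c p))"
proof
  fix w
  have p: "p \<in> fst c" using graph_atD gr by metis
  let ?v = "tvec_of A c p (join w (dif f (horiz (snd c p)) w))"
  have "?v \<in> tangent_to A L p"
    unfolding tangent_to_graph_iff[OF A gr(1)] using tvec_of_tangent[OF A p] tvec_of_same[OF A p] by simp
  then have "vert (?v c) = dif f' (horiz (snd c p)) (horiz (?v c))"
    using tangent_to_graph_iff[OF A gr(2)] eq by blast
  then show "dif f (horiz (snd c p)) w = dif f' (horiz (snd c p)) w"
    using tvec_of_same[OF A p] by simp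
qed

lemma graph_at_if_tangent:
  assumes A: "smooth_manifold A" "c \<in> A" and gr: "graph_at c L p f"
    and L': "submanifold A L'" "p \<in> L'" and eq: "tangent_to A L p = tangent_to A L' p"
  shows "\<exists>f'. graph_at c L' p f'"
proof (rule graph_at_if_transversal[OF A L'])
  show "p \<in> fst c" using graph_atD[OF gr] by simp
  fix v assume v: "v \<in> tangent_to A L' p" "horiz (v c) = 0"
  have "vert (v c) = dif f (horiz (snd c p)) 0"
    using v eq tangent_to_graph_iff[OF A gr] by metis
  also have "\<dots> = 0" using linear_0[OF linear_dif[OF graph_at_differentiable[OF gr]]] .
  finally show "v c = 0"
    using v(2) join_eq_iff[of "v c" 0] linear_0[OF linear_horiz] linear_0[OF linear_vert] by metis
qed

text \<open>
  The tangent space does not refer to a chart, which makes first order contact independent of the chart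
  in which it is tested.
\<close>

theorem contact_1_iff:
  assumes A: "smooth_manifold A" and L: "submanifold A L" "p \<in> L" and L': "submanifold A L'" "p \<in> L'"
  shows "contact A 1 p L L' \<longleftrightarrow> tangent_to A L p = tangent_to A L' p"
proof
  assume "contact A 1 p L L'"
  then obtain c f f' where c: "c \<in> A" "graph_at c L p f" "graph_at c L' p f'"
    "same_derivs 1 f f' (horiz (snd c p))" unfolding contact_def by blast
  then show "tangent_to A L p = tangent_to A L' p"
    using tangent_to_graph_iff[OF A c(1) c(2)] tangent_to_graph_iff[OF A c(1) c(3)]
    by (auto simp: same_derivs_1[unfolded One_nat_def] simp del: same_derivs.simps)
next
  assume eq: "tangent_to A L p = tangent_to A L' p"
  obtain c f where c: "c \<in> A" "graph_at c L p f"
    using L submanifold_iff_graph[OF A] by blast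
  obtain f' where f': "graph_at c L' p f'" using graph_at_if_tangent[OF A c L' eq] by blast
  have "same_derivs 1 f f' (horiz (snd c p))"
    unfolding same_derivs_1 using tangent_to_graph_dif_eq[OF A c f' eq]
      graph_at_value[OF manifold_chart[OF A c(1)]] c(2) f' by metis
  then show "contact A 1 p L L'" unfolding contact_def using c f' by blast
qed

lemma contact_2_imp_1: "contact A 2 p L L' \<Longrightarrow> contact A 1 p L L'"
  unfolding contact_def same_derivs_1 same_derivs_2 by blast

text \<open>
  Contact is an equivalence relation, so equality of jets is contact of representatives.
\<close>

lemma jet_1_eq_iff:
  assumes A: "smooth_manifold A" and L: "submanifold A L" "p \<in> L" and L': "submanifold A L'" "p' \<in> L'"
  shows "jet A 1 L p = jet A 1 L' p' \<longleftrightarrow> p = p' \<and> tangent_to A L p = tangent_to A L' p"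
proof
  assume eq: "jet A 1 L p = jet A 1 L' p'"
  then have p: "p = p'" by (simp add: jet_def)
  have "L \<in> snd (jet A 1 L p)" using L contact_refl[OF A L] by (simp add: jet_def)
  then have "contact A 1 p L' L" unfolding eq using p by (simp add: jet_def)
  then show "p = p' \<and> tangent_to A L p = tangent_to A L' p"
    using contact_1_iff[OF A L'(1) _ L] L'(2) p by simp
next
  assume eq: "p = p' \<and> tangent_to A L p = tangent_to A L' p"
  then have "contact A 1 p L N \<longleftrightarrow> contact A 1 p L' N" if "submanifold A N" "p \<in> N" for N
    using contact_1_iff[OF A L that] contact_1_iff[OF A L'(1) _ that] L'(2) eq by metis
  then show "jet A 1 L p = jet A 1 L' p'" using eq unfolding jet_def by blast
qed

lemma jet_rep:
  assumes A: "smooth_manifold A" and L: "submanifold A L" "p \<in> L"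
  shows "submanifold A (jet_rep (jet A r L p))" "p \<in> jet_rep (jet A r L p)"
    "contact A r p L (jet_rep (jet A r L p))"
proof -
  have "L \<in> snd (jet A r L p)" using L contact_refl[OF A L] by (simp add: jet_def)
  then have "jet_rep (jet A r L p) \<in> snd (jet A r L p)" unfolding jet_rep_def by (rule someI)
  then show "submanifold A (jet_rep (jet A r L p))" "p \<in> jet_rep (jet A r L p)"
    "contact A r p L (jet_rep (jet A r L p))" by (auto simp: jet_def)
qed

lemma fst_jet [simp]: "fst (jet A r L p) = p"
  by (simp add: jet_def)

lemma R_plane1_jet:
  assumes A: "smooth_manifold A" and L: "submanifold A L" "p \<in> L"
  shows "R_plane1 A (jet A 1 L p) = tangent_to A L p"
  using jet_rep[OF A L, of 1] contact_1_iff[OF A L] by (simp add: R_plane1_def)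

lemma jet_proj_jet_2:
  assumes A: "smooth_manifold A" and L: "submanifold A L" "p \<in> L"
  shows "jet_proj A 1 (jet A 2 L p) = jet A 1 L p"
  unfolding jet_proj_def fst_jet
  using jet_rep[OF A L, of 2] contact_1_iff[OF A L] jet_1_eq_iff[OF A _ _ L] contact_2_imp_1 by metis

lemma jet1_chart_dom_graph:
  assumes A: "smooth_manifold A" "c \<in> A" and L: "submanifold A L" "p \<in> L"
  shows "jet A 1 L p \<in> fst (jet1_chart A c) \<longleftrightarrow> (\<exists>f. graph_at c L p f)"
proof
  assume "jet A 1 L p \<in> fst (jet1_chart A c)"
  then obtain L' p' f where L': "jet A 1 L p = jet A 1 L' p'" "submanifold A L'" "graph_at c L' p' f"
    unfolding jet1_chart_def by auto
  then have "p = p'" "tangent_to A L' p = tangent_to A L p"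
    using jet_1_eq_iff[OF A(1) L L'(2)] graph_atD(1)[OF L'(3)] by auto
  then show "\<exists>f. graph_at c L p f" using graph_at_if_tangent[OF A _ L] L'(3) by blast
next
  assume "\<exists>f. graph_at c L p f"
  then show "jet A 1 L p \<in> fst (jet1_chart A c)" unfolding jet1_chart_def using L(1) by auto
qed

text \<open>
  The coordinates are defined by a unique description; uniqueness holds as the derivative of \<open>f\<close> is determined by
  the tangent plane.
\<close>

lemma jet1_chart_val_graph:
  fixes A :: "('e::{t2_space,second_countable_topology}, real^('n::finite + 'm::finite)) chart set"
  assumes A: "smooth_manifold A" "c \<in> A" and L: "submanifold A L" and gr: "graph_at c L p f"
  shows "snd (jet1_chart A c) (jet A 1 L p) = (snd c p, matrix (dif f (horiz (snd c p))))"
  unfolding jet1_chart_def snd_conv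
proof (rule the_equality)
  have m: "(\<chi> i \<mu>. dif f x (axis \<mu> 1) $ i) = matrix (dif f x)" for f :: "real^'n \<Rightarrow> real^'m" and x
    by (simp add: matrix_def)
  show "\<exists>L' p' f'. submanifold A L' \<and> graph_at c L' p' f' \<and> jet A 1 L p = jet A 1 L' p' \<and>
     (snd c p, matrix (dif f (horiz (snd c p)))) = (snd c p', \<chi> i \<mu>. dif f' (horiz (snd c p')) (axis \<mu> 1) $ i)"
    using L gr by (auto simp: m)
  fix y assume "\<exists>L' p' f'. submanifold A L' \<and> graph_at c L' p' f' \<and> jet A 1 L p = jet A 1 L' p' \<and>
     y = (snd c p', \<chi> i \<mu>. dif f' (horiz (snd c p')) (axis \<mu> 1) $ i)"
  then obtain L' p' f' where L': "submanifold A L'" "graph_at c L' p' f'" "jet A 1 L p = jet A 1 L' p'"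
    and y: "y = (snd c p', matrix (dif f' (horiz (snd c p'))))" by (auto simp: m)
  have "p = p'" "tangent_to A L p = tangent_to A L' p"
    using L' jet_1_eq_iff[OF A(1) L graph_atD(1)[OF gr] L'(1)] graph_atD(1)[OF L'(2)] by auto
  then have "dif f (horiz (snd c p)) = dif f' (horiz (snd c p))"
    using tangent_to_graph_dif_eq[OF A gr] L'(2) by blast
  then show "y = (snd c p, matrix (dif f (horiz (snd c p))))" using y \<open>p = p'\<close> by simp
qed

context
  fixes A :: "('e::{t2_space,second_countable_topology}, real^('n::finite + 'm::finite)) chart set"
    and c L \<Omega> G x0
  assumes A: "smooth_manifold A" "c \<in> A" and L: "submanifold A L"
    and G: "parametrizes A L \<Omega> G" "x0 \<in> \<Omega>"
begin

lemma parametrizes_linear_dif: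
  assumes "G x0 \<in> fst c"
  shows "linear (dif (\<lambda>x. snd c (G x)) x0)" "inj (dif (\<lambda>x. snd c (G x)) x0)"
  using linear_dif[OF smooth_into_differentiable[OF parametrizesD(2)[OF G(1)] A(2) G(2) assms]]
    inj_push_iff[OF A parametrizesD(2)[OF G(1)] G(2) assms] parametrizesD(3)[OF G] by auto

lemma parametrizes_dif_graph:
  assumes "graph_at c L (G x0) f"
  shows "vert (dif (\<lambda>x. snd c (G x)) x0 w) = dif f (horiz (snd c (G x0))) (horiz (dif (\<lambda>x. snd c (G x)) x0 w))"
proof -
  have "push A G x0 w \<in> tangent_to A L (G x0)" using tangent_to_parametrizes[OF A(1) G] by auto
  then show ?thesis
    using tangent_to_graph_iff[OF A assms] graph_atD(2)[OF assms] A(2) by (simp add: push_def)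
qed

lemma graph_at_iff_det:
  "(\<exists>f. graph_at c L (G x0) f) \<longleftrightarrow>
    G x0 \<in> fst c \<and> det (hmat (matrix (dif (\<lambda>x. snd c (G x)) x0))) \<noteq> 0"
proof (cases "G x0 \<in> fst c")
  case True
  note lin = parametrizes_linear_dif[OF True]
  have mw: "matrix (dif (\<lambda>x. snd c (G x)) x0) *v w = dif (\<lambda>x. snd c (G x)) x0 w" for w
    by (rule matrix_dif_works[OF smooth_into_differentiable[OF parametrizesD(2)[OF G(1)] A(2) G(2) True]])
  show ?thesis unfolding det_hmat_iff mw
  proof
    assume "\<exists>f. graph_at c L (G x0) f"
    then obtain f where f: "graph_at c L (G x0) f" by blast
    have "inj (\<lambda>w. horiz (dif (\<lambda>x. snd c (G x)) x0 w))"
    proof (rule injI)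
      fix v w assume "horiz (dif (\<lambda>x. snd c (G x)) x0 v) = horiz (dif (\<lambda>x. snd c (G x)) x0 w)"
      then have "dif (\<lambda>x. snd c (G x)) x0 v = dif (\<lambda>x. snd c (G x)) x0 w"
        using parametrizes_dif_graph[OF f] by (metis join_eq_iff)
      then show "v = w" using lin(2) by (simp add: inj_eq)
    qed
    then show "G x0 \<in> fst c \<and> inj (\<lambda>w. horiz (dif (\<lambda>x. snd c (G x)) x0 w))" using True by simp
  next
    assume "G x0 \<in> fst c \<and> inj (\<lambda>w. horiz (dif (\<lambda>x. snd c (G x)) x0 w))"
    then have i: "inj (\<lambda>w. horiz (dif (\<lambda>x. snd c (G x)) x0 w))" by simp
    show "\<exists>f. graph_at c L (G x0) f"
      by (rule parametrizes_graph[OF A G True i]) blast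
  qed
next
  case False
  then show ?thesis using graph_atD(2)[of c L "G x0"] by auto
qed

lemma jet1_chart_dom:
  "jet A 1 L (G x0) \<in> fst (jet1_chart A c) \<longleftrightarrow>
    G x0 \<in> fst c \<and> det (hmat (matrix (dif (\<lambda>x. snd c (G x)) x0))) \<noteq> 0"
  using jet1_chart_dom_graph[OF A L parametrizesD(4)[OF G]] graph_at_iff_det by simp

text \<open>
  The derivative coordinates of the jet are the slope of the tangent plane, for every parametrization.
\<close>

lemma jet1_chart_val:
  assumes "G x0 \<in> fst c" "det (hmat (matrix (dif (\<lambda>x. snd c (G x)) x0))) \<noteq> 0"
  shows "snd (jet1_chart A c) (jet A 1 L (G x0)) = (snd c (G x0), slope (matrix (dif (\<lambda>x. snd c (G x)) x0)))"
proof -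
  obtain f where f: "graph_at c L (G x0) f" using graph_at_iff_det assms by blast
  have mw: "matrix (dif (\<lambda>x. snd c (G x)) x0) *v w = dif (\<lambda>x. snd c (G x)) x0 w" for w
    by (rule matrix_dif_works[OF smooth_into_differentiable[OF parametrizesD(2)[OF G(1)] A(2) G(2) assms(1)]])
  have "slope (matrix (dif (\<lambda>x. snd c (G x)) x0)) = matrix (dif f (horiz (snd c (G x0))))"
    by (rule slope_eqI[OF assms(2)])
       (simp add: mw parametrizes_dif_graph[OF f] matrix_dif_works[OF graph_at_differentiable[OF f]])
  then show ?thesis using jet1_chart_val_graph[OF A L f] by simp
qed

end

lemma smooth_into_jet_lift:
  assumes A: "smooth_manifold A" and L: "submanifold A L" and G: "parametrizes A L \<Omega> G"
  shows "smooth_into (jet1_atlas A) \<Omega> (\<lambda>x. jet A 1 L (G x))"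
  unfolding smooth_into_def jet1_atlas_def
proof (intro ballI, elim imageE, hypsubst)
  fix D c assume c: "c \<in> A"
  note sm = smooth_intoD[OF parametrizesD(2)[OF G] c]
  let ?B = "\<lambda>x. matrix (dif (\<lambda>x. snd c (G x)) x)"
  note sB = smooth_on_matrix_dif[OF sm]
  let ?O = "{x \<in> \<Omega>. G x \<in> fst c}"
  have sh: "smooth_on ?O (\<lambda>x. hmat (?B x))" unfolding hmat_def
    by (rule smooth_on_vec[OF sm(1)]) (simp add: smooth_on_nth[OF sm(1) sB])
  have eq: "{x \<in> \<Omega>. jet A 1 L (G x) \<in> fst (jet1_chart A c)} = ?O \<inter> (\<lambda>x. det (hmat (?B x))) -` (- {0})"
    using jet1_chart_dom[OF A c L G] by auto
  have o: "open (?O \<inter> (\<lambda>x. det (hmat (?B x))) -` (- {0}))"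
    by (rule continuous_open_preimage[OF smooth_on_continuous[OF smooth_on_det[OF sm(1) sh]] sm(1)]) (rule open_Compl, rule closed_singleton)
  have "smooth_on (?O \<inter> (\<lambda>x. det (hmat (?B x))) -` (- {0})) (\<lambda>x. (snd c (G x), slope (?B x)))"
    by (intro smooth_on_Pair smooth_on_slope o smooth_on_subset[OF sB] smooth_on_subset[OF sm(2)]) auto
  then have "smooth_on (?O \<inter> (\<lambda>x. det (hmat (?B x))) -` (- {0})) (\<lambda>x. snd (jet1_chart A c) (jet A 1 L (G x)))"
    by (rule smooth_on_cong[OF o, rotated]) (use jet1_chart_val[OF A c L G] in auto)
  then show "open {x \<in> \<Omega>. jet A 1 L (G x) \<in> fst (jet1_chart A c)} \<and>
     smooth_on {x \<in> \<Omega>. jet A 1 L (G x) \<in> fst (jet1_chart A c)} (\<lambda>x. snd (jet1_chart A c) (jet A 1 L (G x)))"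
    unfolding eq using o by blast
qed

text \<open>
  The left inverse of the lifted parametrization forgets the derivative coordinates and uses the left
  inverse of \<open>G\<close> given by the horizontal coordinates.
\<close>

theorem tangent_to_prolongation:
  fixes A :: "('e::{t2_space,second_countable_topology}, real^('n::finite + 'm::finite)) chart set"
  assumes A: "smooth_manifold A" and L: "submanifold A L" and G: "parametrizes A L \<Omega> G" "x0 \<in> \<Omega>"
  shows "tangent_to (jet1_atlas A) (jet_prolongation A 1 L) (jet A 1 L (G x0))
       = range (push (jet1_atlas A) (\<lambda>x. jet A 1 L (G x)) x0)" (is "?A = ?B")
    and "inj (push (jet1_atlas A) (\<lambda>x. jet A 1 L (G x)) x0)"
proof -
  have p: "G x0 \<in> L" by (rule parametrizesD(4)[OF G])
  obtain c f0 where c: "c \<in> A" "graph_at c L (G x0) f0"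
    using L p submanifold_iff_graph[OF A] by blast
  note tc = manifold_chart[OF A c(1)]
  have Gc: "G x0 \<in> fst c" using graph_atD[OF c(2)] by simp
  have "det (hmat (matrix (dif (\<lambda>x. snd c (G x)) x0))) \<noteq> 0"
    using graph_at_iff_det[OF A c(1) L G] c(2) by blast
  then have inj: "inj (\<lambda>w. horiz (dif (\<lambda>x. snd c (G x)) x0 w))"
    unfolding det_hmat_iff
      matrix_dif_works[OF smooth_into_differentiable[OF parametrizesD(2)[OF G(1)] c(1) G(2) Gc]] .
  obtain f S V g where S: "open S" "x0 \<in> S" "S \<subseteq> {x \<in> \<Omega>. G x \<in> fst c}"
    and V: "open V" "smooth_on V g"
    and gl: "\<And>x. x \<in> S \<Longrightarrow> horiz (snd c (G x)) \<in> V \<and> g (horiz (snd c (G x))) = x \<and> vert (snd c (G x)) = f (horiz (snd c (G x)))"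
    by (rule parametrizes_graph[OF A c(1) G Gc inj]) (rule that; assumption)
  have SO: "S \<subseteq> \<Omega>" using S by auto
  obtain W0 where W0: "open W0" "W0 \<inter> L = G ` S"
    using parametrizesD(5)[OF G(1) S(1) SO] by (elim exE conjE) (rule that)
  let ?W0 = "snd c ` (fst c \<inter> W0)"
  let ?C = "jet1_chart A c" and ?P = "\<lambda>x. jet A 1 L (G x)"
  have par: "parametrizes A L S G" by (rule parametrizes_subset[OF G(1) S(1) SO])
  have val: "fst (snd ?C (jet A 1 L q)) = snd c q \<and> q \<in> fst c" if "q \<in> L" "jet A 1 L q \<in> fst ?C" for q
    using jet1_chart_dom_graph[OF A c(1) L that(1)] jet1_chart_val_graph[OF A c(1) L] that(2) graph_atD(2)
    by fastforce
  have C: "?P x0 \<in> fst ?C" using jet1_chart_dom_graph[OF A c(1) L p] c(2) by blast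
  have x0v: "fst (snd ?C (?P x0)) = snd c (G x0)" using val[OF p C] by simp
  have gd: "g differentiable at (horiz (snd c (G x0)))"
    using gl[OF S(2)] by (intro smooth_onD[OF V(2)]) simp
  have "(\<lambda>z. g (horiz (fst z))) differentiable at (snd ?C (?P x0))"
  proof -
    have "linear (\<lambda>z :: (real^('n+'m)) \<times> (real^'n^'m). horiz (fst z))"
      using linear_compose[OF linear_fst linear_horiz] by (simp add: o_def)
    from differentiable_chain_at[where f="\<lambda>z. horiz (fst z)" and g=g and x="snd ?C (?P x0)",
        OF linear_imp_differentiable[OF this]] gd x0v
    show ?thesis by (simp add: o_def)
  qed
  note h = this
  have qW: "\<exists>x\<in>S. q = ?P x \<and> g (horiz (fst (snd ?C q))) = x"
    if q: "q \<in> jet_prolongation A 1 L" "q \<in> fst ?C" "snd ?C q \<in> ?W0 \<times> UNIV" for q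
  proof -
    obtain q' where q': "q' \<in> L" "q = jet A 1 L q'" using q(1) unfolding jet_prolongation_def by (elim imageE) (rule that)
    have v: "fst (snd ?C q) = snd c q'" "q' \<in> fst c" using val[OF q'(1)] q'(2) q(2) by auto
    then have "snd c q' \<in> ?W0" using q(3) by (metis mem_Times_iff)
    then have "q' \<in> W0" using chart_inj[OF tc] v(2) by (auto dest: inj_onD)
    then have "q' \<in> G ` S" using W0(2) q'(1) by (metis IntI)
    then obtain x where "x \<in> S" "q' = G x" by (elim imageE) (rule that)
    then show ?thesis using gl v q' by auto
  qed
  have *: "open S" "x0 \<in> S" "smooth_into (jet1_atlas A) S ?P" "?P ` S \<subseteq> jet_prolongation A 1 L"
    "?C \<in> jet1_atlas A" "?P x0 \<in> fst ?C" "open (?W0 \<times> (UNIV :: (real^'n^'m) set))" "snd ?C (?P x0) \<in> ?W0 \<times> UNIV"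
  proof -
    show "smooth_into (jet1_atlas A) S ?P" by (rule smooth_into_jet_lift[OF A L par])
    show "?P ` S \<subseteq> jet_prolongation A 1 L"
      using parametrizesD(4)[OF par] by (auto simp: jet_prolongation_def)
    show "?C \<in> jet1_atlas A" using c(1) by (simp add: jet1_atlas_def)
    show "open (?W0 \<times> (UNIV :: (real^'n^'m) set))" by (intro open_Times open_chart_image[OF tc W0(1)] open_UNIV)
    have "G x0 \<in> W0" using W0(2) S(2) by blast
    then show "snd ?C (?P x0) \<in> ?W0 \<times> UNIV" using x0v Gc by (auto simp: mem_Times_iff)
  qed (fact S(1) S(2) C)+
  have inv: "g (horiz (fst (snd ?C q))) \<in> S \<and> ?P (g (horiz (fst (snd ?C q)))) = q"
    if "q \<in> jet_prolongation A 1 L" "q \<in> fst ?C" "snd ?C q \<in> ?W0 \<times> UNIV" for q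
    using qW[OF that] by auto
  have left: "g (horiz (fst (snd ?C (?P x)))) = x"
    if "x \<in> S" "?P x \<in> fst ?C" "snd ?C (?P x) \<in> ?W0 \<times> UNIV" for x
    using val[OF parametrizesD(4)[OF par that(1)] that(2)] gl[OF that(1)] by simp
  show "?A = ?B" by (rule tangent_to_param(1)[OF * h inv left])
  show "inj (push (jet1_atlas A) ?P x0)" by (rule tangent_to_param(2)[OF * h inv left])
qed

lemma graph_submanifold:
  assumes A: "smooth_manifold A" "c \<in> A" and f: "smooth_on UNIV f" and p: "p \<in> fst c"
    "vert (snd c p) = f (horiz (snd c p))"
  shows "submanifold A {q \<in> fst c. vert (snd c q) = f (horiz (snd c q))}"
    "graph_at c {q \<in> fst c. vert (snd c q) = f (horiz (snd c q))} p f"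
proof -
  let ?L = "{q \<in> fst c. vert (snd c q) = f (horiz (snd c q))}"
  note tc = manifold_chart[OF A]
  have gr: "graph_at c ?L q f" if "q \<in> ?L" for q
    unfolding graph_at_def
    using that chart_open(2)[OF tc] chart_inv_works[OF tc] smooth_on_subset[OF f]
    by (intro conjI exI[of _ "snd c ` fst c"]) auto
  show "submanifold A ?L" unfolding submanifold_iff_graph[OF A(1)] using gr A(2) by blast
  show "graph_at c ?L p f" using gr p by blast
qed

section \<open>Transition maps of first order jets, and second order jets\<close>

lemma smooth_on_matrix:
  fixes F :: "'a::euclidean_space \<Rightarrow> real^'n \<Rightarrow> real^'k"
  assumes "open S" "\<And>j. smooth_on S (\<lambda>x. F x (axis j 1))"
  shows "smooth_on S (\<lambda>x. matrix (F x))"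
  unfolding matrix_def
  by (intro smooth_on_vec[OF assms(1)]) (simp add: smooth_on_nth[OF assms])

lemma smooth_on_hmat:
  fixes B :: "'a::euclidean_space \<Rightarrow> real^'n^('n::finite + 'm::finite)"
  assumes "open S" "smooth_on S B"
  shows "smooth_on S (\<lambda>x. hmat (B x))"
  unfolding hmat_def by (rule smooth_on_vec[OF assms(1)]) (simp add: smooth_on_nth[OF assms])

text \<open>
  Coordinate expressions of maps to first order jets have this form: a map to \<open>E\<close> together with the slope of
  a plane that is spanned by a matrix of smooth functions.
\<close>

lemma slope_differentiable:
  fixes B :: "'a::euclidean_space \<Rightarrow> real^'n^('n::finite + 'm::finite)" and \<phi> :: "'a \<Rightarrow> 'b::euclidean_space"
  assumes S: "open S" "smooth_on S \<phi>" "smooth_on S B" and z: "z \<in> S" "det (hmat (B z)) \<noteq> 0"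
    and eq: "\<And>x. x \<in> S \<Longrightarrow> det (hmat (B x)) \<noteq> 0 \<Longrightarrow> F x = (\<phi> x, slope (B x))"
  shows "F differentiable (at z)"
proof -
  let ?S = "S \<inter> (\<lambda>x. det (hmat (B x))) -` (- {0})"
  have o: "open ?S"
    by (rule continuous_open_preimage[OF smooth_on_continuous[OF smooth_on_det[OF S(1) smooth_on_hmat[OF S(1,3)]]] S(1)])
       (rule open_Compl, rule closed_singleton)
  have "smooth_on ?S (\<lambda>x. (\<phi> x, slope (B x)))"
    by (intro smooth_on_Pair smooth_on_slope o smooth_on_subset[OF S(2)] smooth_on_subset[OF S(3)]) auto
  then have "smooth_on ?S F" by (rule smooth_on_cong[OF o, rotated]) (simp add: eq)
  then show ?thesis by (rule smooth_onD) (use z in simp)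
qed

text \<open>
  Affine graphs represent all points of a jet chart. They are used to evaluate coordinate expressions of maps
  between jets without computing with jets.
\<close>

lemma exists_plane:
  assumes A: "smooth_manifold A" "c \<in> A" and p: "p \<in> fst c"
  obtains L f where "submanifold A L" "graph_at c L p f" "matrix (dif f (horiz (snd c p))) = u"
proof -
  define f where "f x = vert (snd c p) + u *v (x - horiz (snd c p))" for x
  have d: "(f has_derivative (*v) u) (at x)" for x
    unfolding f_def by (auto intro!: derivative_eq_intros bounded_linear.has_derivative[OF matrix_vector_mul_bounded_linear])
  have "smooth_on UNIV (\<lambda>x. (vert (snd c p) - u *v horiz (snd c p)) + u *v x)"
    by (intro smooth_on_add smooth_on_const smooth_on_linear open_UNIV matrix_vector_mul_linear)
  then have sm: "smooth_on UNIV f"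
    by (rule smooth_on_cong[OF open_UNIV, rotated]) (simp add: f_def matrix_vector_mult_diff_distrib)
  have val: "vert (snd c p) = f (horiz (snd c p))" by (simp add: f_def)
  show ?thesis
    by (rule that[OF graph_submanifold[OF A sm p val]]) (simp add: dif_eqI[OF d] matrix_of_matrix_vector_mul)
qed

lemma jet1_chart_inj:
  assumes A: "smooth_manifold A" "c \<in> A"
  shows "inj_on (snd (jet1_chart A c)) (fst (jet1_chart A c))"
proof (rule inj_onI)
  fix \<theta> \<theta>' assume "\<theta> \<in> fst (jet1_chart A c)" "\<theta>' \<in> fst (jet1_chart A c)"
    and eq: "snd (jet1_chart A c) \<theta> = snd (jet1_chart A c) \<theta>'"
  then obtain L p f L' p' f' where 1: "\<theta> = jet A 1 L p" "submanifold A L" "graph_at c L p f"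
    and 2: "\<theta>' = jet A 1 L' p'" "submanifold A L'" "graph_at c L' p' f'"
    unfolding jet1_chart_def by auto
  note p = graph_atD[OF 1(3)] graph_atD[OF 2(3)]
  have e: "snd c p = snd c p'" "matrix (dif f (horiz (snd c p))) = matrix (dif f' (horiz (snd c p')))"
    using eq jet1_chart_val_graph[OF A 1(2,3)] jet1_chart_val_graph[OF A 2(2,3)] 1(1) 2(1) by auto
  then have pp: "p = p'" using chart_inj[OF manifold_chart[OF A]] p by (auto dest: inj_onD)
  have "dif f (horiz (snd c p)) w = dif f' (horiz (snd c p)) w" for w
    using e(2) matrix_dif_works[OF graph_at_differentiable[OF 1(3)]]
      matrix_dif_works[OF graph_at_differentiable[OF 2(3)]] pp by metis
  then have "tangent_to A L p = tangent_to A L' p"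
    using tangent_to_graph_iff[OF A 1(3)] tangent_to_graph_iff[OF A 2(3)] pp by auto
  then show "\<theta> = \<theta>'" unfolding 1(1) 2(1) using jet_1_eq_iff[OF A(1) 1(2) p(1) 2(2) p(3)] pp by simp
qed

lemma jet1_chart_inv:
  assumes A: "smooth_manifold A" "c \<in> A" and L: "submanifold A L" "graph_at c L p f"
  shows "chart_inv (jet1_chart A c) (snd c p, matrix (dif f (horiz (snd c p)))) = jet A 1 L p"
  unfolding chart_inv_def
  by (rule inv_into_f_eq[OF jet1_chart_inj[OF A]])
     (use jet1_chart_dom_graph[OF A L(1) graph_atD(1)[OF L(2)]] jet1_chart_val_graph[OF A L] L(2) in auto)

lemma jet1_chart_cases:
  assumes "\<theta> \<in> fst (jet1_chart A c)"
  obtains L f where "\<theta> = jet A 1 L (fst \<theta>)" "submanifold A L" "graph_at c L (fst \<theta>) f"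
proof -
  obtain L p f where "\<theta> = jet A 1 L p" "submanifold A L" "graph_at c L p f"
    using assms unfolding jet1_chart_def by auto
  then show ?thesis using that[of L f] by simp
qed

lemma graph_at_dif_change:
  assumes A: "smooth_manifold A" "c \<in> A" "d \<in> A" and L: "graph_at c L p f" "p \<in> fst d"
  obtains \<Omega> where "parametrizes A L \<Omega> (\<lambda>x. chart_inv c (join x (f x)))" "horiz (snd c p) \<in> \<Omega>"
    "chart_inv c (join (horiz (snd c p)) (f (horiz (snd c p)))) = p"
    "\<And>w. dif (\<lambda>x. snd d (chart_inv c (join x (f x)))) (horiz (snd c p)) w
       = dif (transition c d) (snd c p) (join w (dif f (horiz (snd c p)) w))"
proof -
  obtain \<Omega> where *: "parametrizes A L \<Omega> (\<lambda>x. chart_inv c (join x (f x)))" "horiz (snd c p) \<in> \<Omega>"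
    "join (horiz (snd c p)) (f (horiz (snd c p))) = snd c p"
    "\<And>x w. x \<in> \<Omega> \<Longrightarrow> dif (\<lambda>x. snd c (chart_inv c (join x (f x)))) x w = join w (dif f x w)"
    by (rule graph_parametrizes[OF A(1,2) L(1)]) (rule that; assumption)
  have p: "p \<in> fst c" using graph_atD[OF L(1)] by simp
  have Gp: "chart_inv c (join (horiz (snd c p)) (f (horiz (snd c p)))) = p"
    using *(3) chart_inv_works(1)[OF manifold_chart[OF A(1,2)] p] by simp
  show ?thesis
    by (rule that[OF *(1,2) Gp])
       (use dif_chart_change[OF A parametrizesD(2)[OF *(1)] *(2)] Gp p L(2) *(4)[OF *(2)] in simp)
qed

text \<open>
  The point with coordinates \<open>(y, u)\<close> is the jet of an affine graph, whose tangent plane in the chart \<open>d\<close> is the image of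
  the graph of \<open>u\<close> under the derivative of the transition map.
\<close>

lemma jet1_transition:
  assumes A: "smooth_manifold A" "c \<in> A" "d \<in> A" and p: "p \<in> fst c" "p \<in> fst d"
  shows "chart_inv (jet1_chart A c) (snd c p, u) \<in> fst (jet1_chart A d) \<longleftrightarrow>
      det (hmat (matrix (\<lambda>w. dif (transition c d) (snd c p) (join w (u *v w))))) \<noteq> 0" (is ?dom)
    and "det (hmat (matrix (\<lambda>w. dif (transition c d) (snd c p) (join w (u *v w))))) \<noteq> 0 \<Longrightarrow>
      transition (jet1_chart A c) (jet1_chart A d) (snd c p, u)
      = (transition c d (snd c p), slope (matrix (\<lambda>w. dif (transition c d) (snd c p) (join w (u *v w)))))"
proof -
  obtain L f where L: "submanifold A L" "graph_at c L p f" "matrix (dif f (horiz (snd c p))) = u"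
    by (rule exists_plane[OF A(1,2) p(1)])
  obtain \<Omega> where \<Omega>: "parametrizes A L \<Omega> (\<lambda>x. chart_inv c (join x (f x)))" "horiz (snd c p) \<in> \<Omega>"
    "chart_inv c (join (horiz (snd c p)) (f (horiz (snd c p)))) = p"
    "\<And>w. dif (\<lambda>x. snd d (chart_inv c (join x (f x)))) (horiz (snd c p)) w
       = dif (transition c d) (snd c p) (join w (dif f (horiz (snd c p)) w))"
    by (rule graph_at_dif_change[OF A L(2) p(2)]) (rule that; assumption)
  have df: "dif f (horiz (snd c p)) w = u *v w" for w
    using matrix_dif_works[OF graph_at_differentiable[OF L(2)]] L(3) by metis
  have D: "dif (\<lambda>x. snd d (chart_inv c (join x (f x)))) (horiz (snd c p))
      = (\<lambda>w. dif (transition c d) (snd c p) (join w (u *v w)))"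
    using \<Omega>(4) df by auto
  have J: "chart_inv (jet1_chart A c) (snd c p, u) = jet A 1 L p"
    using jet1_chart_inv[OF A(1,2) L(1,2)] L(3) by simp
  show ?dom unfolding J
    using jet1_chart_dom[OF A(1,3) L(1) \<Omega>(1,2)] \<Omega>(3) p D by simp
  show "transition (jet1_chart A c) (jet1_chart A d) (snd c p, u)
      = (transition c d (snd c p), slope (matrix (\<lambda>w. dif (transition c d) (snd c p) (join w (u *v w)))))"
    if "det (hmat (matrix (\<lambda>w. dif (transition c d) (snd c p) (join w (u *v w))))) \<noteq> 0"
    unfolding transition_apply[of "jet1_chart A c"] J
    using jet1_chart_val[OF A(1,3) L(1) \<Omega>(1,2)] \<Omega>(3) p D that transition_snd[OF manifold_chart[OF A(1,2)] p(1), of d]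
    by simp
qed

lemma jet1_chart_coords:
  assumes A: "smooth_manifold A" "c \<in> A" and \<theta>: "\<theta> \<in> fst (jet1_chart A c)"
  shows "fst \<theta> \<in> fst c" "fst (snd (jet1_chart A c) \<theta>) = snd c (fst \<theta>)"
    "chart_inv (jet1_chart A c) (snd (jet1_chart A c) \<theta>) = \<theta>"
proof -
  obtain L f where L: "\<theta> = jet A 1 L (fst \<theta>)" "submanifold A L" "graph_at c L (fst \<theta>) f"
    by (rule jet1_chart_cases[OF \<theta>])
  show "fst \<theta> \<in> fst c" using graph_atD[OF L(3)] by simp
  show "fst (snd (jet1_chart A c) \<theta>) = snd c (fst \<theta>)"
    using jet1_chart_val_graph[OF A L(2,3)] L(1) by simp
  show "chart_inv (jet1_chart A c) (snd (jet1_chart A c) \<theta>) = \<theta>"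
    using jet1_chart_val_graph[OF A L(2,3)] jet1_chart_inv[OF A L(2,3)] L(1) by simp
qed

lemma jet1_transition_differentiable:
  fixes A :: "('e::{t2_space,second_countable_topology}, real^('n::finite + 'm::finite)) chart set"
  assumes A: "smooth_manifold A" "c \<in> A" "d \<in> A"
    and \<theta>: "\<theta> \<in> fst (jet1_chart A c)" "\<theta> \<in> fst (jet1_chart A d)"
  shows "transition (jet1_chart A c) (jet1_chart A d) differentiable (at (snd (jet1_chart A c) \<theta>))"
proof -
  note co = jet1_chart_coords[OF A(1,2) \<theta>(1)]
  have pd: "fst \<theta> \<in> fst d" using jet1_chart_coords[OF A(1,3) \<theta>(2)] by simp
  note tc = manifold_chart[OF A(1,2)]
  define u where "u = snd (snd (jet1_chart A c) \<theta>)"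
  have su: "snd (jet1_chart A c) \<theta> = (snd c (fst \<theta>), u)" using co(2) by (simp add: u_def prod_eq_iff)
  let ?U = "snd c ` (fst c \<inter> fst d)"
  let ?S = "?U \<times> (UNIV :: (real^'n^'m) set)"
  let ?B = "\<lambda>z :: (real^('n+'m)) \<times> (real^'n^'m). matrix (\<lambda>w. dif (transition c d) (fst z) (join w (snd z *v w)))"
  have o: "open ?S" by (intro open_Times open_overlap[OF A] open_UNIV)
  have s1: "smooth_on ?S fst" by (rule smooth_on_linear[OF linear_fst])
  have s2: "smooth_on ?S (\<lambda>z. transition c d (fst z))"
    by (rule smooth_on_compose[OF smooth_transition[OF A] s1 o open_overlap[OF A]]) auto
  have s3: "smooth_on ?S ?B"
  proof (rule smooth_on_matrix[OF o])
    fix j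
    have "linear (\<lambda>u :: real^'n^'m. u *v axis j 1)"
      by (auto intro!: linearI simp: matrix_vector_mult_add_rdistrib scaleR_matrix_vector_assoc)
    then have "smooth_on ?S (\<lambda>z. snd z *v axis j 1)"
      using smooth_on_linear_comp[OF _ o smooth_on_linear[OF linear_snd]] by blast
    then have "smooth_on ?S (\<lambda>z. join (axis j 1) (snd z *v axis j 1))"
      by (intro smooth_on_join o smooth_on_const)
    then show "smooth_on ?S (\<lambda>z. dif (transition c d) (fst z) (join (axis j 1) (snd z *v axis j 1)))"
      by (rule smooth_on_dif_apply[OF smooth_transition[OF A] s1 _ o open_overlap[OF A]]) auto
  qed
  show ?thesis
  proof (rule slope_differentiable[OF o s2 s3])
    show "snd (jet1_chart A c) \<theta> \<in> ?S" using su co pd by auto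
    show "det (hmat (?B (snd (jet1_chart A c) \<theta>))) \<noteq> 0"
      using jet1_transition(1)[OF A co(1) pd, of u] co(3) \<theta>(2) su by simp
    fix z assume z: "z \<in> ?S" "det (hmat (?B z)) \<noteq> 0"
    then obtain p where p: "p \<in> fst c" "p \<in> fst d" "fst z = snd c p" by auto
    show "transition (jet1_chart A c) (jet1_chart A d) z = (transition c d (fst z), slope (?B z))"
    proof -
      have "transition (jet1_chart A c) (jet1_chart A d) (snd c p, snd z)
        = (transition c d (snd c p), slope (?B z))"
        using jet1_transition(2)[OF A p(1,2), of "snd z"] z(2) unfolding p(3) by simp
      then show ?thesis unfolding p(3)[symmetric] by simp
    qed
  qed
qed

text \<open>
  The velocity coordinates of prolongations transform by the Jacobians of the transition maps between jet
  charts, hence are tangent vectors.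
\<close>

lemma push_jet_tangent:
  assumes A: "smooth_manifold A" and P: "smooth_into (jet1_atlas A) \<Omega> P" "x \<in> \<Omega>"
  shows "push (jet1_atlas A) P x w \<in> tangent_space (jet1_atlas A) (P x)"
  unfolding tangent_space_def
proof (intro CollectI conjI allI impI ballI)
  fix C assume "\<not> (C \<in> jet1_atlas A \<and> P x \<in> fst C)"
  then show "push (jet1_atlas A) P x w C = 0" by (auto simp: push_def)
next
  fix C D assume CD: "C \<in> jet1_atlas A" "D \<in> jet1_atlas A" "P x \<in> fst C \<inter> fst D"
  obtain c d where c: "c \<in> A" "C = jet1_chart A c" and d: "d \<in> A" "D = jet1_chart A d"
    using CD unfolding jet1_atlas_def by blast
  have td: "transition C D differentiable (at (snd C (P x)))"
    unfolding c(2) d(2) by (rule jet1_transition_differentiable[OF A c(1) d(1)]) (use CD c d in auto)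
  have "dif (\<lambda>y. snd D (P y)) x = dif (\<lambda>y. transition C D (snd C (P y))) x"
  proof (rule dif_cong_open[OF smooth_intoD(1)[OF P(1) CD(1)]])
    show "x \<in> {x \<in> \<Omega>. P x \<in> fst C}" using P CD by simp
    fix y assume "y \<in> {x \<in> \<Omega>. P x \<in> fst C}"
    then show "snd D (P y) = transition C D (snd C (P y))"
      using jet1_chart_coords(3)[OF A c(1)] c(2) by (simp add: transition_apply)
  qed
  moreover have "dif (\<lambda>y. transition C D (snd C (P y))) x w = dif (transition C D) (snd C (P x)) (dif (\<lambda>y. snd C (P y)) x w)"
    by (rule dif_compose[OF smooth_into_differentiable[OF P(1) CD(1) P(2)] td]) (use CD in simp)
  ultimately show "push (jet1_atlas A) P x w D = dif (transition C D) (snd C (P x)) (push (jet1_atlas A) P x w C)"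
    using CD by (simp add: push_def)
qed

text \<open>
  The plane that the context assigns to the second order jet of \<open>L\<close> at \<open>p\<close>.
\<close>

definition plane2 :: "('e::topological_space, real^('n::finite + 'm::finite)) chart set \<Rightarrow> 'e set \<Rightarrow> 'e \<Rightarrow>
    ('e jet, (real^('n + 'm)) \<times> (real^'n^'m)) tvec set" where
  "plane2 A L p = tangent_to (jet1_atlas A) (jet_prolongation A 1 L) (jet A 1 L p)"

text \<open>
  The prolongation of a graph is \<open>x \<mapsto> (x, f x, Df x)\<close>, and its derivative shows the second
  derivatives of \<open>f\<close> as the last component.
\<close>

lemma plane2_graph_iff:
  fixes A :: "('e::{t2_space,second_countable_topology}, real^('n::finite + 'm::finite)) chart set"
  assumes A: "smooth_manifold A" "c \<in> A" and L: "submanifold A L" and gr: "graph_at c L p f"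
  shows "v \<in> plane2 A L p \<longleftrightarrow> v \<in> tangent_space (jet1_atlas A) (jet A 1 L p) \<and>
    (\<exists>w. v (jet1_chart A c) = (join w (dif f (horiz (snd c p)) w), matrix (dif2 f (horiz (snd c p)) w)))"
    and "\<exists>u\<in>plane2 A L p. u (jet1_chart A c) = (join w (dif f (horiz (snd c p)) w), matrix (dif2 f (horiz (snd c p)) w))"
proof -
  let ?x = "horiz (snd c p)" and ?G = "\<lambda>x. chart_inv c (join x (f x))" and ?C = "jet1_chart A c"
  obtain \<Omega> where \<Omega>: "parametrizes A L \<Omega> ?G" "?x \<in> \<Omega>" "smooth_on \<Omega> f"
    "join ?x (f ?x) = snd c p" "\<And>x. x \<in> \<Omega> \<Longrightarrow> join x (f x) \<in> snd c ` fst c"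
    "\<And>x. x \<in> \<Omega> \<Longrightarrow> graph_at c L (?G x) f"
    by (rule graph_parametrizes[OF A gr]) (rule that; assumption)
  note tc = manifold_chart[OF A]
  have p: "p \<in> fst c" "p \<in> L" using graph_atD[OF gr] by simp_all
  have Gp: "?G ?x = p" using \<Omega>(4) chart_inv_works(1)[OF tc p(1)] by simp
  have o: "open \<Omega>" using parametrizesD(1)[OF \<Omega>(1)] .
  have into: "smooth_into (jet1_atlas A) \<Omega> (\<lambda>x. jet A 1 L (?G x))"
    by (rule smooth_into_jet_lift[OF A(1) L \<Omega>(1)])
  have C: "?C \<in> jet1_atlas A" "jet A 1 L p \<in> fst ?C"
    using A(2) jet1_chart_dom_graph[OF A L p(2)] gr by (auto simp: jet1_atlas_def)
  have val: "snd ?C (jet A 1 L (?G x)) = (join x (f x), matrix (dif f x))" if x: "x \<in> \<Omega>" for x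
    using jet1_chart_val_graph[OF A L \<Omega>(6)[OF x]] chart_inv_works(2)[OF tc \<Omega>(5)[OF x]] by simp
  have push: "push (jet1_atlas A) (\<lambda>x. jet A 1 L (?G x)) ?x w ?C
      = (join w (dif f ?x w), matrix (dif2 f ?x w))" for w
  proof -
    have fd: "f differentiable (at ?x)" by (rule smooth_onD[OF \<Omega>(3,2)])
    have md: "(\<lambda>x. matrix (dif f x)) differentiable (at ?x)"
      by (rule smooth_onD[OF smooth_on_matrix_dif[OF o \<Omega>(3)] \<Omega>(2)])
    have m: "dif (\<lambda>x. matrix (dif f x)) ?x w = matrix (dif2 f ?x w)"
    proof (simp only: vec_eq_iff, intro allI)
      fix i j
      have l: "linear (\<lambda>M :: real^'n^'m. M $ i $ j)" "linear (\<lambda>z :: real^'m. z $ i)"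
        by (auto intro: linearI)
      have "dif (\<lambda>x. matrix (dif f x)) ?x w $ i $ j = dif (\<lambda>x. matrix (dif f x) $ i $ j) ?x w"
        by (rule dif_linear_comp[OF l(1) md, symmetric])
      also have "\<dots> = dif (\<lambda>x. dif f x (axis j 1) $ i) ?x w" by (simp add: matrix_def)
      also have "\<dots> = dif2 f ?x w (axis j 1) $ i"
        by (rule dif_linear_comp[OF l(2) smooth_onD[OF smooth_on_dif[OF \<Omega>(3)] \<Omega>(2)]])
      finally show "dif (\<lambda>x. matrix (dif f x)) ?x w $ i $ j = matrix (dif2 f ?x w) $ i $ j"
        by (simp add: matrix_def)
    qed
    have "dif (\<lambda>x. snd ?C (jet A 1 L (?G x))) ?x = dif (\<lambda>x. (join x (f x), matrix (dif f x))) ?x"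
      by (rule dif_cong_open[OF o \<Omega>(2) val])
    also have "\<dots> = (\<lambda>w. (join w (dif f ?x w), dif (\<lambda>x. matrix (dif f x)) ?x w))"
      by (rule dif_eqI, rule has_derivative_Pair[OF has_derivative_join[OF has_derivative_ident has_dif[OF fd]] has_dif[OF md]])
    finally show ?thesis using C Gp m by (simp add: push_def)
  qed
  have T: "plane2 A L p = range (push (jet1_atlas A) (\<lambda>x. jet A 1 L (?G x)) ?x)"
    unfolding plane2_def using tangent_to_prolongation(1)[OF A(1) L \<Omega>(1,2)] Gp by simp
  show "\<exists>u\<in>plane2 A L p. u ?C = (join w (dif f ?x w), matrix (dif2 f ?x w))" for w
    unfolding T using push by blast
  show "v \<in> plane2 A L p \<longleftrightarrow> v \<in> tangent_space (jet1_atlas A) (jet A 1 L p) \<and>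
    (\<exists>w. v ?C = (join w (dif f ?x w), matrix (dif2 f ?x w)))"
  proof
    assume "v \<in> plane2 A L p"
    then obtain w where w: "v = push (jet1_atlas A) (\<lambda>x. jet A 1 L (?G x)) ?x w" unfolding T by blast
    have "v \<in> tangent_space (jet1_atlas A) (jet A 1 L p)"
      using push_jet_tangent[OF A(1) into \<Omega>(2), of w] unfolding w Gp .
    moreover have "v ?C = (join w (dif f ?x w), matrix (dif2 f ?x w))" unfolding w by (rule push)
    ultimately show "v \<in> tangent_space (jet1_atlas A) (jet A 1 L p) \<and>
        (\<exists>w. v ?C = (join w (dif f ?x w), matrix (dif2 f ?x w)))" by blast
  next
    assume v: "v \<in> tangent_space (jet1_atlas A) (jet A 1 L p) \<and>
        (\<exists>w. v ?C = (join w (dif f ?x w), matrix (dif2 f ?x w)))"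
    then obtain w where "v ?C = push (jet1_atlas A) (\<lambda>x. jet A 1 L (?G x)) ?x w ?C" unfolding push by blast
    moreover have "push (jet1_atlas A) (\<lambda>x. jet A 1 L (?G x)) ?x w \<in> tangent_space (jet1_atlas A) (jet A 1 L p)"
      using push_jet_tangent[OF A(1) into \<Omega>(2), of w] unfolding Gp .
    ultimately have "v = push (jet1_atlas A) (\<lambda>x. jet A 1 L (?G x)) ?x w"
      using v by (intro tangent_space_eqI[OF _ _ C]) auto
    then show "v \<in> plane2 A L p" unfolding T by blast
  qed
qed

text \<open>
  As for first order contact, the plane is independent of charts, and it determines the second derivatives in
  every chart in which the submanifold is a graph.
\<close>

theorem contact_2_iff:
  assumes A: "smooth_manifold A" and L: "submanifold A L" "p \<in> L" and L': "submanifold A L'" "p \<in> L'"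
  shows "contact A 2 p L L' \<longleftrightarrow> jet A 1 L p = jet A 1 L' p \<and> plane2 A L p = plane2 A L' p"
proof
  assume co: "contact A 2 p L L'"
  then obtain c f f' where c: "c \<in> A" "graph_at c L p f" "graph_at c L' p f'"
    "same_derivs 2 f f' (horiz (snd c p))" unfolding contact_def by blast
  have j: "jet A 1 L p = jet A 1 L' p"
    using contact_2_imp_1[OF co] contact_1_iff[OF A L L'] jet_1_eq_iff[OF A L L'] by simp
  have "dif2 f (horiz (snd c p)) w = dif2 f' (horiz (snd c p)) w" for w
    using c(4) by (auto simp: same_derivs_2)
  moreover have "dif f (horiz (snd c p)) = dif f' (horiz (snd c p))"
    using c(4) by (auto simp: same_derivs_2)
  ultimately have "plane2 A L p = plane2 A L' p"
    using plane2_graph_iff(1)[OF A c(1) L(1) c(2)] plane2_graph_iff(1)[OF A c(1) L'(1) c(3)] j by (intro set_eqI) simp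
  with j show "jet A 1 L p = jet A 1 L' p \<and> plane2 A L p = plane2 A L' p" by simp
next
  assume eq: "jet A 1 L p = jet A 1 L' p \<and> plane2 A L p = plane2 A L' p"
  obtain c f where c: "c \<in> A" "graph_at c L p f"
    using L submanifold_iff_graph[OF A] by blast
  have "jet A 1 L' p \<in> fst (jet1_chart A c)"
    using jet1_chart_dom_graph[OF A c(1) L] c(2) eq by auto
  then obtain f' where f': "graph_at c L' p f'"
    using jet1_chart_dom_graph[OF A c(1) L'] by blast
  let ?x = "horiz (snd c p)" and ?C = "jet1_chart A c"
  have d: "dif f ?x = dif f' ?x"
    using tangent_to_graph_dif_eq[OF A c f'] jet_1_eq_iff[OF A L L'] eq by blast
  obtain S where S: "open S" "?x \<in> S" "smooth_on S f" by (rule graph_at_smooth[OF c(2)])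
  obtain S' where S': "open S'" "?x \<in> S'" "smooth_on S' f'" by (rule graph_at_smooth[OF f'])
  have d2: "dif2 f ?x w a = dif2 f' ?x w a" for w a
  proof -
    obtain v where v: "v \<in> plane2 A L p" "v ?C = (join w (dif f ?x w), matrix (dif2 f ?x w))"
      using plane2_graph_iff(2)[OF A c(1) L(1) c(2)] by blast
    then obtain w' where w': "v ?C = (join w' (dif f' ?x w'), matrix (dif2 f' ?x w'))"
      using eq plane2_graph_iff(1)[OF A c(1) L'(1) f'] by blast
    have "join w (dif f ?x w) = join w' (dif f' ?x w')" using v(2) w' by simp
    then have "w' = w" by (metis join_simps(1))
    then have "matrix (dif2 f ?x w) = matrix (dif2 f' ?x w)" using v(2) w' by simp
    moreover have "matrix (dif2 f ?x w) *v a = dif2 f ?x w a"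
      by (rule matrix_works) (simp add: linear_dif2_right[OF S(1,3,2)] linear_def[symmetric] linear_matrix_vector_mul_eq)
    moreover have "matrix (dif2 f' ?x w) *v a = dif2 f' ?x w a"
      by (rule matrix_works) (simp add: linear_dif2_right[OF S'(1,3,2)] linear_def[symmetric] linear_matrix_vector_mul_eq)
    ultimately show ?thesis by metis
  qed
  have "same_derivs 2 f f' ?x"
    unfolding same_derivs_2 using d d2 graph_at_value[OF manifold_chart[OF A c(1)] c(2)]
      graph_at_value[OF manifold_chart[OF A c(1)] f'] by simp
  then show "contact A 2 p L L'" unfolding contact_def using c f' by blast
qed

lemma jet_2_eq_iff:
  assumes A: "smooth_manifold A" and L: "submanifold A L" "p \<in> L" and L': "submanifold A L'" "p' \<in> L'"
  shows "jet A 2 L p = jet A 2 L' p' \<longleftrightarrow> jet A 1 L p = jet A 1 L' p' \<and> plane2 A L p = plane2 A L' p'"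
proof
  assume eq: "jet A 2 L p = jet A 2 L' p'"
  then have p: "p = p'" by (simp add: jet_def)
  have "L \<in> snd (jet A 2 L p)" using L contact_refl[OF A L] by (simp add: jet_def)
  then have "contact A 2 p L' L" unfolding eq using p by (simp add: jet_def)
  then show "jet A 1 L p = jet A 1 L' p' \<and> plane2 A L p = plane2 A L' p'"
    using contact_2_iff[OF A L'(1) _ L] L'(2) p by simp
next
  assume eq: "jet A 1 L p = jet A 1 L' p' \<and> plane2 A L p = plane2 A L' p'"
  then have p: "p = p'" by (simp add: jet_def)
  then have "contact A 2 p L N \<longleftrightarrow> contact A 2 p L' N" if "submanifold A N" "p \<in> N" for N
    using contact_2_iff[OF A L that] contact_2_iff[OF A L'(1) _ that] L'(2) eq by simp
  then show "jet A 2 L p = jet A 2 L' p'" using p unfolding jet_def by blast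
qed

lemma R_plane2_jet:
  assumes A: "smooth_manifold A" and L: "submanifold A L" "p \<in> L"
  shows "R_plane2 A (jet A 2 L p) = plane2 A L p"
proof -
  let ?L = "jet_rep (jet A 2 L p)"
  note r = jet_rep[OF A L, of 2]
  have "jet_proj A 1 (jet A 2 L p) = jet A 1 ?L p" by (simp add: jet_proj_def)
  then show ?thesis
    using contact_2_iff[OF A L r(1,2)] r(3) unfolding R_plane2_def plane2_def by metis
qed

section \<open>Connections in a chart\<close>

text \<open>
  The Christoffel symbols as a bilinear map.
\<close>

definition gam :: "('a, real^'k) chart set \<Rightarrow> ('a, real^'k) connection \<Rightarrow> ('a, real^'k) chart \<Rightarrow> 'a \<Rightarrow>
    real^'k \<Rightarrow> real^'k \<Rightarrow> real^'k::finite" where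
  "gam A \<Gamma> c p z w = (\<chi> K. \<Sum>I\<in>UNIV. \<Sum>J\<in>UNIV. christoffel A \<Gamma> c p I K J * z $ I * w $ J)"

lemma linear_gam_left: "linear (\<lambda>z. gam A \<Gamma> c p z w)"
  by (rule linearI) (simp_all add: gam_def vec_eq_iff algebra_simps sum.distrib sum_distrib_left)

lemma linear_gam_right: "linear (\<lambda>w. gam A \<Gamma> c p z w)"
  by (rule linearI) (simp_all add: gam_def vec_eq_iff algebra_simps sum.distrib sum_distrib_left)

lemma smooth_vector_field_cong:
  assumes "smooth_vector_field_on A U Y" "\<And>q. q \<in> U \<Longrightarrow> Y q = Z q" and A: "smooth_manifold A"
  shows "smooth_vector_field_on A U Z"
  unfolding smooth_vector_field_on_def
proof (intro conjI ballI)
  show U: "open U" using assms(1) by (simp add: smooth_vector_field_on_def)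
  show "Z q \<in> tangent_space A q" if "q \<in> U" for q
    using assms(1) assms(2)[OF that] that unfolding smooth_vector_field_on_def by metis
  fix c assume c: "c \<in> A"
  have "open (snd c ` (U \<inter> fst c))" using open_chart_image[OF manifold_chart[OF A c] U] by (simp add: Int_commute)
  moreover have "smooth_on (snd c ` (U \<inter> fst c)) (\<lambda>y. Y (chart_inv c y) c)"
    using assms(1) c unfolding smooth_vector_field_on_def by blast
  ultimately show "smooth_on (snd c ` (U \<inter> fst c)) (\<lambda>y. Z (chart_inv c y) c)"
    by (elim smooth_on_cong[rotated 2]) (use assms(2) chart_inv_works(1)[OF manifold_chart[OF A c]] in auto)
qed

lemma smooth_vector_field_subset:
  "smooth_vector_field_on A U Y \<Longrightarrow> open V \<Longrightarrow> V \<subseteq> U \<Longrightarrow> smooth_vector_field_on A V Y"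
  unfolding smooth_vector_field_on_def
  by (intro conjI ballI) (blast | (drule conjunct2, drule conjunct2, drule bspec, assumption, erule smooth_on_subset, blast))+

lemma smooth_vector_field_chartI:
  assumes A: "smooth_manifold A" "c \<in> A" and U: "open U" "U \<subseteq> fst c" and Z: "smooth_on (snd c ` U) Z"
  shows "smooth_vector_field_on A U (\<lambda>q. tvec_of A c q (Z (snd c q)))"
  unfolding smooth_vector_field_on_def
proof (intro conjI ballI)
  show "open U" by fact
  show "tvec_of A c q (Z (snd c q)) \<in> tangent_space A q" if "q \<in> U" for q
    using tvec_of_tangent[OF A] that U by blast
  fix d assume d: "d \<in> A"
  note tc = manifold_chart[OF A] and td = manifold_chart[OF A(1) d]
  have o: "open (snd d ` (U \<inter> fst d))" using open_chart_image[OF td U(1)] by (simp add: Int_commute)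
  have ocU: "open (snd c ` U)" using open_chart_image[OF tc U(1)] U(2) by (simp add: Int_absorb1)
  have ts: "smooth_on (snd d ` (U \<inter> fst d)) (transition d c)"
    by (rule smooth_on_subset[OF smooth_transition[OF A(1) d A(2)]]) (use U in auto)
  have tr: "transition d c (snd d q) = snd c q" if "q \<in> fst d" for q by (rule transition_snd[OF td that])
  have "smooth_on (snd d ` (U \<inter> fst d)) (\<lambda>y. Z (transition d c y))"
    by (rule smooth_on_compose[OF Z ts o ocU]) (use tr in auto)
  then have "smooth_on (snd d ` (U \<inter> fst d)) (\<lambda>y. dif (transition c d) (transition d c y) (Z (transition d c y)))"
    by (rule smooth_on_dif_apply[OF smooth_transition[OF A d] ts _ o open_overlap[OF A d]]) (use tr U in auto)
  then show "smooth_on (snd d ` (U \<inter> fst d)) (\<lambda>y. tvec_of A c (chart_inv d y) (Z (snd c (chart_inv d y))) d)"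
    by (rule smooth_on_cong[OF o, rotated])
       (use d tr chart_inv_works(1)[OF td] in \<open>auto simp: tvec_of_def transition_apply\<close>)
qed

lemma coord_field_eq: "q \<in> fst c \<Longrightarrow> coord_field A c K q = tvec_of A c q (axis K 1)"
  by (auto simp: coord_field_def tvec_of_def fun_eq_iff)

context
  fixes A :: "('a::{t2_space,second_countable_topology}, real^'k::finite) chart set" and \<Gamma> :: "('a, real^'k) connection"
  assumes A: "smooth_manifold A" and \<Gamma>: "linear_connection A \<Gamma>"
begin

lemmas connection_parts =
  \<Gamma>[unfolded linear_connection_def, THEN conjunct2, THEN conjunct1, rule_format, OF conjI]
  \<Gamma>[unfolded linear_connection_def, THEN conjunct2, THEN conjunct2, THEN conjunct1, rule_format, OF conjI[OF _ conjI]]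
  \<Gamma>[unfolded linear_connection_def, THEN conjunct2, THEN conjunct2, THEN conjunct2, rule_format, OF conjI[OF _ conjI]]

lemma connection_tangent:
  assumes "smooth_vector_field_on A U Y" "p \<in> U" "v \<in> tangent_space A p"
  shows "\<Gamma> p v Y \<in> tangent_space A p"
  using connection_parts(1)[OF assms(1,2)] assms(3) by simp

lemma connection_sum_left:
  assumes Y: "smooth_vector_field_on A U Y" "p \<in> U" and I: "finite I" "\<And>i. i \<in> I \<Longrightarrow> V i \<in> tangent_space A p"
  shows "\<Gamma> p (\<Sum>i\<in>I. a i *\<^sub>R V i) Y = (\<Sum>i\<in>I. a i *\<^sub>R \<Gamma> p (V i) Y)"
proof -
  note s = subspace_tangent_space[OF A, of p]
  have add: "\<Gamma> p (v + w) Y = \<Gamma> p v Y + \<Gamma> p w Y" if "v \<in> tangent_space A p" "w \<in> tangent_space A p" for v w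
    using connection_parts(1)[OF Y] that by simp
  have sc: "\<Gamma> p (r *\<^sub>R v) Y = r *\<^sub>R \<Gamma> p v Y" if "v \<in> tangent_space A p" for v r
    using connection_parts(1)[OF Y] that by simp
  show ?thesis using I
  proof (induction I rule: finite_induct)
    case empty
    have "\<Gamma> p 0 Y = 0" using sc[OF subspace_0[OF s], of 0] by (simp only: scale_zero_left)
    then show ?case by (simp only: sum.empty)
  next
    case (insert i I)
    have "(\<Sum>i\<in>I. a i *\<^sub>R V i) \<in> tangent_space A p"
      using insert by (intro subspace_sum[OF s] subspace_scale[OF s]) auto
    moreover have "a i *\<^sub>R V i \<in> tangent_space A p" using insert by (intro subspace_scale[OF s]) simp
    ultimately have "\<Gamma> p (a i *\<^sub>R V i + (\<Sum>i\<in>I. a i *\<^sub>R V i)) Y = \<Gamma> p (a i *\<^sub>R V i) Y + \<Gamma> p (\<Sum>i\<in>I. a i *\<^sub>R V i) Y"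
      by (rule add[rotated])
    also have "\<Gamma> p (a i *\<^sub>R V i) Y = a i *\<^sub>R \<Gamma> p (V i) Y" by (rule sc) (use insert in blast)
    also have "\<Gamma> p (\<Sum>i\<in>I. a i *\<^sub>R V i) Y = (\<Sum>i\<in>I. a i *\<^sub>R \<Gamma> p (V i) Y)"
      using insert by blast
    finally show ?case by (simp only: sum.insert[OF insert(1,2)])
  qed
qed

lemma connection_cong:
  assumes "smooth_vector_field_on A U Y" "p \<in> U" "v \<in> tangent_space A p" "\<And>q. q \<in> U \<Longrightarrow> Y q = Z q"
  shows "\<Gamma> p v Y = \<Gamma> p v Z"
proof -
  have "smooth_vector_field_on A U Z" using smooth_vector_field_cong[OF assms(1) _ A] assms(4) by blast
  from connection_parts(2)[OF assms(1) this assms(2,3)] show ?thesis using assms(4) by simp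
qed

lemma connection_add:
  assumes "smooth_vector_field_on A U Y" "smooth_vector_field_on A U Z" "p \<in> U" "v \<in> tangent_space A p"
  shows "\<Gamma> p v (\<lambda>q. Y q + Z q) = \<Gamma> p v Y + \<Gamma> p v Z"
  using connection_parts(2)[OF assms] by simp

lemma connection_leibniz:
  assumes "smooth_vector_field_on A U Y" "smooth_map_on A std_atlas U f" "p \<in> U" "v \<in> tangent_space A p"
  shows "\<Gamma> p v (\<lambda>q. f q *\<^sub>R Y q) = derivative_along A p v f *\<^sub>R Y p + f p *\<^sub>R \<Gamma> p v Y"
  using connection_parts(3)[OF assms] .

lemma smooth_function_chartI:
  assumes c: "c \<in> A" and U: "open U" "U \<subseteq> fst c" and F: "smooth_on (snd c ` U) F"
  shows "smooth_map_on A std_atlas U (\<lambda>q. F (snd c q))"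
  unfolding smooth_map_on_def std_atlas_def
proof (intro ballI, simp only: singleton_iff fst_conv snd_conv, intro conjI)
  fix d assume d: "d \<in> A"
  note td = manifold_chart[OF A d]
  have eq: "{p \<in> U \<inter> fst d. F (snd c p) \<in> UNIV} = U \<inter> fst d" by auto
  have o: "open (snd d ` (U \<inter> fst d))" using open_chart_image[OF td U(1)] by (simp add: Int_commute)
  have ocU: "open (snd c ` U)" using open_chart_image[OF manifold_chart[OF A c] U(1)] U(2) by (simp add: Int_absorb1)
  have tr: "transition d c (snd d q) = snd c q" if "q \<in> fst d" for q by (rule transition_snd[OF td that])
  have "smooth_on (snd d ` (U \<inter> fst d)) (\<lambda>y. F (transition d c y))"
    by (rule smooth_on_compose[OF F smooth_on_subset[OF smooth_transition[OF A d c]] o ocU]) (use tr U in auto)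
  then show "smooth_on (snd d ` {p \<in> U \<inter> fst d. F (snd c p) \<in> UNIV}) ((\<lambda>x. x) \<circ> (\<lambda>q. F (snd c q)) \<circ> chart_inv d)"
    unfolding eq by (simp add: o_def transition_apply)
  show "open (snd d ` {p \<in> U \<inter> fst d. F (snd c p) \<in> UNIV})" unfolding eq by (rule o)
qed

lemma derivative_along_chart:
  assumes c: "c \<in> A" and U: "open U" "U \<subseteq> fst c" and F: "smooth_on (snd c ` U) F"
    and p: "p \<in> U" and v: "v \<in> tangent_space A p"
  shows "derivative_along A p v (\<lambda>q. F (snd c q)) = dif F (snd c p) (v c)"
proof -
  define e where "e = (SOME c. c \<in> A \<and> p \<in> fst c)"
  have e: "e \<in> A \<and> p \<in> fst e" unfolding e_def by (rule someI_ex) (use manifold_cover[OF A, of p] in blast)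
  have pc: "p \<in> fst c" using p U by blast
  have "derivative_along A p v (\<lambda>q. F (snd c q)) = dif (\<lambda>y. F (transition e c y)) (snd e p) (v e)"
    unfolding derivative_along_def tangent_map_def Let_def e_def[symmetric]
    by (simp add: std_atlas_def o_def transition_apply)
  also have "\<dots> = dif F (transition e c (snd e p)) (dif (transition e c) (snd e p) (v e))"
    by (rule dif_compose[OF transition_differentiable[OF A _ c _ pc]])
       (use e p transition_snd[OF manifold_chart[OF A], of e p c] smooth_onD[OF F] in auto)
  also have "\<dots> = dif F (snd c p) (v c)"
    using tangent_vec_change[OF v, of e c] e c pc transition_snd[OF manifold_chart[OF A], of e p c] by simp
  finally show ?thesis .
qed

text \<open>
  Near \<open>p\<close> the field is a combination of coordinate fields; the connection is additive, obeys the Leibniz rule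
  and is linear in the direction, which reduces it to the Christoffel symbols.
\<close>

theorem connection_in_chart:
  assumes Y: "smooth_vector_field_on A U Y" "p \<in> U" and c: "c \<in> A" "p \<in> fst c" and v: "v \<in> tangent_space A p"
  shows "\<Gamma> p v Y c = dif (\<lambda>y. Y (chart_inv c y) c) (snd c p) (v c) + gam A \<Gamma> c p (v c) (Y p c)"
proof -
  note tc = manifold_chart[OF A c(1)]
  let ?U = "U \<inter> fst c"
  define Z where "Z y = Y (chart_inv c y) c" for y
  define E where "E J q = tvec_of A c q (axis J 1 :: real^'k)" for J q
  \<comment> \<open>partial sums of the expansion in coordinate fields\<close>
  define ZI where "ZI I y = (\<Sum>J\<in>I. (Z y $ J) *\<^sub>R (axis J 1 :: real^'k))" for I y
  have U: "open ?U" "?U \<subseteq> fst c" "p \<in> ?U"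
    using Y c chart_open(1)[OF tc] by (auto simp: smooth_vector_field_on_def)
  have oU: "open (snd c ` ?U)" using open_chart_image[OF tc, of U] U Y(1)
    by (simp add: smooth_vector_field_on_def Int_commute)
  have Zs: "smooth_on (snd c ` ?U) Z" using Y(1) c unfolding smooth_vector_field_on_def Z_def by blast
  have Zn: "smooth_on (snd c ` ?U) (\<lambda>y. Z y $ J)" for J by (rule smooth_on_nth[OF oU Zs])
  have ZIs: "smooth_on (snd c ` ?U) (ZI I)" if "finite I" for I
    unfolding ZI_def using that
    by (intro smooth_on_sum oU smooth_on_bilinear[OF bounded_bilinear_scaleR] Zn smooth_on_const) auto
  have Es: "smooth_vector_field_on A ?U (E J)" for J
    unfolding E_def by (rule smooth_vector_field_chartI[OF A c(1) U(1,2) smooth_on_const])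
  have YIs: "smooth_vector_field_on A ?U (\<lambda>q. tvec_of A c q (ZI I (snd c q)))" if "finite I" for I
    by (rule smooth_vector_field_chartI[OF A c(1) U(1,2) ZIs[OF that]])
  have sum: "\<Gamma> p v (\<lambda>q. tvec_of A c q (ZI I (snd c q)))
      = (\<Sum>J\<in>I. dif (\<lambda>y. Z y $ J) (snd c p) (v c) *\<^sub>R E J p + (Z (snd c p) $ J) *\<^sub>R \<Gamma> p v (E J))"
    if "finite I" for I :: "'k set"
    using that
  proof (induction I rule: finite_induct)
    case empty
    have z: "tvec_of A c q (ZI {} (snd c q)) = 0 *\<^sub>R E undefined q" if "q \<in> ?U" for q
      using tvec_of_add(2)[OF A c(1), of q 0 0] that by (simp add: ZI_def)
    have f: "smooth_map_on A std_atlas ?U (\<lambda>q. (\<lambda>_. 0) (snd c q) :: real)"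
      by (rule smooth_function_chartI[OF c(1) U(1,2) smooth_on_const])
    have "\<Gamma> p v (\<lambda>q. tvec_of A c q (ZI {} (snd c q))) = \<Gamma> p v (\<lambda>q. 0 *\<^sub>R E undefined q)"
      by (rule connection_cong[OF YIs[of "{}"] U(3) v z]) auto
    also have "\<dots> = 0"
      using connection_leibniz[OF Es f U(3) v, of undefined]
        derivative_along_chart[OF c(1) U(1,2) smooth_on_const U(3) v, of 0] by simp
    finally show ?case by simp
  next
    case (insert J I)
    let ?f = "\<lambda>q. Z (snd c q) $ J"
    have eq: "tvec_of A c q (ZI (insert J I) (snd c q)) = ?f q *\<^sub>R E J q + tvec_of A c q (ZI I (snd c q))"
      if "q \<in> ?U" for q
      using insert that by (simp add: ZI_def E_def tvec_of_add[OF A c(1)])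
    have f: "smooth_map_on A std_atlas ?U ?f" by (rule smooth_function_chartI[OF c(1) U(1,2) Zn])
    have fE: "smooth_vector_field_on A ?U (\<lambda>q. ?f q *\<^sub>R E J q)"
    proof (rule smooth_vector_field_cong[OF smooth_vector_field_chartI[OF A c(1) U(1,2)] _ A])
      show "smooth_on (snd c ` ?U) (\<lambda>y. (Z y $ J) *\<^sub>R axis J 1)"
        by (intro oU smooth_on_bilinear[OF bounded_bilinear_scaleR] Zn smooth_on_const)
      show "tvec_of A c q ((Z (snd c q) $ J) *\<^sub>R axis J 1) = ?f q *\<^sub>R E J q" if "q \<in> ?U" for q
        using that by (simp add: E_def tvec_of_add[OF A c(1)])
    qed
    have "\<Gamma> p v (\<lambda>q. tvec_of A c q (ZI (insert J I) (snd c q)))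
        = \<Gamma> p v (\<lambda>q. ?f q *\<^sub>R E J q + tvec_of A c q (ZI I (snd c q)))"
      by (rule connection_cong[OF YIs U(3) v eq]) (use insert in auto)
    also have "\<dots> = \<Gamma> p v (\<lambda>q. ?f q *\<^sub>R E J q) + \<Gamma> p v (\<lambda>q. tvec_of A c q (ZI I (snd c q)))"
      by (rule connection_add[OF fE YIs[OF insert(1)] U(3) v])
    also have "\<Gamma> p v (\<lambda>q. ?f q *\<^sub>R E J q)
       = dif (\<lambda>y. Z y $ J) (snd c p) (v c) *\<^sub>R E J p + (Z (snd c p) $ J) *\<^sub>R \<Gamma> p v (E J)"
      using connection_leibniz[OF Es f U(3) v] derivative_along_chart[OF c(1) U(1,2) Zn U(3) v] by simp
    finally show ?case using insert by simp
  qed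
  have "ZI UNIV y = Z y" for y by (simp add: ZI_def vec_eq_iff axis_def if_distrib cong: if_cong)
  then have YZ: "Y q = tvec_of A c q (ZI UNIV (snd c q))" if "q \<in> ?U" for q
    using that Y(1) tangent_vec_eq[OF A c(1)] chart_inv_works(1)[OF tc]
    by (simp add: smooth_vector_field_on_def Z_def)
  have "\<Gamma> p v Y = \<Gamma> p v (\<lambda>q. tvec_of A c q (ZI UNIV (snd c q)))"
    by (rule connection_cong[OF smooth_vector_field_subset[OF Y(1) U(1)] U(3) v YZ]) auto
  then have G1: "\<Gamma> p v Y
      = (\<Sum>J\<in>UNIV. dif (\<lambda>y. Z y $ J) (snd c p) (v c) *\<^sub>R E J p + (Z (snd c p) $ J) *\<^sub>R \<Gamma> p v (E J))"
    using sum[of UNIV] by simp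
  have vc: "v c = (\<Sum>I\<in>UNIV. (v c $ I) *\<^sub>R axis I 1)"
    by (simp add: vec_eq_iff axis_def if_distrib cong: if_cong)
  have tsum: "tvec_of A c p (\<Sum>I\<in>S. a I *\<^sub>R axis I 1) = (\<Sum>I\<in>S. a I *\<^sub>R E I p)" if "finite S" for S a
    using that
  proof (induction S rule: finite_induct)
    case empty
    have "tvec_of A c p 0 = 0" using tvec_of_add(2)[OF A c, of 0 0] by (simp only: scale_zero_left)
    then show ?case by (simp only: sum.empty)
  next
    case (insert I S)
    then show ?case by (simp only: sum.insert[OF insert(1,2)] tvec_of_add[OF A c] E_def)
  qed
  have "v = tvec_of A c p (\<Sum>I\<in>UNIV. (v c $ I) *\<^sub>R axis I 1)"
    using tangent_vec_eq[OF A c v] unfolding vc[symmetric] .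
  also have "\<dots> = (\<Sum>I\<in>UNIV. (v c $ I) *\<^sub>R E I p)" by (rule tsum) simp
  finally have vE: "v = (\<Sum>I\<in>UNIV. (v c $ I) *\<^sub>R E I p)" .
  have Et: "E I p \<in> tangent_space A p" for I unfolding E_def by (rule tvec_of_tangent[OF A c])
  have G2: "\<Gamma> p v (E J) = (\<Sum>I\<in>UNIV. (v c $ I) *\<^sub>R \<Gamma> p (E I p) (E J))" for J
    by (subst vE, rule connection_sum_left[OF Es U(3)]) (use Et in auto)
  have chr: "\<Gamma> p (E I p) (E J) c $ K = christoffel A \<Gamma> c p I K J" for I J K
  proof -
    have "\<Gamma> p (E I p) (E J) = \<Gamma> p (E I p) (coord_field A c J)"
      by (rule connection_cong[OF Es U(3) Et]) (simp add: E_def coord_field_eq)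
    then show ?thesis using c(2) by (simp add: christoffel_def coord_field_eq E_def)
  qed
  have Zd: "Z differentiable (at (snd c p))" using smooth_onD[OF Zs] U(3) by blast
  have comp: "dif (\<lambda>y. Z y $ J) (snd c p) w = dif Z (snd c p) w $ J" for J w
    by (rule dif_linear_comp[OF _ Zd]) (auto intro: linearI)
  have Zp: "Z (snd c p) = Y p c" using chart_inv_works(1)[OF tc c(2)] by (simp add: Z_def)
  have ap: "(\<Sum>i\<in>S. f i) d = (\<Sum>i\<in>S. f i d)" for S :: "'k set" and f :: "'k \<Rightarrow> ('a, real^'k) tvec" and d
    by (induction S rule: infinite_finite_induct) auto
  have Ec: "E J p c $ K = (if K = J then 1 else 0)" for J K
    by (simp add: E_def tvec_of_same[OF A c] axis_def)
  have "\<Gamma> p v Y c $ K = dif Z (snd c p) (v c) $ K + gam A \<Gamma> c p (v c) (Y p c) $ K" for K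
  proof -
    have "\<Gamma> p v Y c $ K = (\<Sum>J\<in>UNIV. dif Z (snd c p) (v c) $ J * E J p c $ K
        + Y p c $ J * (\<Sum>I\<in>UNIV. v c $ I * christoffel A \<Gamma> c p I K J))"
      unfolding G1 G2 ap by (simp add: scaleR_fun_def ap comp Zp chr)
    also have "\<dots> = dif Z (snd c p) (v c) $ K + (\<Sum>J\<in>UNIV. \<Sum>I\<in>UNIV. christoffel A \<Gamma> c p I K J * v c $ I * Y p c $ J)"
    proof -
      have "(\<Sum>J\<in>UNIV. dif Z (snd c p) (v c) $ J * E J p c $ K) = dif Z (snd c p) (v c) $ K"
        by (simp add: Ec if_distrib cong: if_cong)
      then show ?thesis by (simp only: sum.distrib) (simp add: sum_distrib_left mult_ac)
    qed
    finally show ?thesis by (subst (asm) sum.swap) (simp add: gam_def)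
  qed
  then show ?thesis by (simp add: vec_eq_iff Z_def[abs_def])
qed

text \<open>
  The transformation law of the Christoffel symbols: the covariant derivative of a field with constant components in
  the chart \<open>c\<close> is computed in both charts.
\<close>

lemma gam_transition:
  assumes c: "c \<in> A" "p \<in> fst c" and d: "d \<in> A" "p \<in> fst d"
  shows "dif (transition c d) (snd c p) (gam A \<Gamma> c p z w)
     = dif2 (transition c d) (snd c p) z w
       + gam A \<Gamma> d p (dif (transition c d) (snd c p) z) (dif (transition c d) (snd c p) w)"
proof -
  note tc = manifold_chart[OF A c(1)] and td = manifold_chart[OF A d(1)]
  let ?Y = "\<lambda>q. tvec_of A c q w" and ?v = "tvec_of A c p z"
  have Y: "smooth_vector_field_on A (fst c) ?Y"
    by (rule smooth_vector_field_chartI[OF A c(1) chart_open(1)[OF tc] _ smooth_on_const]) simp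
  have v: "?v \<in> tangent_space A p" by (rule tvec_of_tangent[OF A c])
  have T: "\<Gamma> p ?v ?Y \<in> tangent_space A p" by (rule connection_tangent[OF Y c(2) v])
  have "dif (\<lambda>y. ?Y (chart_inv c y) c) (snd c p) = dif (\<lambda>y. w) (snd c p)"
    by (rule dif_cong_open[OF chart_open(2)[OF tc]]) (use c chart_inv_works[OF tc] tvec_of_same[OF A c(1)] in auto)
  then have 1: "\<Gamma> p ?v ?Y c = gam A \<Gamma> c p z w"
    using connection_in_chart[OF Y c(2) c v] tvec_of_same[OF A c]
    by (simp add: dif_eqI[OF has_derivative_const])
  have dd: "(\<lambda>y. dif (transition c d) y w) differentiable (at (snd c p))"
    by (rule smooth_onD[OF smooth_on_dif[OF smooth_transition[OF A c(1) d(1)]]]) (use c d in auto)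
  have "dif (\<lambda>y. ?Y (chart_inv d y) d) (snd d p) = dif (\<lambda>y. dif (transition c d) (transition d c y) w) (snd d p)"
    by (rule dif_cong_open[OF open_overlap[OF A d(1) c(1)]])
       (use c d chart_inv_works[OF td] in \<open>auto simp: tvec_of_def transition_apply\<close>)
  then have "dif (\<lambda>y. ?Y (chart_inv d y) d) (snd d p) (?v d)
      = dif (\<lambda>y. dif (transition c d) y w) (transition d c (snd d p)) (dif (transition d c) (snd d p) (?v d))"
    using dif_compose[OF transition_differentiable[OF A d(1) c(1) d(2) c(2)], of "\<lambda>y. dif (transition c d) y w" "?v d"]
      dd transition_snd[OF td d(2), of c] by simp
  also have "\<dots> = dif2 (transition c d) (snd c p) z w"
    using tangent_vec_change[OF v d(1) c(1) d(2) c(2)] tvec_of_same[OF A c] transition_snd[OF td d(2), of c]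
    by simp
  finally have "\<Gamma> p ?v ?Y d = dif2 (transition c d) (snd c p) z w + gam A \<Gamma> d p (?v d) (?Y p d)"
    using connection_in_chart[OF Y c(2) d v] by simp
  then show ?thesis
    using tangent_vec_change[OF T c(1) d(1) c(2) d(2)] 1 d by (simp add: tvec_of_def)
qed

text \<open>
  The bracket of fields with constant coordinates vanishes.
\<close>

lemma gam_sym:
  assumes tf: "torsion_free A \<Gamma>" and c: "c \<in> A" "p \<in> fst c"
  shows "gam A \<Gamma> c p z w = gam A \<Gamma> c p w z"
proof -
  note tc = manifold_chart[OF A c(1)]
  let ?Y = "\<lambda>w q. tvec_of A c q w"
  have Y: "smooth_vector_field_on A (fst c) (?Y w)" for w
    by (rule smooth_vector_field_chartI[OF A c(1) chart_open(1)[OF tc] _ smooth_on_const]) simp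
  have v: "?Y z p \<in> tangent_space A p" for z by (rule tvec_of_tangent[OF A c])
  have "dif (\<lambda>y. ?Y w (chart_inv c y) c) (snd c p) = dif (\<lambda>y. w) (snd c p)" for w
    by (rule dif_cong_open[OF chart_open(2)[OF tc]]) (use c chart_inv_works[OF tc] tvec_of_same[OF A c(1)] in auto)
  then have D: "dif (\<lambda>y. ?Y w (chart_inv c y) c) (snd c p) z = 0" for w z
    by (simp add: dif_eqI[OF has_derivative_const])
  have 1: "\<Gamma> p (?Y z p) (?Y w) c = gam A \<Gamma> c p z w" for z w
    using connection_in_chart[OF Y c(2) c v] D tvec_of_same[OF A c] by simp
  have "\<Gamma> p (?Y z p) (?Y w) - \<Gamma> p (?Y w p) (?Y z) = lie_bracket A (?Y z) (?Y w) p"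
    using tf Y c(2) unfolding torsion_free_def by blast
  then have "(\<Gamma> p (?Y z p) (?Y w) - \<Gamma> p (?Y w p) (?Y z)) c = lie_bracket A (?Y z) (?Y w) p c" by simp
  then show ?thesis using c by (simp add: 1 lie_bracket_def D)
qed

end

section \<open>The second fundamental form and the unparametrized equation\<close>

text \<open>
  The vector \<open>vert z - D (horiz z)\<close> represents \<open>z\<close> modulo the tangent plane, which is the graph of \<open>D\<close>.
\<close>

definition sff_chart :: "('e::topological_space, real^('n::finite + 'm::finite)) chart set \<Rightarrow> ('e, real^('n + 'm)) connection \<Rightarrow>
    ('e, real^('n + 'm)) chart \<Rightarrow> 'e \<Rightarrow> (real^'n \<Rightarrow> real^'m) \<Rightarrow> real^'n \<Rightarrow> real^'n \<Rightarrow> real^'m" where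
  "sff_chart A \<Gamma> c p f a b =
     (let D = dif f (horiz (snd c p)); g = gam A \<Gamma> c p (join a (D a)) (join b (D b))
      in dif2 f (horiz (snd c p)) a b + (vert g - D (horiz g)))"

lemma smooth_vector_field_in_chart:
  "smooth_vector_field_on A U Y \<Longrightarrow> c \<in> A \<Longrightarrow> smooth_on (snd c ` (U \<inter> fst c)) (\<lambda>y. Y (chart_inv c y) c)"
  unfolding smooth_vector_field_on_def by blast

text \<open>
  For the fields with components \<open>(b, Df b)\<close>, which are tangent to the graph, the covariant derivative is
  \<open>(0, D\<^sup>2f(a, b))\<close> plus the term with the Christoffel symbols. For an arbitrary field that is tangent along the
  graph, the tangency condition is differentiated along the graph: modulo the tangent plane the derivative of its components
  is \<open>D\<^sup>2f(a, b)\<close>, where \<open>b\<close> is its horizontal part at \<open>p\<close>.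
\<close>

theorem second_fundamental_form_chart:
  fixes A :: "('e::{t2_space,second_countable_topology}, real^('n::finite + 'm::finite)) chart set"
  assumes A: "smooth_manifold A" "c \<in> A" and \<Gamma>: "linear_connection A \<Gamma>"
    and gr: "graph_at c L p f"
  shows "second_fundamental_form_vanishes A \<Gamma> L p \<longleftrightarrow> (\<forall>a b. sff_chart A \<Gamma> c p f a b = 0)"
proof -
  let ?x = "horiz (snd c p)"
  define G where "G a = join a (dif f ?x a)" for a
  obtain \<Omega> where \<Omega>: "parametrizes A L \<Omega> (\<lambda>x. chart_inv c (join x (f x)))" "?x \<in> \<Omega>"
    "smooth_on \<Omega> f" "join ?x (f ?x) = snd c p"
    "\<And>x. x \<in> \<Omega> \<Longrightarrow> join x (f x) \<in> snd c ` fst c"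
    "\<And>x. x \<in> \<Omega> \<Longrightarrow> graph_at c L (chart_inv c (join x (f x))) f"
    "\<exists>W. open W \<and> p \<in> W \<and> W \<subseteq> fst c \<and> (\<forall>q\<in>L \<inter> W. horiz (snd c q) \<in> \<Omega> \<and> graph_at c L q f \<and>
         q = chart_inv c (join (horiz (snd c q)) (f (horiz (snd c q)))))"
    by (rule graph_parametrizes[OF A gr]) (rule that; assumption)
  have o: "open \<Omega>" using parametrizesD(1)[OF \<Omega>(1)] .
  note tc = manifold_chart[OF A]
  note ci = chart_inv_works[OF tc]
  have p: "p \<in> L" "p \<in> fst c" using graph_atD[OF gr] by simp_all
  have fd: "f differentiable (at ?x)" by (rule smooth_onD[OF \<Omega>(3,2)])
  have D: "linear (dif f ?x)" by (rule linear_dif[OF fd])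
  have T: "v \<in> tangent_to A L p \<longleftrightarrow> v \<in> tangent_space A p \<and> vert (v c) = dif f ?x (horiz (v c))" for v
    by (rule tangent_to_graph_iff[OF A gr])
  show ?thesis
  proof
    assume sff: "second_fundamental_form_vanishes A \<Gamma> L p"
    show "\<forall>a b. sff_chart A \<Gamma> c p f a b = 0"
    proof (intro allI)
      fix a b
      obtain W where W: "open W" "p \<in> W" "W \<subseteq> fst c"
        "\<And>q. q \<in> L \<Longrightarrow> q \<in> W \<Longrightarrow> horiz (snd c q) \<in> \<Omega> \<and> graph_at c L q f"
        using \<Omega>(7) by blast
      define Z where "Z y = join b (dif f (horiz y) b)" for y :: "real^('n + 'm)"
      let ?U = "W \<inter> (fst c \<inter> (\<lambda>q. horiz (snd c q)) -` \<Omega>)"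
      let ?Y = "\<lambda>q. tvec_of A c q (Z (snd c q))"
      have "open (fst c \<inter> (\<lambda>q. horiz (snd c q)) -` \<Omega>)"
        by (rule continuous_open_preimage[OF continuous_on_horiz[OF chart_continuous(1)[OF tc]] chart_open(1)[OF tc] o])
      then have U: "open ?U" "?U \<subseteq> fst c" "p \<in> ?U" using W \<Omega>(2) p by auto
      have oU: "open (snd c ` ?U)" using open_chart_image[OF tc U(1)] U(2) by (simp add: Int_absorb1)
      have sh: "smooth_on (snd c ` ?U) horiz" by (rule smooth_on_linear[OF linear_horiz])
      have "smooth_on (snd c ` ?U) (\<lambda>y. dif f (horiz y) b)"
        by (rule smooth_on_compose[OF smooth_on_dif[OF \<Omega>(3)] sh oU o]) auto
      then have Zs: "smooth_on (snd c ` ?U) Z" unfolding Z_def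
        by (intro smooth_on_join oU smooth_on_const)
      have Y: "smooth_vector_field_on A ?U ?Y" by (rule smooth_vector_field_chartI[OF A U(1,2) Zs])
      have X: "tvec_of A c p (G a) \<in> tangent_to A L p"
        unfolding T using tvec_of_tangent[OF A p(2)] tvec_of_same[OF A p(2)] by (simp add: G_def)
      have XT: "tvec_of A c p (G a) \<in> tangent_space A p" using X T by blast
      have "?Y q \<in> tangent_to A L q" if q: "q \<in> L \<inter> ?U" for q
      proof -
        have gq: "graph_at c L q f" using W(4) q by blast
        have "q \<in> fst c" using q by blast
        then show ?thesis unfolding tangent_to_graph_iff[OF A gq]
          using tvec_of_tangent[OF A] tvec_of_same[OF A] by (simp add: Z_def)
      qed
      then have YL: "\<forall>q\<in>L \<inter> ?U. ?Y q \<in> tangent_to A L q" by blast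
      have "\<Gamma> p (tvec_of A c p (G a)) ?Y \<in> tangent_to A L p"
        by (rule sff[unfolded second_fundamental_form_vanishes_def, rule_format, OF X]) (use Y U(3) YL in blast)
      then have t: "vert (\<Gamma> p (tvec_of A c p (G a)) ?Y c) = dif f ?x (horiz (\<Gamma> p (tvec_of A c p (G a)) ?Y c))"
        unfolding T by blast
      have "dif (\<lambda>y. ?Y (chart_inv c y) c) (snd c p) = dif Z (snd c p)"
      proof (rule dif_cong_open[OF oU])
        show "snd c p \<in> snd c ` ?U" using U(3) by blast
        fix y assume "y \<in> snd c ` ?U"
        then obtain q where "q \<in> fst c" "y = snd c q" by blast
        then show "?Y (chart_inv c y) c = Z y" using ci(1) tvec_of_same[OF A] by simp
      qed
      also have "dif Z (snd c p) = (\<lambda>z. join 0 (dif2 f ?x (horiz z) b))"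
      proof -
        have db: "(\<lambda>x. dif f x b) differentiable (at ?x)" by (rule smooth_onD[OF smooth_on_dif[OF \<Omega>(3)] \<Omega>(2)])
        show ?thesis unfolding Z_def
          by (rule dif_eqI, rule has_derivative_join[OF has_derivative_const],
              rule has_derivative_compose[OF linear_imp_has_derivative[OF linear_horiz] has_dif[OF db]])
      qed
      finally have "\<Gamma> p (tvec_of A c p (G a)) ?Y c
          = join 0 (dif2 f ?x (horiz (G a)) b) + gam A \<Gamma> c p (G a) (Z (snd c p))"
        using connection_in_chart[OF A(1) \<Gamma> Y U(3) A(2) p(2) XT] tvec_of_same[OF A p(2)] by simp
      moreover have "Z (snd c p) = G b" by (simp add: Z_def G_def)
      ultimately show "sff_chart A \<Gamma> c p f a b = 0"
        using t unfolding sff_chart_def Let_def G_def[symmetric]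
        by (simp add: linear_add[OF linear_vert] linear_add[OF linear_horiz] G_def add_diff_eq)
    qed
  next
    assume eq: "\<forall>a b. sff_chart A \<Gamma> c p f a b = 0"
    show "second_fundamental_form_vanishes A \<Gamma> L p"
      unfolding second_fundamental_form_vanishes_def
    proof (intro ballI allI impI, elim conjE)
      fix X U Y
      assume X: "X \<in> tangent_to A L p" and U: "p \<in> U" and Y: "smooth_vector_field_on A U Y"
        and YL: "\<forall>q\<in>L \<inter> U. Y q \<in> tangent_to A L q"
      define Z where "Z y = Y (chart_inv c y) c" for y
      define F where "F x = join x (f x)" for x
      have XT: "X \<in> tangent_space A p" using X T by blast
      define a where "a = horiz (X c)"
      have Xc: "X c = G a" using X unfolding T by (simp add: join_eq_iff[of "X c"] G_def a_def)
      have oU: "open U" using Y by (simp add: smooth_vector_field_on_def)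
      let ?V = "snd c ` (fst c \<inter> U)"
      have V: "open ?V" by (rule open_chart_image[OF tc oU])
      have Zs: "smooth_on ?V Z" using smooth_vector_field_in_chart[OF Y A(2)] by (simp add: Z_def[abs_def] Int_commute)
      have Fs: "smooth_on \<Omega> F" unfolding F_def by (rule smooth_on_join[OF o smooth_on_id \<Omega>(3)])
      let ?N = "\<Omega> \<inter> F -` ?V"
      have N: "open ?N" by (rule continuous_open_preimage[OF smooth_on_continuous[OF Fs] o V])
      have Fx: "F ?x = snd c p" using \<Omega>(4) by (simp add: F_def)
      have xN: "?x \<in> ?N" using \<Omega>(2) Fx p U by auto
      have dF: "dif F ?x w = G w" for w
        unfolding F_def G_def using dif_eqI[OF has_derivative_join[OF has_derivative_ident has_dif[OF fd]]] by simp
      have ZF: "smooth_on ?N (\<lambda>x. Z (F x))"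
        by (rule smooth_on_compose[OF Zs smooth_on_subset[OF Fs] N V]) auto
      have ZFd: "(\<lambda>x. Z (F x)) differentiable (at ?x)" by (rule smooth_onD[OF ZF xN])
      have dZF: "dif (\<lambda>x. Z (F x)) ?x w = dif Z (snd c p) (G w)" for w
        using dif_compose[OF smooth_onD[OF Fs \<Omega>(2)], of Z w] smooth_onD[OF Zs, of "snd c p"] xN Fx dF by auto
      \<comment> \<open>the field is tangent along the graph, which is an identity between functions of \<open>x\<close>\<close>
      have tang: "vert (Z (F x)) = dif f x (horiz (Z (F x)))" if x: "x \<in> ?N" for x
      proof -
        let ?q = "chart_inv c (F x)"
        have x\<Omega>: "x \<in> \<Omega>" using x by blast
        have gq: "graph_at c L ?q f" using \<Omega>(6)[OF x\<Omega>] by (simp add: F_def)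
        have sq: "snd c ?q = F x" using \<Omega>(5)[OF x\<Omega>] ci(2) by (simp add: F_def)
        obtain q where "q \<in> fst c" "q \<in> U" "F x = snd c q" using x by blast
        then have "?q \<in> U" using ci(1) by simp
        then have "Y ?q \<in> tangent_to A L ?q" using YL graph_atD(1)[OF gq] by blast
        then show ?thesis unfolding tangent_to_graph_iff[OF A gq] sq by (simp add: Z_def F_def)
      qed
      have hd: "(\<lambda>x. horiz (Z (F x))) differentiable (at ?x)"
        using differentiable_chain_at[OF ZFd linear_imp_differentiable[OF linear_horiz]] by (simp add: o_def)
      let ?b = "horiz (Z (snd c p))" and ?D = "dif Z (snd c p) (G a)"
      have "dif (\<lambda>x. vert (Z (F x))) ?x a = dif (\<lambda>x. dif f x (horiz (Z (F x)))) ?x a"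
        by (rule arg_cong[where f="\<lambda>f. f a"], rule dif_cong_open[OF N xN tang])
      also have "\<dots> = dif2 f ?x a ?b + dif f ?x (dif (\<lambda>x. horiz (Z (F x))) ?x a)"
      proof -
        have "((\<lambda>y. dif f y (horiz (Z (F y)))) has_derivative
          (\<lambda>a. dif2 f ?x (dif (\<lambda>x. x) ?x a) (horiz (Z (F ?x))) + dif f ?x (dif (\<lambda>x. horiz (Z (F x))) ?x a))) (at ?x)"
          by (rule has_derivative_dif_apply[OF o \<Omega>(3), where \<psi>="\<lambda>x. x" and Z="\<lambda>x. horiz (Z (F x))"])
             (use \<Omega>(2) hd in auto)
        from dif_eqI[OF this] show ?thesis using Fx by (simp add: dif_eqI[OF has_derivative_ident])
      qed
      also have "dif (\<lambda>x. horiz (Z (F x))) ?x a = horiz ?D"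
        using dif_linear_comp[OF linear_horiz ZFd] dZF by simp
      finally have D1: "vert ?D = dif2 f ?x a ?b + dif f ?x (horiz ?D)"
        using dif_linear_comp[OF linear_vert ZFd] dZF by simp
      have Yc: "Y p c = G ?b"
        using tang[OF xN] Fx ci(1)[OF p(2)] by (simp add: Z_def G_def join_eq_iff[of "Y p c"])
      have GT: "\<Gamma> p X Y \<in> tangent_space A p" by (rule connection_tangent[OF A(1) \<Gamma> Y U XT])
      have "\<Gamma> p X Y c = ?D + gam A \<Gamma> c p (G a) (G ?b)"
        using connection_in_chart[OF A(1) \<Gamma> Y U A(2) p(2) XT] Xc Yc by (simp add: Z_def[abs_def])
      then have "vert (\<Gamma> p X Y c) = dif f ?x (horiz (\<Gamma> p X Y c))"
        using D1 eq[rule_format, of a ?b] unfolding sff_chart_def Let_def G_def[symmetric]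
        by (simp add: linear_add[OF linear_vert] linear_add[OF linear_horiz] linear_add[OF D] algebra_simps)
      then show "\<Gamma> p X Y \<in> tangent_to A L p" unfolding T using GT by blast
    qed
  qed
qed

lemma sum_UNIV_Plus: "(\<Sum>J\<in>UNIV. g J) = (\<Sum>i\<in>UNIV. g (Inl i)) + (\<Sum>j\<in>UNIV. g (Inr j))"
  for g :: "'n::finite + 'm::finite \<Rightarrow> 'b::comm_monoid_add"
  using sum.Plus[of "UNIV :: 'n set" "UNIV :: 'm set" g] by (simp add: UNIV_Plus_UNIV o_def)

lemma sum_axis: "(\<Sum>i\<in>UNIV. a i * axis k (1::real) $ i) = a k" for a :: "'n::finite \<Rightarrow> real"
  by (simp add: axis_def if_distrib cong: if_cong)

text \<open>
  The coefficients of the connection on the first order jets are made such that the vertical projection of a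
  tangent vector of a prolongation is the second fundamental form.
\<close>

lemma dot_vertical_graph:
  fixes A :: "('e::{t2_space,second_countable_topology}, real^('n::finite + 'm::finite)) chart set"
  assumes A: "smooth_manifold A" "c \<in> A" and L: "submanifold A L" and gr: "graph_at c L p f"
    and v: "v (jet1_chart A c) = (join a (dif f (horiz (snd c p)) a), M)"
  shows "dot_vertical A \<Gamma> c (jet A 1 L p) v
     = M + matrix (\<lambda>b. sff_chart A \<Gamma> c p f a b - dif2 f (horiz (snd c p)) a b)"
proof -
  let ?D = "dif f (horiz (snd c p))" and ?G = "christoffel A \<Gamma> c p"
  have Dm: "?D h $ k = (\<Sum>\<beta>\<in>UNIV. matrix ?D $ k $ \<beta> * h $ \<beta>)" for h k
    using matrix_dif_works[OF graph_at_differentiable[OF gr], of h]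
    by (metis (no_types, lifting) matrix_vector_mult_def sum.cong vec_lambda_beta)
  have dc: "dot_coeff A \<Gamma> c (jet A 1 L p) I k \<xi>
      = (\<Sum>J\<in>UNIV. ?G I (Inr k) J * join (axis \<xi> 1) (?D (axis \<xi> 1)) $ J)
        - (\<Sum>\<beta>\<in>UNIV. matrix ?D $ k $ \<beta> * (\<Sum>J\<in>UNIV. ?G I (Inl \<beta>) J * join (axis \<xi> 1) (?D (axis \<xi> 1)) $ J))" for I k \<xi>
  proof -
    have "(\<Sum>J\<in>UNIV. ?G I K J * join (axis \<xi> 1) (?D (axis \<xi> 1)) $ J)
        = ?G I K (Inl \<xi>) + (\<Sum>i\<in>UNIV. ?G I K (Inr i) * matrix ?D $ i $ \<xi>)" for K
      by (simp add: sum_UNIV_Plus sum_axis) (simp add: matrix_def)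
    then show ?thesis
      unfolding dot_coeff_def Let_def jet1_chart_val_graph[OF A L gr] by simp
  qed
  have key: "(\<Sum>I\<in>UNIV. dot_coeff A \<Gamma> c (jet A 1 L p) I k \<xi> * z $ I)
      = vert (gam A \<Gamma> c p z (join (axis \<xi> 1) (?D (axis \<xi> 1)))) $ k
        - ?D (horiz (gam A \<Gamma> c p z (join (axis \<xi> 1) (?D (axis \<xi> 1))))) $ k" for z k \<xi>
  proof -
    let ?w = "join (axis \<xi> 1) (?D (axis \<xi> 1))"
    have g: "gam A \<Gamma> c p z ?w $ K = (\<Sum>I\<in>UNIV. (\<Sum>J\<in>UNIV. ?G I K J * ?w $ J) * z $ I)" for K
      by (simp add: gam_def sum_distrib_right sum_distrib_left mult_ac)
    have h: "horiz y $ \<beta> = y $ Inl \<beta>" "vert y $ i = y $ Inr i" for y :: "real^('n+'m)" and \<beta> i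
      by (simp_all add: horiz_def vert_def)
    have "?D (horiz (gam A \<Gamma> c p z ?w)) $ k
       = (\<Sum>\<beta>\<in>UNIV. \<Sum>I\<in>UNIV. matrix ?D $ k $ \<beta> * (\<Sum>J\<in>UNIV. ?G I (Inl \<beta>) J * ?w $ J) * z $ I)"
      unfolding Dm h g by (simp add: sum_distrib_left mult_ac)
    also have "\<dots> = (\<Sum>I\<in>UNIV. (\<Sum>\<beta>\<in>UNIV. matrix ?D $ k $ \<beta> * (\<Sum>J\<in>UNIV. ?G I (Inl \<beta>) J * ?w $ J)) * z $ I)"
      by (subst sum.swap) (simp add: sum_distrib_right)
    finally show ?thesis
      unfolding dc h g by (simp add: left_diff_distrib sum_subtractf)
  qed
  show ?thesis
    by (simp add: vec_eq_iff dot_vertical_def v key[unfolded One_nat_def] sff_chart_def Let_def matrix_def)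
qed

text \<open>
  The tangent map is defined by one chart, which is chosen arbitrarily; the lemma exhibits it.
\<close>

lemma tangent_map_fst:
  fixes A :: "('e::{t2_space,second_countable_topology}, real^('n::finite + 'm::finite)) chart set"
  assumes A: "smooth_manifold A" and L: "submanifold A L" "p \<in> L"
  obtains c where "c \<in> A" "jet A 1 L p \<in> fst (jet1_chart A c)"
    "\<And>v. tangent_map (jet1_atlas A) A fst (jet A 1 L p) v = tvec_of A c p (fst (v (jet1_chart A c)))"
proof -
  let ?\<theta> = "jet A 1 L p"
  define C where "C = (SOME C. C \<in> jet1_atlas A \<and> ?\<theta> \<in> fst C)"
  obtain c0 f0 where "c0 \<in> A" "graph_at c0 L p f0"
    using L submanifold_iff_graph[OF A] by blast
  then have "jet1_chart A c0 \<in> jet1_atlas A \<and> ?\<theta> \<in> fst (jet1_chart A c0)"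
    using jet1_chart_dom_graph[OF A _ L] by (auto simp: jet1_atlas_def)
  then have "C \<in> jet1_atlas A \<and> ?\<theta> \<in> fst C" unfolding C_def by (rule someI)
  then obtain c where c: "c \<in> A" "C = jet1_chart A c" "?\<theta> \<in> fst (jet1_chart A c)"
    unfolding jet1_atlas_def by blast
  note co = jet1_chart_coords[OF A c(1,3)]
  show ?thesis
  proof (rule that[OF c(1,3)], rule ext)
    fix v :: "('e jet, (real^('n + 'm)) \<times> (real^'n^'m)) tvec" and d :: "('e, real^('n + 'm)) chart"
    let ?v = "v (jet1_chart A c)" and ?\<Phi> = "\<lambda>z. snd d (fst (chart_inv (jet1_chart A c) z))"
    have "dif ?\<Phi> (snd (jet1_chart A c) ?\<theta>) ?v = dif (transition c d) (snd c p) (fst ?v)"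
      if d: "d \<in> A" "p \<in> fst d"
    proof -
      let ?S = "snd c ` (fst c \<inter> fst d) \<times> (UNIV :: (real^'n^'m) set)"
      have "dif ?\<Phi> (snd (jet1_chart A c) ?\<theta>) = dif (\<lambda>z. transition c d (fst z)) (snd (jet1_chart A c) ?\<theta>)"
      proof (rule dif_cong_open)
        show "open ?S" by (intro open_Times open_overlap[OF A c(1) d(1)] open_UNIV)
        show "snd (jet1_chart A c) ?\<theta> \<in> ?S" using co d by (auto simp: mem_Times_iff)
        fix z assume "z \<in> ?S"
        then obtain q u where z: "q \<in> fst c" "z = (snd c q, u)" by auto
        obtain N f where "submanifold A N" "graph_at c N q f" "matrix (dif f (horiz (snd c q))) = u"
          by (rule exists_plane[OF A c(1) z(1)])
        then have "fst (chart_inv (jet1_chart A c) z) = q"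
          using jet1_chart_inv[OF A c(1)] z(2) by force
        then show "?\<Phi> z = transition c d (fst z)"
          using z transition_snd[OF manifold_chart[OF A c(1)] z(1), of d] by simp
      qed
      then have "dif ?\<Phi> (snd (jet1_chart A c) ?\<theta>) ?v = dif (\<lambda>z. transition c d (fst z)) (snd (jet1_chart A c) ?\<theta>) ?v" by simp
      also have "\<dots> = dif (transition c d) (fst (snd (jet1_chart A c) ?\<theta>)) (dif fst (snd (jet1_chart A c) ?\<theta>) ?v)"
        using co transition_differentiable[OF A c(1) d(1) _ d(2)]
        by (intro dif_compose) (auto intro: linear_imp_differentiable linear_fst)
      also have "\<dots> = dif (transition c d) (snd c p) (fst ?v)"
        using co dif_eqI[OF linear_imp_has_derivative[OF linear_fst], of "snd (jet1_chart A c) ?\<theta>"] by simp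
      finally show ?thesis .
    qed
    then show "tangent_map (jet1_atlas A) A fst ?\<theta> v d = tvec_of A c p (fst ?v) d"
      unfolding tangent_map_def Let_def C_def[symmetric] c(2) tvec_of_def by (simp add: o_def)
  qed
qed

text \<open>
  A vector in the lift has the base component of a vector of the prolongation, and being horizontal
  fixes its fibre component. Horizontality is required in all charts of \<open>E\<close>; it holds for the vectors of the
  prolongation as the vanishing of the second fundamental form does not depend on charts.
\<close>

theorem plane2_eq_dot_lift:
  assumes A: "smooth_manifold A" and \<Gamma>: "linear_connection A \<Gamma>" and L: "submanifold A L" "p \<in> L"
    and sff: "second_fundamental_form_vanishes A \<Gamma> L p"
  shows "plane2 A L p = dot_lift A \<Gamma> (jet A 1 L p) (tangent_to A L p)"
proof -
  let ?\<theta> = "jet A 1 L p"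
  obtain c where c: "c \<in> A" "?\<theta> \<in> fst (jet1_chart A c)"
    and tm: "\<And>v. tangent_map (jet1_atlas A) A fst ?\<theta> v = tvec_of A c p (fst (v (jet1_chart A c)))"
    by (rule tangent_map_fst[OF A L]) (rule that; assumption)
  obtain f where f: "graph_at c L p f" using jet1_chart_dom_graph[OF A c(1) L] c(2) by blast
  have p: "p \<in> fst c" using graph_atD[OF f] by simp
  show ?thesis
  proof (intro equalityI subsetI)
    fix v assume v: "v \<in> plane2 A L p"
    have vT: "v \<in> tangent_space (jet1_atlas A) ?\<theta>" using v plane2_graph_iff(1)[OF A c(1) L(1) f] by blast
    have "dot_vertical A \<Gamma> d ?\<theta> v = 0" if d: "d \<in> A" "?\<theta> \<in> fst (jet1_chart A d)" for d
    proof -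
      obtain g where g: "graph_at d L p g" using jet1_chart_dom_graph[OF A d(1) L] d(2) by blast
      obtain w where "v (jet1_chart A d) = (join w (dif g (horiz (snd d p)) w), matrix (dif2 g (horiz (snd d p)) w))"
        using v plane2_graph_iff(1)[OF A d(1) L(1) g] by blast
      from dot_vertical_graph[of A d L p g v w, OF A d(1) L(1) g this]
      show ?thesis
        using second_fundamental_form_chart[OF A d(1) \<Gamma> g] sff by (simp add: matrix_def vec_eq_iff)
    qed
    moreover obtain w where w: "v (jet1_chart A c) = (join w (dif f (horiz (snd c p)) w), matrix (dif2 f (horiz (snd c p)) w))"
      using v plane2_graph_iff(1)[OF A c(1) L(1) f] by blast
    have "tvec_of A c p (fst (v (jet1_chart A c))) \<in> tangent_to A L p"
      unfolding tangent_to_graph_iff[OF A c(1) f]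
      using tvec_of_tangent[OF A c(1) p] tvec_of_same[OF A c(1) p] w by simp
    ultimately show "v \<in> dot_lift A \<Gamma> ?\<theta> (tangent_to A L p)"
      unfolding dot_lift_def dot_horizontal_def tm using vT by blast
  next
    fix v assume "v \<in> dot_lift A \<Gamma> ?\<theta> (tangent_to A L p)"
    then have v: "v \<in> tangent_space (jet1_atlas A) ?\<theta>" "dot_vertical A \<Gamma> c ?\<theta> v = 0"
      "tvec_of A c p (fst (v (jet1_chart A c))) \<in> tangent_to A L p"
      unfolding dot_lift_def dot_horizontal_def tm using c by blast+
    define w where "w = horiz (fst (v (jet1_chart A c)))"
    have "fst (v (jet1_chart A c)) = join w (dif f (horiz (snd c p)) w)"
      using v(3) unfolding tangent_to_graph_iff[OF A c(1) f]
      by (simp add: tvec_of_same[OF A c(1) p] w_def join_eq_iff[of "fst (v (jet1_chart A c))"])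
    then have vc: "v (jet1_chart A c) = (join w (dif f (horiz (snd c p)) w), snd (v (jet1_chart A c)))"
      by (simp add: prod_eq_iff)
    have "snd (v (jet1_chart A c)) = matrix (dif2 f (horiz (snd c p)) w)"
      using dot_vertical_graph[of A c L p f v w _ \<Gamma>, OF A c(1) L(1) f vc] v(2) second_fundamental_form_chart[OF A c(1) \<Gamma> f] sff
      by (simp add: matrix_def vec_eq_iff)
    then show "v \<in> plane2 A L p"
      unfolding plane2_graph_iff(1)[OF A c(1) L(1) f] using v(1) vc by metis
  qed
qed

text \<open>
  A function with prescribed 2-jet at a point; the symmetry of \<open>Q\<close> is the only obstruction.
\<close>

lemma quadratic_polynomial:
  fixes Q :: "'a::euclidean_space \<Rightarrow> 'a \<Rightarrow> 'b::euclidean_space"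
  assumes l: "linear l" and Q: "bilinear Q" and sym: "\<And>a b. Q a b = Q b a"
  obtains F where "smooth_on UNIV F" "F x0 = y0" "dif F x0 = l" "\<And>a b. dif2 F x0 a b = Q a b"
proof -
  define F where "F x = y0 + l (x - x0) + (1/2) *\<^sub>R Q (x - x0) (x - x0)" for x
  have bQ: "bounded_bilinear Q" using Q bilinear_conv_bounded_bilinear by blast
  have sx: "smooth_on UNIV (\<lambda>x. x - x0)" by (intro smooth_on_minus open_UNIV smooth_on_id smooth_on_const)
  have sF: "smooth_on UNIV F" unfolding F_def
    by (intro smooth_on_add smooth_on_const open_UNIV smooth_on_linear_comp[OF l] sx
        smooth_on_bilinear[OF bounded_bilinear_scaleR] smooth_on_bilinear[OF bQ])
  have dF: "(F has_derivative (\<lambda>v. l v + Q (x - x0) v)) (at x)" for x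
  proof -
    have dx: "((\<lambda>x. x - x0) has_derivative (\<lambda>v. v)) (at x)" by (auto intro!: derivative_eq_intros)
    have "((\<lambda>x. l (x - x0)) has_derivative l) (at x)"
      using has_derivative_compose[OF dx linear_imp_has_derivative[OF l]] by simp
    moreover have q: "((\<lambda>x. (1/2) *\<^sub>R Q (x - x0) (x - x0)) has_derivative (\<lambda>v. (1/2) *\<^sub>R (Q (x - x0) v + Q v (x - x0)))) (at x)"
      by (rule has_derivative_scaleR_right[OF bounded_bilinear.FDERIV[OF bQ dx dx]])
    moreover have e: "(1/2) *\<^sub>R (Q (x - x0) v + Q v (x - x0)) = Q (x - x0) v" for v
      by (simp add: sym[of v] flip: scaleR_2)
    ultimately show ?thesis unfolding F_def
      using has_derivative_add[OF has_derivative_add[OF has_derivative_const[of y0]]] unfolding e by force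
  qed
  have Q0: "Q 0 b = 0" "Q a 0 = 0" for a b
    using bounded_bilinear.zero_left[OF bQ] bounded_bilinear.zero_right[OF bQ] by auto
  have 1: "dif F x = (\<lambda>v. l v + Q (x - x0) v)" for x by (rule dif_eqI[OF dF])
  have "((\<lambda>x. l b + Q (x - x0) b) has_derivative (\<lambda>a. Q a b)) (at x0)" for b
  proof -
    have dx: "((\<lambda>x. x - x0) has_derivative (\<lambda>v. v)) (at x0)" by (auto intro!: derivative_eq_intros)
    show ?thesis
      using has_derivative_add[OF has_derivative_const[of "l b"] bounded_linear.has_derivative[OF bounded_bilinear.bounded_linear_left[OF bQ, of b] dx]]
      by simp
  qed
  from dif_eqI[OF this] have "dif2 F x0 a b = Q a b" for a b unfolding 1 by simp
  then show ?thesis using that[OF sF] 1[of x0] linear_0[OF l] by (simp add: Q0 F_def)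
qed

text \<open>
  The equation \<open>sff_chart = 0\<close> prescribes the second derivative by a bilinear map that depends on the first
  order jet only. It is symmetric since \<open>\<Gamma>\<close> is torsion-free.
\<close>

lemma exists_totally_geodesic_jet:
  assumes A: "smooth_manifold A" and \<Gamma>: "linear_connection A \<Gamma>" "torsion_free A \<Gamma>" and L: "submanifold A L" "p \<in> L"
  obtains N where "submanifold A N" "p \<in> N" "jet A 1 N p = jet A 1 L p" "second_fundamental_form_vanishes A \<Gamma> N p"
proof -
  obtain c f where c: "c \<in> A" "graph_at c L p f"
    using L submanifold_iff_graph[OF A] by blast
  have p: "p \<in> fst c" using graph_atD[OF c(2)] by simp
  let ?x = "horiz (snd c p)"
  let ?D = "dif f ?x"
  have D: "linear ?D" by (rule linear_dif[OF graph_at_differentiable[OF c(2)]])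
  \<comment> \<open>minus the component modulo the tangent plane, to be cancelled by the second derivative\<close>
  define P where "P z = ?D (horiz z) - vert z" for z
  have P: "linear P" unfolding P_def
    by (intro linear_compose_sub linear_vert linear_compose[OF linear_horiz D, unfolded o_def])
  have G: "linear (\<lambda>a. join a (?D a))"
    by (rule linearI) (simp_all add: join_add join_scale linear_add[OF D] linear_cmul[OF D])
  define Q where "Q a b = P (gam A \<Gamma> c p (join a (?D a)) (join b (?D b)))" for a b
  have "linear (\<lambda>b. Q a b)" for a unfolding Q_def
    using linear_compose[OF linear_compose[OF G linear_gam_right] P] by (simp add: o_def)
  moreover have "linear (\<lambda>a. Q a b)" for b unfolding Q_def
    using linear_compose[OF linear_compose[OF G linear_gam_left] P] by (simp add: o_def)
  ultimately have Q: "bilinear Q" by (simp add: bilinear_def)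
  have sym: "Q a b = Q b a" for a b unfolding Q_def using gam_sym[OF A \<Gamma> c(1) p] by simp
  obtain h where h: "smooth_on UNIV h" "h ?x = vert (snd c p)" "dif h ?x = ?D" "\<And>a b. dif2 h ?x a b = Q a b"
    by (rule quadratic_polynomial[OF D Q sym]) (rule that; assumption)
  let ?N = "{q \<in> fst c. vert (snd c q) = h (horiz (snd c q))}"
  note N = graph_submanifold[OF A c(1) h(1) p h(2)[symmetric]]
  have "tangent_to A ?N p = tangent_to A L p"
    using tangent_to_graph_iff[OF A c(1) N(2)] tangent_to_graph_iff[OF A c] h(3) by auto
  then have "jet A 1 ?N p = jet A 1 L p"
    using jet_1_eq_iff[OF A N(1) graph_atD(1)[OF N(2)] L] by simp
  moreover have "second_fundamental_form_vanishes A \<Gamma> ?N p"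
    unfolding second_fundamental_form_chart[OF A c(1) \<Gamma>(1) N(2)] sff_chart_def Let_def h(3,4)
    by (simp add: Q_def P_def)
  ultimately show ?thesis using that[OF N(1) graph_atD(1)[OF N(2)]] by blast
qed

text \<open>
  The defining property of the second order jet fixes its plane, hence the jet itself.
\<close>

theorem ddot_eq:
  assumes A: "smooth_manifold A" and \<Gamma>: "linear_connection A \<Gamma>" and L: "submanifold A L" "p \<in> L"
    and sff: "second_fundamental_form_vanishes A \<Gamma> L p"
  shows "ddot A \<Gamma> (jet A 1 L p) = jet A 2 L p"
  unfolding ddot_def R_plane1_jet[OF A L]
proof (rule the_equality)
  show "jet A 2 L p \<in> Jet A 2 \<and> jet_proj A 1 (jet A 2 L p) = jet A 1 L p \<and>
     R_plane2 A (jet A 2 L p) = dot_lift A \<Gamma> (jet A 1 L p) (tangent_to A L p)"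
    using L jet_proj_jet_2[OF A L] R_plane2_jet[OF A L] plane2_eq_dot_lift[OF A \<Gamma> L sff]
    unfolding Jet_def by auto
  fix \<theta> assume \<theta>: "\<theta> \<in> Jet A 2 \<and> jet_proj A 1 \<theta> = jet A 1 L p \<and>
     R_plane2 A \<theta> = dot_lift A \<Gamma> (jet A 1 L p) (tangent_to A L p)"
  then obtain N q where N: "\<theta> = jet A 2 N q" "submanifold A N" "q \<in> N" unfolding Jet_def by blast
  have "jet A 1 N q = jet A 1 L p" using \<theta> jet_proj_jet_2[OF A N(2,3)] N(1) by simp
  moreover have "plane2 A N q = plane2 A L p"
    using \<theta> R_plane2_jet[OF A N(2,3)] plane2_eq_dot_lift[OF A \<Gamma> L sff] N(1) by simp
  ultimately show "\<theta> = jet A 2 L p" using jet_2_eq_iff[OF A N(2,3) L] N(1) by simp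
qed

theorem section_ddot:
  assumes A: "smooth_manifold A" and \<Gamma>: "linear_connection A \<Gamma>" "torsion_free A \<Gamma>"
  shows "section_with_image (ddot A \<Gamma>) (jet_proj A 1) (Jet A 1) (Jet A 2) (geod_eq A \<Gamma>)"
proof -
  have *: "\<exists>N p. submanifold A N \<and> p \<in> N \<and> second_fundamental_form_vanishes A \<Gamma> N p \<and>
      \<theta> = jet A 1 N p \<and> ddot A \<Gamma> \<theta> = jet A 2 N p" if \<theta>: "\<theta> \<in> Jet A 1" for \<theta>
  proof -
    obtain L p where L: "\<theta> = jet A 1 L p" "submanifold A L" "p \<in> L" using \<theta> unfolding Jet_def by blast
    obtain N where N: "submanifold A N" "p \<in> N" "jet A 1 N p = jet A 1 L p" "second_fundamental_form_vanishes A \<Gamma> N p"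
      by (rule exists_totally_geodesic_jet[OF A \<Gamma> L(2,3)])
    then show ?thesis using ddot_eq[OF A \<Gamma>(1) N(1,2,4)] L(1) by metis
  qed
  show ?thesis unfolding section_with_image_def
  proof (intro conjI ballI)
    show "geod_eq A \<Gamma> \<subseteq> Jet A 2" unfolding geod_eq_def Jet_def by blast
    show "ddot A \<Gamma> ` Jet A 1 = geod_eq A \<Gamma>"
    proof (intro equalityI subsetI)
      fix \<theta> assume "\<theta> \<in> ddot A \<Gamma> ` Jet A 1"
      then obtain \<theta>1 where "\<theta>1 \<in> Jet A 1" "\<theta> = ddot A \<Gamma> \<theta>1" by blast
      then show "\<theta> \<in> geod_eq A \<Gamma>" using *[of \<theta>1] unfolding geod_eq_def by blast
    next
      fix \<theta> assume "\<theta> \<in> geod_eq A \<Gamma>"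
      then obtain L p where L: "\<theta> = jet A 2 L p" "submanifold A L" "p \<in> L" "second_fundamental_form_vanishes A \<Gamma> L p"
        unfolding geod_eq_def by blast
      then have "\<theta> = ddot A \<Gamma> (jet A 1 L p)" using ddot_eq[OF A \<Gamma>(1) L(2-4)] by simp
      moreover have "jet A 1 L p \<in> Jet A 1" unfolding Jet_def using L by blast
      ultimately show "\<theta> \<in> ddot A \<Gamma> ` Jet A 1" by blast
    qed
    fix \<theta> assume "\<theta> \<in> Jet A 1"
    from *[OF this] obtain N p where "submanifold A N" "p \<in> N" "\<theta> = jet A 1 N p" "ddot A \<Gamma> \<theta> = jet A 2 N p" by blast
    then show "jet_proj A 1 (ddot A \<Gamma> \<theta>) = \<theta>" using jet_proj_jet_2[OF A] by metis
  qed
qed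

section \<open>Jets of maps\<close>

lemma same_derivs_trans: "same_derivs r f g x \<Longrightarrow> same_derivs r g h x \<Longrightarrow> same_derivs r f h x"
  by (induction r arbitrary: f g h) (auto, blast)

text \<open>
  The coordinate representation of a map.
\<close>

abbreviation rep :: "('x, 'b) chart \<Rightarrow> ('e, 'c) chart \<Rightarrow> ('x \<Rightarrow> 'e) \<Rightarrow> 'b \<Rightarrow> 'c" where
  "rep c d s \<equiv> \<lambda>y. snd d (s (chart_inv c y))"

lemma comp_eq: "snd d \<circ> s \<circ> chart_inv c = rep c d s"
  by (simp add: o_def)

context
  fixes M :: "('x::{t2_space,second_countable_topology}, real^'n::finite) chart set"
    and E :: "('e::{t2_space,second_countable_topology}, real^'k::finite) chart set"
  assumes M: "smooth_manifold M" and E: "smooth_manifold E"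
begin

lemma smooth_map_on_iff:
  "smooth_map_on M E U s \<longleftrightarrow> (\<forall>c\<in>M. smooth_into E (snd c ` (U \<inter> fst c)) (\<lambda>y. s (chart_inv c y)))"
proof -
  have eq: "snd c ` {p \<in> U \<inter> fst c. s p \<in> fst d} = {y \<in> snd c ` (U \<inter> fst c). s (chart_inv c y) \<in> fst d}"
    if c: "c \<in> M" for c d
    using chart_inv_works(1)[OF manifold_chart[OF M c]] by auto
  show ?thesis unfolding smooth_map_on_def smooth_into_def comp_eq
    by (rule ball_cong[OF refl], rule ball_cong[OF refl]) (simp only: eq)
qed

lemma smooth_map_on_into:
  "smooth_map_on M E U s \<Longrightarrow> c \<in> M \<Longrightarrow> smooth_into E (snd c ` (U \<inter> fst c)) (\<lambda>y. s (chart_inv c y))"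
  unfolding smooth_map_on_iff by blast

lemma open_chart_image': "c \<in> M \<Longrightarrow> open U \<Longrightarrow> open (snd c ` (U \<inter> fst c))"
  using open_chart_image[OF manifold_chart[OF M]] by (simp add: Int_commute)

lemma smooth_map_on_subset: "smooth_map_on M E U s \<Longrightarrow> open V \<Longrightarrow> V \<subseteq> U \<Longrightarrow> smooth_map_on M E V s"
  unfolding smooth_map_on_iff using open_chart_image' by (blast intro: smooth_into_subset)

lemma smooth_map_onI:
  assumes c: "c \<in> M" and \<Omega>: "open \<Omega>" "\<Omega> \<subseteq> snd c ` fst c" and G: "smooth_into E \<Omega> G"
    and s: "\<And>q. q \<in> chart_inv c ` \<Omega> \<Longrightarrow> s q = G (snd c q)"
  shows "open (chart_inv c ` \<Omega>)" "smooth_map_on M E (chart_inv c ` \<Omega>) s"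
proof -
  note tc = manifold_chart[OF M c]
  show U: "open (chart_inv c ` \<Omega>)" by (rule open_chart_inv_image[OF tc \<Omega>])
  show "smooth_map_on M E (chart_inv c ` \<Omega>) s" unfolding smooth_map_on_iff
  proof
    fix b assume b: "b \<in> M"
    note tb = manifold_chart[OF M b]
    let ?S = "snd b ` (chart_inv c ` \<Omega> \<inter> fst b)"
    have S: "open ?S" by (rule open_chart_image'[OF b U])
    have fc: "chart_inv c ` \<Omega> \<subseteq> fst c" using \<Omega>(2) chart_inv_works[OF tc] by auto
    have im: "transition b c ` ?S \<subseteq> \<Omega>"
      using \<Omega>(2) chart_inv_works[OF tc] chart_inv_works[OF tb] by (auto simp: transition_apply)
    have a: "smooth_into E ?S (\<lambda>y. G (transition b c y))"
      by (rule smooth_into_compose[OF G S smooth_on_subset[OF smooth_transition[OF M b c]] im]) (use fc in auto)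
    have eq: "G (transition b c y) = s (chart_inv b y)" if "y \<in> ?S" for y
      using that s chart_inv_works(1)[OF tb] by (auto simp: transition_apply)
    show "smooth_into E ?S (\<lambda>y. s (chart_inv b y))"
      unfolding smooth_into_def
    proof (intro ballI)
      fix d assume d: "d \<in> E"
      have e: "{y \<in> ?S. s (chart_inv b y) \<in> fst d} = {y \<in> ?S. G (transition b c y) \<in> fst d}" using eq by auto
      show "open {y \<in> ?S. s (chart_inv b y) \<in> fst d} \<and>
          smooth_on {y \<in> ?S. s (chart_inv b y) \<in> fst d} (rep b d s)"
        unfolding e using smooth_intoD[OF a d] eq
        by (intro conjI smooth_on_cong[OF smooth_intoD(1)[OF a d] _ smooth_intoD(2)[OF a d]]) auto
    qed
  qed
qed

lemma smooth_at_chart: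
  assumes "smooth_at M E s x" "c \<in> M" "x \<in> fst c"
  obtains U where "open U" "x \<in> U" "U \<subseteq> fst c" "smooth_map_on M E U s" "open (snd c ` U)"
    "smooth_into E (snd c ` U) (\<lambda>y. s (chart_inv c y))" "\<And>y. y \<in> U \<Longrightarrow> smooth_at M E s y"
proof -
  note tc = manifold_chart[OF M assms(2)]
  obtain U where U: "open U" "x \<in> U" "smooth_map_on M E U s" using assms(1) unfolding smooth_at_def by blast
  have V: "open (U \<inter> fst c)" using U(1) chart_open(1)[OF tc] by blast
  have s: "smooth_map_on M E (U \<inter> fst c) s" by (rule smooth_map_on_subset[OF U(3) V]) simp
  have "\<And>y. y \<in> U \<inter> fst c \<Longrightarrow> smooth_at M E s y" using V s unfolding smooth_at_def by blast
  with that[OF V _ _ s open_chart_image'[OF assms(2) U(1)] smooth_map_on_into[OF U(3) assms(2)]]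
  show ?thesis using U(2) assms(3) by blast
qed

lemma smooth_at_rep:
  assumes "smooth_at M E s x" "c \<in> M" "x \<in> fst c" "d \<in> E" "s x \<in> fst d"
  obtains S where "open S" "snd c x \<in> S" "S \<subseteq> snd c ` fst c" "smooth_on S (rep c d s)"
    "\<And>y. y \<in> S \<Longrightarrow> s (chart_inv c y) \<in> fst d"
proof -
  obtain U where U: "open U" "x \<in> U" "U \<subseteq> fst c" "smooth_into E (snd c ` U) (\<lambda>y. s (chart_inv c y))"
    by (rule smooth_at_chart[OF assms(1-3)]) (rule that; assumption)
  show ?thesis
    by (rule that[OF smooth_intoD(1)[OF U(4) assms(4)] _ _ smooth_intoD(2)[OF U(4) assms(4)]])
       (use U assms chart_inv_works(1)[OF manifold_chart[OF M assms(2)]] in auto)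
qed

lemma rep_differentiable:
  assumes "smooth_at M E s x" "c \<in> M" "x \<in> fst c" "d \<in> E" "s x \<in> fst d"
  shows "rep c d s differentiable (at (snd c x))"
  by (rule smooth_at_rep[OF assms]) (rule smooth_onD)

lemma rep_change:
  assumes s: "smooth_at M E s x" and c: "c \<in> M" "x \<in> fst c" "c' \<in> M" "x \<in> fst c'"
    and d: "d \<in> E" "s x \<in> fst d" "d' \<in> E" "s x \<in> fst d'"
  obtains S where "open S" "snd c x \<in> S" "S \<subseteq> snd c ` (fst c \<inter> fst c')"
    "\<And>y. y \<in> S \<Longrightarrow> snd d' (s (chart_inv c' (transition c c' y))) = transition d d' (snd d (s (chart_inv c y)))"
proof -
  note tc = chart_inv_works[OF manifold_chart[OF M c(1)]] and tc' = chart_inv_works[OF manifold_chart[OF M c(3)]]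
  note td = chart_inv_works[OF manifold_chart[OF E d(1)]]
  obtain S where S: "open S" "snd c x \<in> S" "S \<subseteq> snd c ` fst c" "\<And>y. y \<in> S \<Longrightarrow> s (chart_inv c y) \<in> fst d"
    by (rule smooth_at_rep[OF s c(1,2) d(1,2)]) (rule that; assumption)
  let ?S = "S \<inter> snd c ` (fst c \<inter> fst c')"
  have "open ?S" using S(1) open_overlap[OF M c(1,3)] by blast
  moreover have "snd d' (s (chart_inv c' (transition c c' y))) = transition d d' (snd d (s (chart_inv c y)))"
    if y: "y \<in> ?S" for y
  proof -
    obtain q where q: "q \<in> fst c" "q \<in> fst c'" "y = snd c q" using y by blast
    have "s (chart_inv c y) \<in> fst d" using S(4) y by blast
    then show ?thesis using q tc(1) tc'(1) td(1) by (simp add: transition_apply)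
  qed
  ultimately show ?thesis using that[of ?S] S(2) c by blast
qed

lemma dif_rep_change:
  assumes s: "smooth_at M E s x" and c: "c \<in> M" "x \<in> fst c" "c' \<in> M" "x \<in> fst c'"
    and d: "d \<in> E" "s x \<in> fst d" "d' \<in> E" "s x \<in> fst d'"
  shows "dif (rep c' d' s) (snd c' x) (dif (transition c c') (snd c x) w)
    = dif (transition d d') (snd d (s x)) (dif (rep c d s) (snd c x) w)"
proof -
  obtain S where S: "open S" "snd c x \<in> S"
    "\<And>y. y \<in> S \<Longrightarrow> snd d' (s (chart_inv c' (transition c c' y))) = transition d d' (snd d (s (chart_inv c y)))"
    by (rule rep_change[OF s c d]) (rule that; assumption)
  note tr = transition_snd[OF manifold_chart[OF M c(1)] c(2), of c']
  have sx: "snd d (s (chart_inv c (snd c x))) = snd d (s x)"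
    using chart_inv_works(1)[OF manifold_chart[OF M c(1)] c(2)] by simp
  have "dif (\<lambda>y. snd d' (s (chart_inv c' (transition c c' y)))) (snd c x)
      = dif (\<lambda>y. transition d d' (snd d (s (chart_inv c y)))) (snd c x)"
    by (rule dif_cong_open[OF S])
  moreover have "dif (\<lambda>y. snd d' (s (chart_inv c' (transition c c' y)))) (snd c x) w
      = dif (rep c' d' s) (transition c c' (snd c x)) (dif (transition c c') (snd c x) w)"
    by (rule dif_compose[OF transition_differentiable[OF M c(1,3,2,4)]])
       (use rep_differentiable[OF s c(3,4) d(3,4)] tr in simp)
  moreover have "dif (\<lambda>y. transition d d' (snd d (s (chart_inv c y)))) (snd c x) w
      = dif (transition d d') (snd d (s (chart_inv c (snd c x)))) (dif (rep c d s) (snd c x) w)"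
    by (rule dif_compose[OF rep_differentiable[OF s c(1,2) d(1,2)]])
       (use transition_differentiable[OF E d(1,3,2,4)] sx in simp)
  ultimately show ?thesis using tr sx by simp
qed

lemma dif_transition_surj:
  assumes "c \<in> M" "x \<in> fst c" "c' \<in> M" "x \<in> fst c'"
  shows "dif (transition c c') (snd c x) (dif (transition c' c) (snd c' x) w) = w"
  using dif_transition_cocycle[OF M assms(3,1,3,4,2,4)] dif_transition_self[OF M assms(3,4)] by simp

lemma mcontact_refl: "mcontact M E r x s s"
  by (simp add: mcontact_def same_derivs_refl)

lemma mcontactD:
  assumes "mcontact M E r x s s'"
  shows "s x = s' x" and "c \<in> M \<Longrightarrow> x \<in> fst c \<Longrightarrow> d \<in> E \<Longrightarrow> s x \<in> fst d \<Longrightarrow>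
    same_derivs r (rep c d s) (rep c d s') (snd c x)"
  using assms by (simp_all add: mcontact_def comp_eq)

lemma mcontactI:
  assumes "s x = s' x" "\<And>c d. c \<in> M \<Longrightarrow> x \<in> fst c \<Longrightarrow> d \<in> E \<Longrightarrow> s x \<in> fst d \<Longrightarrow>
    same_derivs r (rep c d s) (rep c d s') (snd c x)"
  shows "mcontact M E r x s s'"
  unfolding mcontact_def comp_eq using assms(1) by (intro conjI ballI impI, simp, elim conjE, intro assms(2))

lemma mcontact_sym:
  assumes "mcontact M E r x s s'"
  shows "mcontact M E r x s' s"
  by (rule mcontactI)
     (use mcontactD(1)[OF assms] in \<open>auto intro!: same_derivs_sym[OF mcontactD(2)[OF assms]]\<close>)

lemma mcontact_trans:
  assumes "mcontact M E r x s s'" "mcontact M E r x s' s''"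
  shows "mcontact M E r x s s''"
proof (rule mcontactI)
  show "s x = s'' x" using mcontactD(1)[OF assms(1)] mcontactD(1)[OF assms(2)] by simp
  fix c d assume *: "c \<in> M" "x \<in> fst c" "d \<in> E" "s x \<in> fst d"
  then have "s' x \<in> fst d" using mcontactD(1)[OF assms(1)] by simp
  from same_derivs_trans[OF mcontactD(2)[OF assms(1) *] mcontactD(2)[OF assms(2) *(1-3) this]]
  show "same_derivs r (rep c d s) (\<lambda>y. snd d (s'' (chart_inv c y))) (snd c x)" .
qed

lemma mcontact_2_imp_1: "mcontact M E 2 x s s' \<Longrightarrow> mcontact M E 1 x s s'"
  unfolding mcontact_def same_derivs_1 same_derivs_2 by blast

lemma mcontact_1D:
  assumes "mcontact M E 1 x s s'" "c \<in> M" "x \<in> fst c" "d \<in> E" "s x \<in> fst d"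
  shows "dif (rep c d s) (snd c x) = dif (rep c d s') (snd c x)"
  using mcontactD(2)[OF assms] unfolding same_derivs_1 by auto

text \<open>
  By the chain rule the first derivatives in one pair of charts determine those in all others.
\<close>

lemma mcontact_1I:
  assumes s: "smooth_at M E s x" "smooth_at M E s' x" "s x = s' x" and c: "c \<in> M" "x \<in> fst c" "d \<in> E" "s x \<in> fst d"
    and eq: "dif (rep c d s) (snd c x) = dif (rep c d s') (snd c x)"
  shows "mcontact M E 1 x s s'"
  unfolding mcontact_def comp_eq same_derivs_1
proof (intro conjI ballI impI allI, fact, elim conjE)
  fix c' d' assume c': "c' \<in> M" "x \<in> fst c'" and d': "d' \<in> E" "s x \<in> fst d'"
  show "snd d' (s (chart_inv c' (snd c' x))) = snd d' (s' (chart_inv c' (snd c' x)))"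
    using chart_inv_works(1)[OF manifold_chart[OF M c'(1)] c'(2)] s(3) by simp
next
  fix c' d' w assume "x \<in> fst c' \<and> s x \<in> fst d'" and c'd': "c' \<in> M" "d' \<in> E"
  then have c': "c' \<in> M" "x \<in> fst c'" and d': "d' \<in> E" "s x \<in> fst d'" by auto
  have s': "s' x \<in> fst d" "s' x \<in> fst d'" using c d' s(3) by auto
  \<comment> \<open>the vector \<open>w\<close> in the chart \<open>c\<close>\<close>
  let ?w = "dif (transition c' c) (snd c' x) w"
  have w: "w = dif (transition c c') (snd c x) ?w" using dif_transition_surj[OF c(1,2) c'] by simp
  show "dif (rep c' d' s) (snd c' x) w = dif (rep c' d' s') (snd c' x) w"
    by (subst (1 2) w)
       (simp only: dif_rep_change[OF s(1) c(1,2) c' c(3,4) d'] dif_rep_change[OF s(2) c(1,2) c' c(3) s'(1) d'(1) s'(2)] eq s(3))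
qed

lemma mjet_eq_iff:
  assumes "smooth_at M E s x" "smooth_at M E s' x'"
  shows "mjet M E r s x = mjet M E r s' x' \<longleftrightarrow> x = x' \<and> mcontact M E r x s s'"
proof
  assume eq: "mjet M E r s x = mjet M E r s' x'"
  then have x: "x = x'" by (simp add: mjet_def)
  have "s' \<in> snd (mjet M E r s' x')" using assms mcontact_refl by (simp add: mjet_def)
  then show "x = x' \<and> mcontact M E r x s s'" unfolding eq[symmetric] using x by (simp add: mjet_def)
next
  assume "x = x' \<and> mcontact M E r x s s'"
  then show "mjet M E r s x = mjet M E r s' x'"
    unfolding mjet_def using mcontact_sym mcontact_trans by blast
qed

lemma fst_mjet [simp]: "fst (mjet M E r s x) = x"
  by (simp add: mjet_def)

lemma mjet_rep:
  assumes "smooth_at M E s x"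
  shows "smooth_at M E (mjet_rep (mjet M E r s x)) x" "mcontact M E r x s (mjet_rep (mjet M E r s x))"
    "mjet M E r (mjet_rep (mjet M E r s x)) x = mjet M E r s x"
proof -
  have "s \<in> snd (mjet M E r s x)" using assms mcontact_refl by (simp add: mjet_def)
  then have "mjet_rep (mjet M E r s x) \<in> snd (mjet M E r s x)" 
    unfolding mjet_rep_def by (rule someI[of "\<lambda>s'. s' \<in> snd (mjet M E r s x)" s])
  then show 1: "smooth_at M E (mjet_rep (mjet M E r s x)) x" and 2: "mcontact M E r x s (mjet_rep (mjet M E r s x))"
    by (auto simp: mjet_def)
  show "mjet M E r (mjet_rep (mjet M E r s x)) x = mjet M E r s x"
    using mjet_eq_iff[OF 1 assms] mcontact_sym[OF 2] by simp
qed

lemma mjet_proj_mjet_2: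
  assumes "smooth_at M E s x"
  shows "mjet_proj M E 1 (mjet M E 2 s x) = mjet M E 1 s x"
  unfolding mjet_proj_def fst_mjet
  using mjet_eq_iff[OF mjet_rep(1)[OF assms] assms, of 1 2]
    mcontact_sym[OF mcontact_2_imp_1[OF mjet_rep(2)[OF assms]]] by simp

lemma immersive_at_cong:
  assumes "mcontact M E 1 x s s'"
  shows "immersive_at M E s x \<longleftrightarrow> immersive_at M E s' x"
proof -
  obtain c0 where "c0 \<in> M \<and> x \<in> fst c0" using manifold_cover[OF M, of x] by blast
  then have c: "(SOME c. c \<in> M \<and> x \<in> fst c) \<in> M \<and> x \<in> fst (SOME c. c \<in> M \<and> x \<in> fst c)"
    by (rule someI)
  have "tangent_map M E s x = tangent_map M E s' x"
    unfolding tangent_map_def Let_def comp_eq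
    using mcontactD(1)[OF assms] mcontact_1D[OF assms] c by (intro ext) auto
  then show ?thesis by (simp add: immersive_at_def)
qed

lemma tangent_map_push:
  assumes s: "smooth_at M E s x" and c: "c \<in> M" "x \<in> fst c" and v: "v \<in> tangent_space M x"
  shows "tangent_map M E s x v = push E (\<lambda>y. s (chart_inv c y)) (snd c x) (v c)"
proof
  fix d
  define b where "b = (SOME c. c \<in> M \<and> x \<in> fst c)"
  have "b \<in> M \<and> x \<in> fst b" unfolding b_def by (rule someI) (use c in blast)
  then have b: "b \<in> M" "x \<in> fst b" by auto
  note ci = chart_inv_works(1)[OF manifold_chart[OF M c(1)] c(2)]
  show "tangent_map M E s x v d = push E (\<lambda>y. s (chart_inv c y)) (snd c x) (v c) d"
  proof (cases "d \<in> E \<and> s x \<in> fst d")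
    case True
    then have d: "d \<in> E" "s x \<in> fst d" by auto
    have "dif (rep b d s) (snd b x) (v b) = dif (rep c d s) (snd c x) (v c)"
      using dif_rep_change[OF s c b d d] tangent_vec_change[OF v c(1) b(1) c(2) b(2)] dif_transition_self[OF E d]
      by simp
    then show ?thesis using d ci by (simp add: tangent_map_def Let_def b_def[symmetric] push_def comp_eq)
  next
    case False
    then show ?thesis using ci by (auto simp: tangent_map_def push_def Let_def)
  qed
qed

lemma immersive_at_iff:
  assumes s: "smooth_at M E s x" and c: "c \<in> M" "x \<in> fst c"
  shows "immersive_at M E s x \<longleftrightarrow> inj (push E (\<lambda>y. s (chart_inv c y)) (snd c x))"
proof -
  let ?p = "push E (\<lambda>y. s (chart_inv c y)) (snd c x)"
  have "immersive_at M E s x \<longleftrightarrow> inj_on (\<lambda>v. ?p (v c)) (tangent_space M x)"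
    unfolding immersive_at_def by (rule inj_on_cong) (rule tangent_map_push[OF s c])
  also have "\<dots> \<longleftrightarrow> inj ?p"
  proof
    assume i: "inj_on (\<lambda>v. ?p (v c)) (tangent_space M x)"
    show "inj ?p"
    proof (rule injI)
      fix a b assume "?p a = ?p b"
      then have "tvec_of M c x a = tvec_of M c x b"
        using tvec_of_tangent[OF M c] tvec_of_same[OF M c] by (intro inj_onD[OF i]) auto
      then show "a = b" using tvec_of_same[OF M c] by metis
    qed
  next
    assume i: "inj ?p"
    show "inj_on (\<lambda>v. ?p (v c)) (tangent_space M x)"
    proof (rule inj_onI)
      fix v w assume v: "v \<in> tangent_space M x" "w \<in> tangent_space M x" "?p (v c) = ?p (w c)"
      then have "v c = w c" using i by (simp add: inj_eq)
      then show "v = w" by (rule tangent_space_eqI[OF v(1,2) c])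
    qed
  qed
  finally show ?thesis .
qed

lemma exists_local_map:
  assumes c: "c \<in> M" "x \<in> fst c" and d: "d \<in> E" "q \<in> fst d" and F: "smooth_on UNIV F" "F (snd c x) = snd d q"
  obtains s where "smooth_at M E s x" "s x = q"
    "dif (rep c d s) (snd c x) = dif F (snd c x)"
    "\<And>a b. dif2 (rep c d s) (snd c x) a b = dif2 F (snd c x) a b"
proof -
  note tc = manifold_chart[OF M c(1)] and td = manifold_chart[OF E d(1)]
  define \<Omega> where "\<Omega> = snd c ` fst c \<inter> F -` (snd d ` fst d)"
  define s where "s p = chart_inv d (F (snd c p))" for p
  have o: "open \<Omega>" unfolding \<Omega>_def
    by (rule continuous_open_preimage[OF smooth_on_continuous[OF smooth_on_subset[OF F(1) subset_UNIV]] chart_open(2)[OF tc] chart_open(2)[OF td]])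
  have into: "smooth_into E \<Omega> (\<lambda>y. chart_inv d (F y))"
    by (rule smooth_into_chartI[OF E d(1) o smooth_on_subset[OF F(1) subset_UNIV]]) (auto simp: \<Omega>_def)
  have x: "snd c x \<in> \<Omega>" using c d F by (auto simp: \<Omega>_def)
  have sub: "\<Omega> \<subseteq> snd c ` fst c" by (auto simp: \<Omega>_def)
  note sm = smooth_map_onI[OF c(1) o sub into, of s, unfolded s_def, OF refl, folded s_def]
  have "x \<in> chart_inv c ` \<Omega>" using x chart_inv_works(1)[OF tc c(2)] by (intro image_eqI[of _ _ "snd c x"]) auto
  then have sa: "smooth_at M E s x" using sm unfolding smooth_at_def by blast
  have eq: "snd d (s (chart_inv c y)) = F y" if "y \<in> \<Omega>" for y
    using that chart_inv_works[OF tc] chart_inv_works[OF td] by (auto simp: s_def \<Omega>_def)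
  have 1: "dif (rep c d s) y = dif F y" if "y \<in> \<Omega>" for y
    by (rule dif_cong_open[OF o that eq])
  have 2: "dif2 (rep c d s) (snd c x) a b = dif2 F (snd c x) a b" for a b
    by (rule arg_cong[where f="\<lambda>f. f a"], rule dif_cong_open[OF o x]) (simp add: 1)
  have "s x = q" using F(2) chart_inv_works(1)[OF td d(2)] by (simp add: s_def)
  then show ?thesis using that[OF sa _ 1[OF x] 2] by blast
qed

text \<open>
  Affine maps represent all points of a chart of first order jets.
\<close>

lemma exists_affine_map:
  assumes c: "c \<in> M" "x \<in> fst c" and d: "d \<in> E" "q \<in> fst d"
  obtains s where "smooth_at M E s x" "s x = q" "matrix (dif (rep c d s) (snd c x)) = u"
proof -
  define F where "F y = (snd d q - u *v snd c x) + u *v y" for y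
  have sm: "smooth_on UNIV F" unfolding F_def
    by (intro smooth_on_add smooth_on_const smooth_on_linear open_UNIV matrix_vector_mul_linear)
  have D: "dif F y = (*v) u" for y unfolding F_def
    by (rule dif_eqI) (auto intro!: derivative_eq_intros bounded_linear.has_derivative[OF matrix_vector_mul_bounded_linear])
  have F0: "F (snd c x) = snd d q" by (simp add: F_def)
  obtain s where s: "smooth_at M E s x" "s x = q" "dif (rep c d s) (snd c x) = dif F (snd c x)"
    by (rule exists_local_map[OF c d sm F0]) (rule that; assumption)
  show ?thesis by (rule that[OF s(1,2)]) (simp add: s(3) D matrix_of_matrix_vector_mul)
qed

section \<open>The charts of first order jets of maps\<close>

lemma mjet1_chart_dom:
  assumes "smooth_at M E s x"
  shows "mjet M E 1 s x \<in> fst (mjet1_chart M E c d) \<longleftrightarrow> x \<in> fst c \<and> s x \<in> fst d"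
proof
  assume "mjet M E 1 s x \<in> fst (mjet1_chart M E c d)"
  then obtain s' x' where s': "mjet M E 1 s x = mjet M E 1 s' x'" "smooth_at M E s' x'" "x' \<in> fst c" "s' x' \<in> fst d"
    unfolding mjet1_chart_def by auto
  then have "x = x'" "mcontact M E 1 x s s'" using mjet_eq_iff[OF assms s'(2)] by auto
  then show "x \<in> fst c \<and> s x \<in> fst d" using s' mcontactD(1) by metis
next
  assume "x \<in> fst c \<and> s x \<in> fst d"
  then show "mjet M E 1 s x \<in> fst (mjet1_chart M E c d)" unfolding mjet1_chart_def using assms by auto
qed

text \<open>
  The coordinates are computed from a chosen representative, which may be replaced by \<open>s\<close>.
\<close>

lemma mjet1_chart_val:
  assumes s: "smooth_at M E s x" and c: "c \<in> M" "x \<in> fst c" and d: "d \<in> E" "s x \<in> fst d"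
  shows "snd (mjet1_chart M E c d) (mjet M E 1 s x)
    = (snd c x, snd d (s x), matrix (dif (rep c d s) (snd c x)))"
proof -
  note r = mjet_rep[OF s, of 1]
  have "dif (rep c d s) (snd c x)
      = dif (\<lambda>y. snd d (mjet_rep (mjet M E 1 s x) (chart_inv c y))) (snd c x)"
    by (rule mcontact_1D[OF r(2) c d])
  moreover have "s x = mjet_rep (mjet M E 1 s x) x" by (rule mcontactD(1)[OF r(2)])
  ultimately show ?thesis
    unfolding mjet1_chart_def snd_conv Let_def fst_mjet comp_eq by (simp only: matrix_def)
qed

lemma mjet1_chart_inj:
  assumes c: "c \<in> M" and d: "d \<in> E"
  shows "inj_on (snd (mjet1_chart M E c d)) (fst (mjet1_chart M E c d))"
proof (rule inj_onI)
  fix \<theta> \<theta>' assume "\<theta> \<in> fst (mjet1_chart M E c d)" "\<theta>' \<in> fst (mjet1_chart M E c d)"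
    and eq: "snd (mjet1_chart M E c d) \<theta> = snd (mjet1_chart M E c d) \<theta>'"
  then obtain s x s' x' where 1: "\<theta> = mjet M E 1 s x" "smooth_at M E s x" "x \<in> fst c" "s x \<in> fst d"
    and 2: "\<theta>' = mjet M E 1 s' x'" "smooth_at M E s' x'" "x' \<in> fst c" "s' x' \<in> fst d"
    unfolding mjet1_chart_def by auto
  have e: "snd c x = snd c x'" "snd d (s x) = snd d (s' x')"
    "matrix (dif (rep c d s) (snd c x)) = matrix (dif (rep c d s') (snd c x'))"
    using eq mjet1_chart_val[OF 1(2) c 1(3) d 1(4)] mjet1_chart_val[OF 2(2) c 2(3) d 2(4)] 1(1) 2(1) by auto
  have x: "x = x'" using e(1) inj_onD[OF chart_inj[OF manifold_chart[OF M c]]] 1(3) 2(3) by blast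
  have sx: "s x = s' x" using e(2) inj_onD[OF chart_inj[OF manifold_chart[OF E d]]] 1(4) 2(4) x by blast
  have "smooth_at M E s' x" using 2 x by simp
  moreover have "dif (rep c d s) (snd c x) = dif (rep c d s') (snd c x)"
  proof
    fix w
    have "smooth_at M E s' x" "s' x \<in> fst d" using 2 x by simp_all
    then show "dif (rep c d s) (snd c x) w = dif (rep c d s') (snd c x) w"
      using e(3) x matrix_dif_works[OF rep_differentiable[OF 1(2) c 1(3) d 1(4)], of w]
        matrix_dif_works[OF rep_differentiable[of s', OF _ c 1(3) d], of w] by simp
  qed
  ultimately have "mcontact M E 1 x s s'" 
    using mcontact_1I[of s x s' c d] 1(2-4) sx c d by blast
  then show "\<theta> = \<theta>'" unfolding 1(1) 2(1) using mjet_eq_iff[OF 1(2) 2(2)] x by simp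
qed

lemma mjet1_chart_inv:
  assumes s: "smooth_at M E s x" and c: "c \<in> M" "x \<in> fst c" and d: "d \<in> E" "s x \<in> fst d"
  shows "chart_inv (mjet1_chart M E c d)
     (snd c x, snd d (s x), matrix (dif (rep c d s) (snd c x))) = mjet M E 1 s x"
  unfolding chart_inv_def[of "mjet1_chart M E c d"]
  by (rule inv_into_f_eq[OF mjet1_chart_inj[OF c(1) d(1)]])
     (use mjet1_chart_dom[OF s] mjet1_chart_val[OF s c d] c d in auto)

lemma smooth_into_mjet_lift:
  assumes s: "smooth_map_on M E U s" and U: "open U" and c: "c \<in> M"
  shows "smooth_into (mjet1_atlas M E) (snd c ` (U \<inter> fst c)) (\<lambda>y. mjet M E 1 s (chart_inv c y))"
  unfolding smooth_into_def
proof (intro ballI)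
  fix C assume "C \<in> mjet1_atlas M E"
  then obtain b d where b: "b \<in> M" and d: "d \<in> E" and C: "C = mjet1_chart M E b d"
    unfolding mjet1_atlas_def by auto
  note tc = manifold_chart[OF M c] and tb = manifold_chart[OF M b]
  let ?\<Omega> = "snd c ` (U \<inter> fst c)" and ?P = "\<lambda>y. mjet M E 1 s (chart_inv c y)"
  have sa: "smooth_at M E s q" if "q \<in> U" for q using s U that unfolding smooth_at_def by blast
  let ?O = "snd c ` ({q \<in> U. q \<in> fst b \<and> s q \<in> fst d} \<inter> fst c)"
  have "?P (snd c q) \<in> fst C \<longleftrightarrow> q \<in> fst b \<and> s q \<in> fst d" if "q \<in> U" "q \<in> fst c" for q
    using chart_inv_works(1)[OF tc that(2)] mjet1_chart_dom[OF sa[OF that(1)], of b d] unfolding C by simp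
  then have eq: "{y \<in> ?\<Omega>. ?P y \<in> fst C} = ?O" by blast
  let ?B = "{y \<in> snd b ` (U \<inter> fst b). s (chart_inv b y) \<in> fst d}"
  note B = smooth_intoD[OF smooth_map_on_into[OF s b] d]
  have "chart_inv b ` ?B = {q \<in> U. q \<in> fst b \<and> s q \<in> fst d}"
  proof (intro equalityI subsetI)
    fix q assume "q \<in> {q \<in> U. q \<in> fst b \<and> s q \<in> fst d}"
    then show "q \<in> chart_inv b ` ?B" using chart_inv_works(1)[OF tb] by (intro image_eqI[of _ _ "snd b q"]) auto
  qed (use chart_inv_works(1)[OF tb] in auto)
  then have oW: "open {q \<in> U. q \<in> fst b \<and> s q \<in> fst d}"
    using open_chart_inv_image[OF tb B(1)] by auto
  have o: "open ?O" by (rule open_chart_image'[OF c oW])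
  have tr: "smooth_on ?O (transition c b)"
    by (rule smooth_on_subset[OF smooth_transition[OF M c b]]) auto
  have trB: "transition c b ` ?O \<subseteq> ?B"
    using chart_inv_works(1)[OF tc] chart_inv_works(1)[OF tb] by (auto simp: transition_apply)
  have 2: "smooth_on ?O (\<lambda>y. snd d (s (chart_inv b (transition c b y))))"
    by (rule smooth_on_compose[OF B(2) tr o B(1) trB])
  have 3: "smooth_on ?O (\<lambda>y. matrix (dif (rep b d s) (transition c b y)))"
    by (rule smooth_on_compose[OF smooth_on_matrix_dif[OF B] tr o B(1) trB])
  have "smooth_on ?O (\<lambda>y. (transition c b y, snd d (s (chart_inv b (transition c b y))),
      matrix (dif (rep b d s) (transition c b y))))"
    by (intro smooth_on_Pair o tr 2 3)
  then have "smooth_on ?O (\<lambda>y. snd C (?P y))"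
  proof (rule smooth_on_cong[OF o, rotated])
    fix y assume "y \<in> ?O"
    then obtain q where q: "q \<in> U" "q \<in> fst b" "s q \<in> fst d" "q \<in> fst c" "y = snd c q" by blast
    show "(transition c b y, snd d (s (chart_inv b (transition c b y))),
      matrix (dif (rep b d s) (transition c b y))) = snd C (?P y)"
      using mjet1_chart_val[OF sa[OF q(1)] b q(2) d q(3)] q chart_inv_works(1)[OF tc] chart_inv_works(1)[OF tb]
      by (simp add: C transition_apply)
  qed
  then show "open {y \<in> ?\<Omega>. ?P y \<in> fst C} \<and> smooth_on {y \<in> ?\<Omega>. ?P y \<in> fst C} (\<lambda>y. snd C (?P y))"
    unfolding eq using o by blast
qed

text \<open>
  Here the left inverse is the projection to the coordinates of \<open>M\<close>.
\<close>

theorem tangent_to_mjet_prolongation: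
  assumes s: "smooth_map_on M E U s" and U: "open U" and x: "x \<in> U" and c: "c \<in> M" "x \<in> fst c"
  shows "tangent_to (mjet1_atlas M E) {mjet M E 1 s y | y. smooth_at M E s y} (mjet M E 1 s x)
      = range (push (mjet1_atlas M E) (\<lambda>y. mjet M E 1 s (chart_inv c y)) (snd c x))" (is "?A = ?B")
    and "inj (push (mjet1_atlas M E) (\<lambda>y. mjet M E 1 s (chart_inv c y)) (snd c x))"
proof -
  note tc = manifold_chart[OF M c(1)]
  let ?P = "\<lambda>y. mjet M E 1 s (chart_inv c y)" and ?\<Omega> = "snd c ` (U \<inter> fst c)"
  let ?N = "{mjet M E 1 s y | y. smooth_at M E s y}"
  have sa: "smooth_at M E s q" if "q \<in> U" for q using s U that unfolding smooth_at_def by blast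
  obtain d where d: "d \<in> E" "s x \<in> fst d" using manifold_cover[OF E] by blast
  let ?C = "mjet1_chart M E c d"
  have Px: "?P (snd c x) = mjet M E 1 s x" using chart_inv_works(1)[OF tc c(2)] by simp
  have val: "y \<in> fst c" "s y \<in> fst d" "fst (snd ?C (mjet M E 1 s y)) = snd c y"
    if "smooth_at M E s y" "mjet M E 1 s y \<in> fst ?C" for y
    using mjet1_chart_dom[OF that(1)] mjet1_chart_val[OF that(1) c(1) _ d(1)] that(2) by auto
  have o: "open ?\<Omega>" by (rule open_chart_image'[OF c(1) U])
  have x0: "snd c x \<in> ?\<Omega>" using x c by blast
  have C: "?C \<in> mjet1_atlas M E" "?P (snd c x) \<in> fst ?C"
    unfolding mjet1_atlas_def Px mjet1_chart_dom[OF sa[OF x]] using c d by blast+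
  have W: "open (?\<Omega> \<times> UNIV)" "snd ?C (?P (snd c x)) \<in> ?\<Omega> \<times> UNIV"
    using o x0 mjet1_chart_val[OF sa[OF x] c d] Px by (auto intro: open_Times)
  have N: "?P ` ?\<Omega> \<subseteq> ?N" using chart_inv_works(1)[OF tc] sa by auto
  have h: "fst differentiable (at (snd ?C (?P (snd c x))))" by (rule linear_imp_differentiable[OF linear_fst])
  have inv: "fst (snd ?C q) \<in> ?\<Omega> \<and> ?P (fst (snd ?C q)) = q"
    if q: "q \<in> ?N" "q \<in> fst ?C" "snd ?C q \<in> ?\<Omega> \<times> UNIV" for q
  proof -
    obtain y where y: "q = mjet M E 1 s y" "smooth_at M E s y" using q(1) by blast
    then show ?thesis using val[OF y(2)] q chart_inv_works(1)[OF tc] by (auto simp: mem_Times_iff)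
  qed
  have left: "fst (snd ?C (?P y)) = y" if y: "y \<in> ?\<Omega>" "?P y \<in> fst ?C" for y
  proof -
    obtain q where q: "q \<in> U" "q \<in> fst c" "y = snd c q" using y by blast
    then show ?thesis using val[OF sa[OF q(1)]] y(2) chart_inv_works(1)[OF tc] by simp
  qed
  note P = smooth_into_mjet_lift[OF s U c(1)]
  show "?A = ?B" using tangent_to_param(1)[OF o x0 P N C W h inv left] unfolding Px by blast
  show "inj (push (mjet1_atlas M E) ?P (snd c x))" by (rule tangent_to_param(2)[OF o x0 P N C W h inv left])
qed

section \<open>The parametrized equation\<close>

text \<open>
  The left hand side of the parametrized equation, that is the covariant derivative of the differential of \<open>s\<close>.
\<close>

definition hess :: "('x, real^'n) connection \<Rightarrow> ('e, real^'k) connection \<Rightarrow> ('x, real^'n) chart \<Rightarrow> ('e, real^'k) chart \<Rightarrow>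
    ('x \<Rightarrow> 'e) \<Rightarrow> 'x \<Rightarrow> real^'n \<Rightarrow> real^'n \<Rightarrow> real^'k" where
  "hess \<Theta> \<Gamma> c d s x a b =
     (let F = rep c d s; D = dif F (snd c x)
      in dif2 F (snd c x) a b + gam E \<Gamma> d (s x) (D a) (D b) - D (gam M \<Theta> c x a b))"

lemma bilinear_gam:
  assumes "linear f" "linear g"
  shows "bilinear (\<lambda>a b. gam A \<Gamma> c p (f a) (g b))"
  unfolding bilinear_def
  using linear_compose[OF assms(1) linear_gam_left[of A \<Gamma> c p], unfolded o_def]
    linear_compose[OF assms(2) linear_gam_right[of A \<Gamma> c p], unfolded o_def] by blast

lemma bilinear_combine:
  assumes "bilinear f"
  shows "linear h \<Longrightarrow> bilinear (\<lambda>a b. h (f a b))"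
    and "bilinear g \<Longrightarrow> bilinear (\<lambda>a b. f a b + g a b)"
    and "bilinear g \<Longrightarrow> bilinear (\<lambda>a b. f a b - g a b)"
proof -
  show "bilinear (\<lambda>a b. h (f a b))" if h: "linear h"
    unfolding bilinear_def
  proof (intro conjI allI)
    show "linear (\<lambda>b. h (f a b))" for a
      using linear_compose[of "f a", OF _ h] assms by (simp add: bilinear_def o_def)
    show "linear (\<lambda>a. h (f a b))" for b
      using linear_compose[of "\<lambda>a. f a b", OF _ h] assms by (simp add: bilinear_def o_def)
  qed
qed (use assms in \<open>auto simp: bilinear_def intro!: linear_compose_add linear_compose_sub\<close>)

lemma bilinear_hess:
  assumes "smooth_at M E s x" "c \<in> M" "x \<in> fst c" "d \<in> E" "s x \<in> fst d"
  shows "bilinear (hess \<Theta> \<Gamma> c d s x)"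
proof -
  obtain S where S: "open S" "snd c x \<in> S" "smooth_on S (rep c d s)"
    by (rule smooth_at_rep[OF assms]) (rule that; assumption)
  let ?D = "dif (rep c d s) (snd c x)"
  have D: "linear ?D" by (rule linear_dif[OF rep_differentiable[OF assms]])
  have b: "bilinear (dif2 (rep c d s) (snd c x))"
    unfolding bilinear_def using linear_dif2_left[OF S(3,2)] linear_dif2_right[OF S(1,3,2)] by blast
  have "hess \<Theta> \<Gamma> c d s x = (\<lambda>a b. dif2 (rep c d s) (snd c x) a b
      + gam E \<Gamma> d (s x) (?D a) (?D b) - ?D (gam M \<Theta> c x a b))"
    by (simp add: fun_eq_iff hess_def Let_def)
  then show ?thesis
    using bilinear_combine(3)[OF bilinear_combine(2)[OF b bilinear_gam[OF D D]]
        bilinear_combine(1)[OF bilinear_gam[OF linear_ident linear_ident] D]] by simp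
qed

text \<open>
  The second derivatives of the transition maps that come from \<open>s\<close> cancel those that come from the Christoffel
  symbols of \<open>\<Gamma>\<close> and \<open>\<Theta>\<close>, so that \<open>hess\<close> is a tensor.
\<close>

lemma hess_change:
  assumes \<Theta>: "linear_connection M \<Theta>" and \<Gamma>: "linear_connection E \<Gamma>"
    and s: "smooth_at M E s x" and c: "c \<in> M" "x \<in> fst c" "c' \<in> M" "x \<in> fst c'"
    and d: "d \<in> E" "s x \<in> fst d" "d' \<in> E" "s x \<in> fst d'"
  shows "hess \<Theta> \<Gamma> c' d' s x (dif (transition c c') (snd c x) a) (dif (transition c c') (snd c x) b)
    = dif (transition d d') (snd d (s x)) (hess \<Theta> \<Gamma> c d s x a b)"
proof -
  let ?F = "rep c d s" and ?F' = "rep c' d' s"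
  let ?\<psi> = "transition c c'" and ?\<phi> = "transition d d'"
  let ?D\<psi> = "dif ?\<psi> (snd c x)" and ?D\<phi> = "dif ?\<phi> (snd d (s x))" and ?DF = "dif ?F (snd c x)" and ?DF' = "dif ?F' (snd c' x)"
  obtain S where S: "open S" "snd c x \<in> S" "S \<subseteq> snd c ` (fst c \<inter> fst c')"
    "\<And>y. y \<in> S \<Longrightarrow> ?F' (?\<psi> y) = ?\<phi> (?F y)"
    by (rule rep_change[OF s c d]) (rule that; assumption)
  obtain S1 where S1: "open S1" "snd c x \<in> S1" "S1 \<subseteq> snd c ` fst c" "smooth_on S1 ?F"
    by (rule smooth_at_rep[OF s c(1,2) d(1,2)]) (rule that; assumption)
  obtain S2 where S2: "open S2" "snd c' x \<in> S2" "S2 \<subseteq> snd c' ` fst c'" "smooth_on S2 ?F'"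
    by (rule smooth_at_rep[OF s c(3,4) d(3,4)]) (rule that; assumption)
  have tx: "?\<psi> (snd c x) = snd c' x" by (rule transition_snd[OF manifold_chart[OF M c(1)] c(2)])
  have Fx: "?F (snd c x) = snd d (s x)" using chart_inv_works(1)[OF manifold_chart[OF M c(1)] c(2)] by simp
  have e1: "dif (\<lambda>y. ?F' (?\<psi> y)) y b = dif (\<lambda>y. ?\<phi> (?F y)) y b" if "y \<in> S" for y
    by (rule arg_cong[where f="\<lambda>f. f b"], rule dif_cong_open[OF S(1) that S(4)])
  have e: "dif2 (\<lambda>y. ?F' (?\<psi> y)) (snd c x) a b = dif2 (\<lambda>y. ?\<phi> (?F y)) (snd c x) a b"
    by (rule arg_cong[where f="\<lambda>f. f a"], rule dif_cong_open[OF S(1,2) e1])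
  have "dif2 (\<lambda>y. ?F' (?\<psi> y)) (snd c x) a b = dif2 ?F' (?\<psi> (snd c x)) (?D\<psi> a) (?D\<psi> b) + dif ?F' (?\<psi> (snd c x)) (dif2 ?\<psi> (snd c x) a b)"
    by (rule dif2_compose[where g="?F'" and f="?\<psi>", OF S2(1,4) _ open_overlap[OF M c(1,3)] smooth_transition[OF M c(1,3)]])
       (use tx S2(2) c in auto)
  then have 1: "dif2 (\<lambda>y. ?F' (?\<psi> y)) (snd c x) a b = dif2 ?F' (snd c' x) (?D\<psi> a) (?D\<psi> b) + ?DF' (dif2 ?\<psi> (snd c x) a b)"
    unfolding tx .
  have "dif2 (\<lambda>y. ?\<phi> (?F y)) (snd c x) a b = dif2 ?\<phi> (?F (snd c x)) (?DF a) (?DF b) + dif ?\<phi> (?F (snd c x)) (dif2 ?F (snd c x) a b)"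
    by (rule dif2_compose[where g="?\<phi>" and f="?F", OF open_overlap[OF E d(1,3)] smooth_transition[OF E d(1,3)] _ S1(1,4,2)])
       (use Fx d in auto)
  then have 2: "dif2 (\<lambda>y. ?\<phi> (?F y)) (snd c x) a b = dif2 ?\<phi> (snd d (s x)) (?DF a) (?DF b) + ?D\<phi> (dif2 ?F (snd c x) a b)"
    unfolding Fx .
  note 3 = gam_transition[OF M \<Theta> c, of a b] and 4 = gam_transition[OF E \<Gamma> d, of "?DF a" "?DF b"]
  have 5: "?DF' (?D\<psi> w) = ?D\<phi> (?DF w)" for w by (rule dif_rep_change[OF s c d])
  have l: "linear ?DF'" "linear ?D\<phi>"
    by (rule linear_dif[OF rep_differentiable[OF s c(3,4) d(3,4)]])
       (rule linear_dif[OF transition_differentiable[OF E d(1,3,2,4)]])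
  have "?D\<phi> (?DF (gam M \<Theta> c x a b)) = ?DF' (dif2 ?\<psi> (snd c x) a b) + ?DF' (gam M \<Theta> c' x (?D\<psi> a) (?D\<psi> b))"
    unfolding 5[symmetric] 3 by (rule linear_add[OF l(1)])
  then show ?thesis
    unfolding hess_def Let_def linear_add[OF l(2)] linear_diff[OF l(2)] 4 5
    using e unfolding 1 2 by (simp add: algebra_simps)
qed

definition param_geodesic_at :: "('x, real^'n) connection \<Rightarrow> ('e, real^'k) connection \<Rightarrow> ('x \<Rightarrow> 'e) \<Rightarrow> 'x \<Rightarrow> bool" where
  "param_geodesic_at \<Theta> \<Gamma> s x \<longleftrightarrow>
     (\<forall>c\<in>M. \<forall>d\<in>E. x \<in> fst c \<and> s x \<in> fst d \<longrightarrow> (\<forall>a b. hess \<Theta> \<Gamma> c d s x a b = 0))"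

lemma param_geodesic_atI:
  assumes \<Theta>: "linear_connection M \<Theta>" and \<Gamma>: "linear_connection E \<Gamma>"
    and s: "smooth_at M E s x" and c: "c \<in> M" "x \<in> fst c" and d: "d \<in> E" "s x \<in> fst d"
    and h: "\<And>a b. hess \<Theta> \<Gamma> c d s x a b = 0"
  shows "param_geodesic_at \<Theta> \<Gamma> s x"
  unfolding param_geodesic_at_def
proof (intro ballI allI impI, elim conjE)
  fix c' d' a b assume c': "c' \<in> M" "x \<in> fst c'" and d': "d' \<in> E" "s x \<in> fst d'"
  note w = dif_transition_surj[OF c c']
  have "hess \<Theta> \<Gamma> c' d' s x a b = dif (transition d d') (snd d (s x)) 0"
    using hess_change[OF \<Theta> \<Gamma> s c c' d d', of "dif (transition c' c) (snd c' x) a" "dif (transition c' c) (snd c' x) b"]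
    unfolding w h .
  also have "\<dots> = 0" by (rule linear_0[OF linear_dif[OF transition_differentiable[OF E d(1) d'(1) d(2) d'(2)]]])
  finally show "hess \<Theta> \<Gamma> c' d' s x a b = 0" .
qed

lemma Basis_axis: "(b :: real^'j) \<in> Basis \<longleftrightarrow> (\<exists>i. b = axis i 1)"
  by (auto simp: Basis_vec_def)

text \<open>
  The components of the equation are the values of a bilinear map on basis vectors.
\<close>

lemma geod_eq_param_iff:
  "geod_eq_param M E \<Theta> \<Gamma> = {mjet M E 2 s x | s x. smooth_at M E s x \<and> immersive_at M E s x \<and> param_geodesic_at \<Theta> \<Gamma> s x}"
proof -
  have "(\<forall>C \<xi> \<mu>.
          dif (\<lambda>y. dif (rep c d s) y (axis \<mu> 1)) (snd c x) (axis \<xi> 1) $ C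
          + (\<Sum>A\<in>UNIV. \<Sum>B\<in>UNIV. christoffel E \<Gamma> d (s x) A C B * dif (rep c d s) (snd c x) (axis \<xi> 1) $ A
                * dif (rep c d s) (snd c x) (axis \<mu> 1) $ B)
          - (\<Sum>\<eta>\<in>UNIV. christoffel M \<Theta> c x \<xi> \<eta> \<mu> * dif (rep c d s) (snd c x) (axis \<eta> 1) $ C) = 0)
      \<longleftrightarrow> (\<forall>a b. hess \<Theta> \<Gamma> c d s x a b = 0)" (is "?L \<longleftrightarrow> ?R")
    if s: "smooth_at M E s x" and c: "c \<in> M" "x \<in> fst c" and d: "d \<in> E" "s x \<in> fst d" for s x c d
  proof -
    let ?D = "dif (rep c d s) (snd c x)"
    have D: "linear ?D" by (rule linear_dif[OF rep_differentiable[OF s c d]])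
    have g: "gam M \<Theta> c x (axis \<xi> 1) (axis \<mu> 1) $ \<eta> = christoffel M \<Theta> c x \<xi> \<eta> \<mu>" for \<xi> \<eta> \<mu>
    proof -
      have "gam M \<Theta> c x (axis \<xi> 1) (axis \<mu> 1) $ \<eta>
          = (\<Sum>I\<in>UNIV. (\<Sum>J\<in>UNIV. christoffel M \<Theta> c x I \<eta> J * axis \<mu> 1 $ J) * axis \<xi> 1 $ I)"
        by (simp add: gam_def sum_distrib_left sum_distrib_right mult_ac)
      then show ?thesis by (simp only: sum_axis)
    qed
    have Dz: "?D z = (\<Sum>\<eta>\<in>UNIV. (z $ \<eta>) *\<^sub>R ?D (axis \<eta> 1))" for z
    proof -
      have "z = (\<Sum>\<eta>\<in>UNIV. (z $ \<eta>) *\<^sub>R axis \<eta> 1)"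
        by (simp add: vec_eq_iff axis_def if_distrib cong: if_cong)
      then have "?D z = ?D (\<Sum>\<eta>\<in>UNIV. (z $ \<eta>) *\<^sub>R axis \<eta> 1)" by simp
      also have "\<dots> = (\<Sum>\<eta>\<in>UNIV. (z $ \<eta>) *\<^sub>R ?D (axis \<eta> 1))" by (simp add: linear_sum[OF D] linear_cmul[OF D])
      finally show ?thesis .
    qed
    have Dg: "?D (gam M \<Theta> c x (axis \<xi> 1) (axis \<mu> 1)) $ C = (\<Sum>\<eta>\<in>UNIV. christoffel M \<Theta> c x \<xi> \<eta> \<mu> * ?D (axis \<eta> 1) $ C)" for \<xi> \<mu> C
      by (subst Dz) (simp add: g)
    have "?L \<longleftrightarrow> (\<forall>C \<xi> \<mu>. hess \<Theta> \<Gamma> c d s x (axis \<xi> 1) (axis \<mu> 1) $ C = 0)"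
      unfolding hess_def Let_def vector_add_component vector_minus_component Dg by (simp add: gam_def)
    also have "\<dots> \<longleftrightarrow> (\<forall>\<xi> \<mu>. hess \<Theta> \<Gamma> c d s x (axis \<xi> 1) (axis \<mu> 1) = 0)" by (auto simp: vec_eq_iff)
    also have "\<dots> \<longleftrightarrow> ?R"
    proof
      assume z: "\<forall>\<xi> \<mu>. hess \<Theta> \<Gamma> c d s x (axis \<xi> 1) (axis \<mu> 1) = 0"
      have "hess \<Theta> \<Gamma> c d s x = (\<lambda>a b. 0)"
        by (rule bilinear_eq_stdbasis[OF bilinear_hess[OF s c d]])
           (use z in \<open>auto simp: Basis_axis bilinear_def linear_zero simp del: One_nat_def\<close>)
      then show ?R by simp
    qed blast
    finally show ?thesis .
  qed
  note eq = this
  show ?thesis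
    unfolding geod_eq_param_def Let_def comp_eq param_geodesic_at_def
    by (rule Collect_cong, rule ex_cong1, rule ex_cong1, rule conj_cong[OF refl], rule conj_cong[OF refl],
      rule conj_cong[OF refl], rule ball_cong[OF refl], rule ball_cong[OF refl], rule imp_cong[OF refl], elim conjE)
      (rule eq; assumption)
qed

lemma param_geodesic_at_cong:
  assumes "mcontact M E 2 x s s'" "param_geodesic_at \<Theta> \<Gamma> s x"
  shows "param_geodesic_at \<Theta> \<Gamma> s' x"
  unfolding param_geodesic_at_def
proof (intro ballI allI impI, elim conjE)
  fix c d a b assume c: "c \<in> M" "x \<in> fst c" and d: "d \<in> E" "s' x \<in> fst d"
  have sx: "s x = s' x" using mcontactD(1)[OF assms(1)] .
  have sd: "same_derivs 2 (rep c d s) (rep c d s') (snd c x)"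
    using mcontactD(2)[OF assms(1) c d(1)] d(2) sx by simp
  then have "hess \<Theta> \<Gamma> c d s x a b = hess \<Theta> \<Gamma> c d s' x a b"
    unfolding hess_def Let_def same_derivs_2 by (simp add: sx)
  then show "hess \<Theta> \<Gamma> c d s' x a b = 0"
    using assms(2) c d sx unfolding param_geodesic_at_def by metis
qed

text \<open>
  The equation prescribes the second derivatives by a symmetric bilinear map of the first order jet. It is solved in
  one pair of charts.
\<close>

lemma exists_param_geodesic_jet:
  assumes \<Theta>: "linear_connection M \<Theta>" "torsion_free M \<Theta>" and \<Gamma>: "linear_connection E \<Gamma>" "torsion_free E \<Gamma>"
    and s: "smooth_at M E s x"
  obtains s' where "smooth_at M E s' x" "mcontact M E 1 x s s'" "param_geodesic_at \<Theta> \<Gamma> s' x"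
proof -
  obtain c where c: "c \<in> M" "x \<in> fst c" using manifold_cover[OF M] by blast
  obtain d where d: "d \<in> E" "s x \<in> fst d" using manifold_cover[OF E] by blast
  let ?D = "dif (rep c d s) (snd c x)"
  have D: "linear ?D" by (rule linear_dif[OF rep_differentiable[OF s c d]])
  define Q where "Q a b = ?D (gam M \<Theta> c x a b) - gam E \<Gamma> d (s x) (?D a) (?D b)" for a b
  have Q: "bilinear Q" unfolding Q_def
    by (rule bilinear_combine(3)[OF bilinear_combine(1)[OF bilinear_gam[OF linear_ident linear_ident] D] bilinear_gam[OF D D]])
  have sym: "Q a b = Q b a" for a b
    unfolding Q_def using gam_sym[OF M \<Theta> c] gam_sym[OF E \<Gamma> d] by metis
  obtain F where F: "smooth_on UNIV F" "F (snd c x) = snd d (s x)" "dif F (snd c x) = ?D" "\<And>a b. dif2 F (snd c x) a b = Q a b"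
    by (rule quadratic_polynomial[OF D Q sym]) (rule that; assumption)
  obtain s' where s': "smooth_at M E s' x" "s' x = s x" "dif (rep c d s') (snd c x) = dif F (snd c x)"
    "\<And>a b. dif2 (rep c d s') (snd c x) a b = dif2 F (snd c x) a b"
    by (rule exists_local_map[OF c d F(1,2)]) (rule that; assumption)
  have d': "s' x \<in> fst d" using s'(2) d by simp
  have "mcontact M E 1 x s s'" by (rule mcontact_1I[OF s s'(1) _ c d]) (use s' F in simp_all)
  moreover have "param_geodesic_at \<Theta> \<Gamma> s' x"
    by (rule param_geodesic_atI[OF \<Theta>(1) \<Gamma>(1) s'(1) c d(1) d'])
       (simp add: hess_def Let_def s' F Q_def)
  ultimately show ?thesis using that s'(1) by blast
qed

lemma param_geodesic_unique:
  assumes "mcontact M E 1 x s s'" "param_geodesic_at \<Theta> \<Gamma> s x" "param_geodesic_at \<Theta> \<Gamma> s' x"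
  shows "mcontact M E 2 x s s'"
  unfolding mcontact_def comp_eq same_derivs_2
proof (intro conjI ballI impI allI)
  show sx: "s x = s' x" by (rule mcontactD(1)[OF assms(1)])
  fix c d v w assume c: "c \<in> M" and d: "d \<in> E" and xd: "x \<in> fst c \<and> s x \<in> fst d"
  have D: "dif (rep c d s) (snd c x) = dif (rep c d s') (snd c x)"
    by (rule mcontact_1D[OF assms(1) c _ d]) (use xd in auto)
  show "snd d (s (chart_inv c (snd c x))) = snd d (s' (chart_inv c (snd c x)))"
    using chart_inv_works(1)[OF manifold_chart[OF M c], of x] xd sx by simp
  show "dif (rep c d s) (snd c x) v = dif (rep c d s') (snd c x) v"
    unfolding D ..
  have "hess \<Theta> \<Gamma> c d s x v w = 0" "hess \<Theta> \<Gamma> c d s' x v w = 0"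
    using assms(2,3) c d xd sx unfolding param_geodesic_at_def by auto
  then show "dif2 (rep c d s) (snd c x) v w = dif2 (rep c d s') (snd c x) v w"
    unfolding hess_def Let_def D sx by (metis add_right_cancel diff_eq_eq)
qed

lemma ddot_param_eq:
  assumes s: "smooth_at M E s x" "immersive_at M E s x" "param_geodesic_at \<Theta> \<Gamma> s x"
  shows "ddot_param M E \<Theta> \<Gamma> (mjet M E 1 s x) = mjet M E 2 s x"
  unfolding ddot_param_def
proof (rule the_equality)
  show "mjet M E 2 s x \<in> geod_eq_param M E \<Theta> \<Gamma> \<and> mjet_proj M E 1 (mjet M E 2 s x) = mjet M E 1 s x"
    unfolding geod_eq_param_iff using s mjet_proj_mjet_2[OF s(1)] by blast
  fix \<theta> assume \<theta>: "\<theta> \<in> geod_eq_param M E \<Theta> \<Gamma> \<and> mjet_proj M E 1 \<theta> = mjet M E 1 s x"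
  then obtain s' x' where s': "\<theta> = mjet M E 2 s' x'" "smooth_at M E s' x'" "param_geodesic_at \<Theta> \<Gamma> s' x'"
    unfolding geod_eq_param_iff by blast
  then have "mjet M E 1 s' x' = mjet M E 1 s x" using \<theta> mjet_proj_mjet_2[OF s'(2)] by simp
  then have "x' = x" "mcontact M E 1 x' s' s" using mjet_eq_iff[OF s'(2) s(1)] by auto
  then show "\<theta> = mjet M E 2 s x"
    using param_geodesic_unique[of x s' s \<Theta> \<Gamma>] s' s mjet_eq_iff[OF s'(2) s(1), of 2] by simp
qed

lemma ddot_param_cases:
  assumes \<Theta>: "linear_connection M \<Theta>" "torsion_free M \<Theta>" and \<Gamma>: "linear_connection E \<Gamma>" "torsion_free E \<Gamma>"
    and \<theta>: "\<theta> \<in> ImmJet M E 1"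
  obtains s x where "smooth_at M E s x" "immersive_at M E s x" "param_geodesic_at \<Theta> \<Gamma> s x"
    "\<theta> = mjet M E 1 s x" "ddot_param M E \<Theta> \<Gamma> \<theta> = mjet M E 2 s x"
proof -
  obtain s0 x where s0: "\<theta> = mjet M E 1 s0 x" "smooth_at M E s0 x" "immersive_at M E s0 x"
    using \<theta> unfolding ImmJet_def by blast
  obtain s where s: "smooth_at M E s x" "mcontact M E 1 x s0 s" "param_geodesic_at \<Theta> \<Gamma> s x"
    by (rule exists_param_geodesic_jet[OF \<Theta> \<Gamma> s0(2)])
  have i: "immersive_at M E s x" using immersive_at_cong[OF s(2)] s0(3) by simp
  have "\<theta> = mjet M E 1 s x" using mjet_eq_iff[OF s0(2) s(1)] s(2) s0(1) by simp
  with that[OF s(1) i s(3)] ddot_param_eq[OF s(1) i s(3)] show ?thesis by simp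
qed

theorem section_ddot_param:
  assumes \<Theta>: "linear_connection M \<Theta>" "torsion_free M \<Theta>" and \<Gamma>: "linear_connection E \<Gamma>" "torsion_free E \<Gamma>"
  shows "section_with_image (ddot_param M E \<Theta> \<Gamma>) (mjet_proj M E 1) (ImmJet M E 1) (ImmJet M E 2) (geod_eq_param M E \<Theta> \<Gamma>)"
  unfolding section_with_image_def
proof (intro conjI ballI)
  show "geod_eq_param M E \<Theta> \<Gamma> \<subseteq> ImmJet M E 2" unfolding geod_eq_param_iff ImmJet_def by blast
  show "ddot_param M E \<Theta> \<Gamma> ` ImmJet M E 1 = geod_eq_param M E \<Theta> \<Gamma>"
  proof (intro equalityI subsetI)
    fix \<theta> assume "\<theta> \<in> ddot_param M E \<Theta> \<Gamma> ` ImmJet M E 1"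
    then obtain \<theta>1 where \<theta>1: "\<theta>1 \<in> ImmJet M E 1" "\<theta> = ddot_param M E \<Theta> \<Gamma> \<theta>1" by blast
    obtain s x where "smooth_at M E s x" "immersive_at M E s x" "param_geodesic_at \<Theta> \<Gamma> s x"
      "ddot_param M E \<Theta> \<Gamma> \<theta>1 = mjet M E 2 s x"
      by (rule ddot_param_cases[OF \<Theta> \<Gamma> \<theta>1(1)])
    then show "\<theta> \<in> geod_eq_param M E \<Theta> \<Gamma>" unfolding geod_eq_param_iff \<theta>1(2) by blast
  next
    fix \<theta> assume "\<theta> \<in> geod_eq_param M E \<Theta> \<Gamma>"
    then obtain s x where s: "\<theta> = mjet M E 2 s x" "smooth_at M E s x" "immersive_at M E s x" "param_geodesic_at \<Theta> \<Gamma> s x"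
      unfolding geod_eq_param_iff by blast
    have "mjet M E 1 s x \<in> ImmJet M E 1" unfolding ImmJet_def using s by blast
    moreover have "\<theta> = ddot_param M E \<Theta> \<Gamma> (mjet M E 1 s x)" using ddot_param_eq[OF s(2-4)] s(1) by simp
    ultimately show "\<theta> \<in> ddot_param M E \<Theta> \<Gamma> ` ImmJet M E 1" by blast
  qed
  fix \<theta> assume \<theta>: "\<theta> \<in> ImmJet M E 1"
  obtain s x where "smooth_at M E s x" "\<theta> = mjet M E 1 s x" "ddot_param M E \<Theta> \<Gamma> \<theta> = mjet M E 2 s x"
    by (rule ddot_param_cases[OF \<Theta> \<Gamma> \<theta>])
  then show "mjet_proj M E 1 (ddot_param M E \<Theta> \<Gamma> \<theta>) = \<theta>" using mjet_proj_mjet_2 by simp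
qed

end

section \<open>Images of immersions\<close>

text \<open>
  The coordinates of \<open>s\<close>, followed by a left inverse of the derivative at \<open>x\<close>, form a local diffeomorphism. Where it is
  one, \<open>s\<close> is an immersion, and the inverse diffeomorphism gives a continuous inverse of \<open>s\<close>.
\<close>

theorem immersion_locally_embedding:
  fixes M :: "('x::{t2_space,second_countable_topology}, real^'n::finite) chart set"
    and E :: "('e::{t2_space,second_countable_topology}, real^'k::finite) chart set"
  assumes M: "smooth_manifold M" and E: "smooth_manifold E"
    and s: "smooth_at M E s x" "immersive_at M E s x"
  obtains U where "x \<in> U" "smooth_embedding_on M E U s"
proof -
  obtain c where c: "c \<in> M" "x \<in> fst c" using manifold_cover[OF M] by blast
  obtain d where d: "d \<in> E" "s x \<in> fst d" using manifold_cover[OF E] by blast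
  note tc = manifold_chart[OF M c(1)] and td = manifold_chart[OF E d(1)]
  note ci = chart_inv_works[OF tc] and di = chart_inv_works[OF td]
  obtain U0 where U0: "open U0" "x \<in> U0" "U0 \<subseteq> fst c" "smooth_map_on M E U0 s" "open (snd c ` U0)"
    "smooth_into E (snd c ` U0) (\<lambda>y. s (chart_inv c y))" "\<And>y. y \<in> U0 \<Longrightarrow> smooth_at M E s y"
    by (rule smooth_at_chart[OF M E s(1) c]) (rule that; assumption)
  let ?F = "rep c d s" and ?x = "snd c x"
  let ?O = "{y \<in> snd c ` U0. s (chart_inv c y) \<in> fst d}"
  note F = smooth_intoD[OF U0(6) d(1)]
  have x0: "?x \<in> ?O" using U0(2) ci(1)[OF c(2)] d by auto
  have xc: "s (chart_inv c ?x) \<in> fst d" using x0 by simp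
  have "inj (push E (\<lambda>y. s (chart_inv c y)) ?x)" using immersive_at_iff[OF M E s(1) c] s(2) by simp
  then have inj: "inj (dif ?F ?x)" using inj_push_iff[OF E d(1) U0(6) _ xc] x0 by simp
  have lin: "linear (dif ?F y)" if "y \<in> ?O" for y by (rule linear_dif[OF smooth_onD[OF F(2) that]])
  obtain hl where hl: "linear hl" "hl \<circ> dif ?F ?x = id"
    using linear_injective_left_inverse[OF lin[OF x0] inj] by blast
  have dh: "dif (\<lambda>y. hl (?F y)) y w = hl (dif ?F y w)" if "y \<in> ?O" for y w
    by (rule dif_linear_comp[OF hl(1) smooth_onD[OF F(2) that]])
  have "dif (\<lambda>y. hl (?F y)) ?x = id" using dh[OF x0] hl(2) by (simp add: fun_eq_iff)
  then have injh: "inj (dif (\<lambda>y. hl (?F y)) ?x)" by simp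
  obtain S V g where S: "open S" "S \<subseteq> ?O" "?x \<in> S" and V: "open V"
    and gl: "\<And>y. y \<in> S \<Longrightarrow> hl (?F y) \<in> V \<and> g (hl (?F y)) = y"
    and gr: "\<And>z. z \<in> V \<Longrightarrow> g z \<in> S \<and> hl (?F (g z)) = z" and gs: "smooth_on V g"
    and injS: "\<And>y. y \<in> S \<Longrightarrow> inj (dif (\<lambda>y. hl (?F y)) y)"
    by (rule smooth_inverse_function[OF F(1) smooth_on_linear_comp[OF hl(1) F] x0 injh]) (rule that; assumption)
  let ?U = "chart_inv c ` S"
  have Sc: "S \<subseteq> snd c ` fst c" using S(2) U0(3) by auto
  have U: "open ?U" by (rule open_chart_inv_image[OF tc S(1) Sc])
  have UU: "?U \<subseteq> U0"
  proof
    fix q assume "q \<in> ?U"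
    then obtain y where "y \<in> S" "q = chart_inv c y" by blast
    moreover then obtain r where "r \<in> U0" "y = snd c r" using S(2) by auto
    ultimately show "q \<in> U0" using ci(1) U0(3) by auto
  qed
  have q: "snd c q \<in> S" "q \<in> fst c" "s q \<in> fst d" "chart_inv c (snd c q) = q" if qU: "q \<in> ?U" for q
  proof -
    obtain y where y: "y \<in> S" "q = chart_inv c y" using qU by blast
    have yc: "y \<in> snd c ` fst c" using y Sc by blast
    show "snd c q \<in> S" "q \<in> fst c" using y ci(2,3)[OF yc] by auto
    then have qc: "q \<in> fst c" by blast
    show "chart_inv c (snd c q) = q" by (rule ci(1)[OF qc])
    show "s q \<in> fst d" using y S(2) by auto
  qed
  have xU: "x \<in> ?U" using S(3) ci(1)[OF c(2)] by (intro image_eqI[of _ _ "?x"]) auto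
  have imm: "immersive_at M E s q" if qU: "q \<in> ?U" for q
  proof -
    note qq = q[OF qU]
    have y: "snd c q \<in> ?O" using qq(1) S(2) by blast
    have "inj (dif ?F (snd c q))"
    proof (rule injI)
      fix v w assume "dif ?F (snd c q) v = dif ?F (snd c q) w"
      then have "dif (\<lambda>y. hl (?F y)) (snd c q) v = dif (\<lambda>y. hl (?F y)) (snd c q) w" using dh[OF y] by simp
      then show "v = w" using injS[OF qq(1)] by (simp add: inj_eq)
    qed
    then have "inj (push E (\<lambda>y. s (chart_inv c y)) (snd c q))"
      using inj_push_iff[OF E d(1) U0(6), of "snd c q"] y by simp
    then show ?thesis using immersive_at_iff[OF M E U0(7) c(1) qq(2)] UU qU by blast
  qed
  have "homeomorphism ?U (s ` ?U) s (\<lambda>p. chart_inv c (g (hl (snd d p))))"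
  proof (rule homeomorphismI)
    have "continuous_on ?U (\<lambda>q. chart_inv d (?F (snd c q)))"
    proof (rule continuous_on_compose2[OF chart_continuous(2)[OF td]])
      have "continuous_on ?U (snd c)" by (rule continuous_on_subset[OF chart_continuous(1)[OF tc]]) (use q in auto)
      then show "continuous_on ?U (\<lambda>q. ?F (snd c q))"
        by (rule continuous_on_compose2[OF smooth_on_continuous[OF F(2)]]) (use q S(2) in blast)
    qed (use q in auto)
    then show "continuous_on ?U s"
      by (rule continuous_on_eq) (use q di(1) in auto)
    have "continuous_on (s ` ?U) (snd d)" by (rule continuous_on_subset[OF chart_continuous(1)[OF td]]) (use q in auto)
    then have "continuous_on (s ` ?U) (\<lambda>p. hl (snd d p))"
      by (rule bounded_linear.continuous_on[rotated]) (use hl(1) linear_conv_bounded_linear in blast)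
    then have "continuous_on (s ` ?U) (\<lambda>p. g (hl (snd d p)))"
      by (rule continuous_on_compose2[OF smooth_on_continuous[OF gs]]) (use q gl in force)
    then show "continuous_on (s ` ?U) (\<lambda>p. chart_inv c (g (hl (snd d p))))"
      by (rule continuous_on_compose2[OF chart_continuous(2)[OF tc]]) (use q gl Sc in force)
    have *: "chart_inv c (g (hl (snd d (s q)))) = q" if "q \<in> ?U" for q
      using gl[OF q(1)[OF that]] q(4)[OF that] by simp
    show "(\<lambda>p. chart_inv c (g (hl (snd d p)))) ` (s ` ?U) \<subseteq> ?U" using * by auto
    show "chart_inv c (g (hl (snd d (s q)))) = q" if "q \<in> ?U" for q by (rule *[OF that])
    show "s (chart_inv c (g (hl (snd d p)))) = p" if "p \<in> s ` ?U" for p using that * by auto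
  qed auto
  then have "smooth_embedding_on M E ?U s"
    unfolding smooth_embedding_on_def using U smooth_map_on_subset[OF M E U0(4) U UU] imm by blast
  then show ?thesis using that xU by blast
qed

context
  fixes M :: "('x::{t2_space,second_countable_topology}, real^'n::finite) chart set"
    and E :: "('e::{t2_space,second_countable_topology}, real^('n + 'm::finite)) chart set"
  assumes M: "smooth_manifold M" and E: "smooth_manifold E"
begin

lemma embeddingD:
  assumes "smooth_embedding_on M E U s"
  shows "open U" "smooth_map_on M E U s" "x \<in> U \<Longrightarrow> immersive_at M E s x" "x \<in> U \<Longrightarrow> smooth_at M E s x"
  using assms unfolding smooth_embedding_on_def smooth_at_def by blast+

text \<open>
  The homeomorphism makes \<open>s\<close> open onto its image.
\<close>

lemma embedding_parametrizes:
  assumes s: "smooth_embedding_on M E U s" and c: "c \<in> M"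
  shows "parametrizes E (s ` U) (snd c ` (U \<inter> fst c)) (\<lambda>y. s (chart_inv c y))"
proof -
  note e = embeddingD[OF s] and tc = manifold_chart[OF M c]
  note ci = chart_inv_works[OF tc]
  obtain g where g: "homeomorphism U (s ` U) s g" using s unfolding smooth_embedding_on_def by blast
  show ?thesis unfolding parametrizes_def
  proof (intro conjI ballI allI impI)
    show "open (snd c ` (U \<inter> fst c))" by (rule open_chart_image'[OF M E c e(1)])
    show "smooth_into E (snd c ` (U \<inter> fst c)) (\<lambda>y. s (chart_inv c y))" by (rule smooth_map_on_into[OF M E e(2) c])
    show "inj (push E (\<lambda>y. s (chart_inv c y)) y)" if yU: "y \<in> snd c ` (U \<inter> fst c)" for y
    proof -
      obtain q where "q \<in> U" "q \<in> fst c" "y = snd c q" using yU by blast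
      then show ?thesis using immersive_at_iff[OF M E e(4) c] e(3) by simp
    qed
    fix S assume "open S \<and> S \<subseteq> snd c ` (U \<inter> fst c)"
    then have S: "open S" "S \<subseteq> snd c ` (U \<inter> fst c)" by auto
    have "open (chart_inv c ` S)" by (rule open_chart_inv_image[OF tc S(1)]) (use S(2) in auto)
    moreover have "chart_inv c ` S \<subseteq> U" using S(2) ci(1) by auto
    ultimately have "openin (top_of_set U) (chart_inv c ` S)" using e(1) openin_open_eq by blast
    then have "openin (top_of_set (s ` U)) (s ` (chart_inv c ` S))" by (rule homeomorphism_imp_open_map[OF g])
    then obtain W where "open W" "s ` (chart_inv c ` S) = s ` U \<inter> W" unfolding openin_open by blast
    then show "\<exists>W. open W \<and> W \<inter> s ` U = (\<lambda>y. s (chart_inv c y)) ` S"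
      by (intro exI[of _ W]) (simp add: image_image Int_commute)
  qed
qed

lemma embedding_submanifold:
  assumes s: "smooth_embedding_on M E U s"
  shows "submanifold E (s ` U)"
proof (rule submanifold_if_parametrizes[OF E])
  fix p assume "p \<in> s ` U"
  then obtain x where x: "x \<in> U" "p = s x" by blast
  obtain c where c: "c \<in> M" "x \<in> fst c" using manifold_cover[OF M] by blast
  have "s (chart_inv c (snd c x)) = p" using chart_inv_works(1)[OF manifold_chart[OF M c(1)] c(2)] x by simp
  then show "\<exists>\<Omega> G. \<exists>x0\<in>\<Omega>. parametrizes E (s ` U) \<Omega> G \<and> G x0 = p"
    using embedding_parametrizes[OF s c(1)] x c by blast
qed

lemma embedding_tangent_to:
  assumes s: "smooth_embedding_on M E U s" "x \<in> U" and c: "c \<in> M" "x \<in> fst c"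
  shows "tangent_to E (s ` U) (s x) = range (push E (\<lambda>y. s (chart_inv c y)) (snd c x))"
  using tangent_to_parametrizes[OF E embedding_parametrizes[OF s(1) c(1)], of "snd c x"] s(2) c
    chart_inv_works(1)[OF manifold_chart[OF M c(1)] c(2)] by simp

text \<open>
  The tangent plane of the image of another representative is the same, as it is spanned by the same derivative.
  So the description that defines the projection has a unique solution.
\<close>

theorem prE_mjet:
  assumes s: "smooth_embedding_on M E U s" "x \<in> U"
  shows "prE M E 1 (mjet M E 1 s x) = jet E 1 (s ` U) (s x)"
  unfolding prE_def fst_mjet[OF M E]
proof (rule the_equality)
  note e = embeddingD[OF s(1)]
  have "s \<in> snd (mjet M E 1 s x)" using e(4)[OF s(2)] mcontact_refl[OF M E] by (simp add: mjet_def)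
  then show "\<exists>s' U'. s' \<in> snd (mjet M E 1 s x) \<and> x \<in> U' \<and> smooth_embedding_on M E U' s' \<and>
      jet E 1 (s ` U) (s x) = jet E 1 (s' ` U') (s' x)" using s by blast
  fix \<theta> assume "\<exists>s' U'. s' \<in> snd (mjet M E 1 s x) \<and> x \<in> U' \<and> smooth_embedding_on M E U' s' \<and>
      \<theta> = jet E 1 (s' ` U') (s' x)"
  then obtain s' U' where s': "mcontact M E 1 x s s'" "x \<in> U'" "smooth_embedding_on M E U' s'" "\<theta> = jet E 1 (s' ` U') (s' x)"
    unfolding mjet_def by auto
  obtain c where c: "c \<in> M" "x \<in> fst c" using manifold_cover[OF M] by blast
  have sx: "s x = s' x" by (rule mcontactD(1)[OF M E s'(1)])
  have "push E (\<lambda>y. s (chart_inv c y)) (snd c x) = push E (\<lambda>y. s' (chart_inv c y)) (snd c x)"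
    using mcontact_1D[OF M E s'(1) c] sx chart_inv_works(1)[OF manifold_chart[OF M c(1)] c(2)]
    by (auto simp: push_def fun_eq_iff)
  then have "tangent_to E (s' ` U') (s' x) = tangent_to E (s ` U) (s x)"
    using embedding_tangent_to[OF s c] embedding_tangent_to[OF s'(3,2) c] by simp
  then show "\<theta> = jet E 1 (s ` U) (s x)"
    unfolding s'(4) using jet_1_eq_iff[OF E embedding_submanifold[OF s'(3)] _ embedding_submanifold[OF s(1)]] s(2) s'(2) sx
    by (metis imageI)
qed

text \<open>
  A tangent plane in \<open>E\<close> is spanned by the derivative of an affine map from coordinates of an arbitrary point of
  \<open>M\<close>.
\<close>

theorem prE_surj: "prE M E 1 ` ImmJet M E 1 = Jet E 1"
proof (intro equalityI subsetI)
  fix \<theta> assume "\<theta> \<in> prE M E 1 ` ImmJet M E 1"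
  then obtain s x where s: "smooth_at M E s x" "immersive_at M E s x" "\<theta> = prE M E 1 (mjet M E 1 s x)"
    unfolding ImmJet_def by blast
  obtain U where U: "x \<in> U" "smooth_embedding_on M E U s" by (rule immersion_locally_embedding[OF M E s(1,2)])
  then show "\<theta> \<in> Jet E 1"
    unfolding s(3) prE_mjet[OF U(2,1)] Jet_def using embedding_submanifold[OF U(2)] by blast
next
  fix \<theta> assume "\<theta> \<in> Jet E 1"
  then obtain L p where L: "\<theta> = jet E 1 L p" "submanifold E L" "p \<in> L" unfolding Jet_def by blast
  obtain d f where d: "d \<in> E" and f: "graph_at d L p f" using L submanifold_iff_graph[OF E] by blast
  have pd: "p \<in> fst d" using graph_atD[OF f] by simp
  define x :: 'x where "x = undefined"
  obtain c where c: "c \<in> M" "x \<in> fst c" using manifold_cover[OF M] by blast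
  note ci = chart_inv_works(1)[OF manifold_chart[OF M c(1)] c(2)]
  let ?D = "dif f (horiz (snd d p))"
  have D: "linear ?D" by (rule linear_dif[OF graph_at_differentiable[OF f]])
  have G: "linear (\<lambda>w. join w (?D w))"
    by (rule linearI) (simp_all add: join_add join_scale linear_add[OF D] linear_cmul[OF D])
  obtain s where s: "smooth_at M E s x" "s x = p" "matrix (dif (rep c d s) (snd c x)) = matrix (\<lambda>w. join w (?D w))"
    by (rule exists_affine_map[OF M E c d pd])
  have sd: "s x \<in> fst d" using s(2) pd by simp
  obtain U0 where U0: "x \<in> U0" "smooth_into E (snd c ` U0) (\<lambda>y. s (chart_inv c y))"
    by (rule smooth_at_chart[OF M E s(1) c]) (rule that; assumption)
  have ds: "dif (rep c d s) (snd c x) w = join w (?D w)" for w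
  proof -
    have "dif (rep c d s) (snd c x) w = matrix (\<lambda>w. join w (?D w)) *v w"
      using matrix_dif_works[OF rep_differentiable[OF M E s(1) c d sd], of w] s(3) by simp
    also have "\<dots> = join w (?D w)"
      by (rule matrix_works) (simp add: G linear_def[symmetric] linear_matrix_vector_mul_eq)
    finally show ?thesis .
  qed
  have xc: "s (chart_inv c (snd c x)) \<in> fst d" using sd ci by simp
  have push: "push E (\<lambda>y. s (chart_inv c y)) (snd c x) w = tvec_of E d p (join w (?D w))" for w
    using push_eq_tvec_of[OF E d U0(2) _ xc] U0(1) ci s(2) ds by simp
  have "inj (dif (rep c d s) (snd c x))"
  proof (rule injI)
    fix v w assume "dif (rep c d s) (snd c x) v = dif (rep c d s) (snd c x) w"
    then have "horiz (join v (?D v)) = horiz (join w (?D w))" unfolding ds by simp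
    then show "v = w" by simp
  qed
  then have "immersive_at M E s x"
    using immersive_at_iff[OF M E s(1) c] inj_push_iff[OF E d U0(2) _ xc] U0(1) by simp
  then have I: "mjet M E 1 s x \<in> ImmJet M E 1" unfolding ImmJet_def using s(1) by blast
  obtain U where U: "x \<in> U" "smooth_embedding_on M E U s"
    by (rule immersion_locally_embedding[OF M E s(1) \<open>immersive_at M E s x\<close>])
  have "tangent_to E (s ` U) p = tangent_to E L p"
    using embedding_tangent_to[OF U(2,1) c] push s(2) tangent_to_graph[OF E d f] by simp
  then have "jet E 1 (s ` U) p = jet E 1 L p"
    using jet_1_eq_iff[OF E embedding_submanifold[OF U(2)] _ L(2,3)] U(1) s(2) by blast
  then have "prE M E 1 (mjet M E 1 s x) = \<theta>" using prE_mjet[OF U(2,1)] s(2) L(1) by simp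
  then show "\<theta> \<in> prE M E 1 ` ImmJet M E 1" using I by blast
qed

section \<open>The tangent maps of the projection of first order jets\<close>

text \<open>
  In coordinates the projection sends the derivative of a map to the slope of the plane that it spans, seen in the chart \<open>b\<close> of
  \<open>E\<close>.
\<close>

lemma prE_differentiable:
  assumes c: "c \<in> M" and d: "d \<in> E" and b: "b \<in> E"
    and s: "smooth_at M E s x" "immersive_at M E s x" "x \<in> fst c" "s x \<in> fst d"
    and dom: "prE M E 1 (mjet M E 1 s x) \<in> fst (jet1_chart E b)"
  shows "(\<lambda>z. snd (jet1_chart E b) (prE M E 1 (chart_inv (mjet1_chart M E c d) z)))
     differentiable (at (snd (mjet1_chart M E c d) (mjet M E 1 s x)))"
proof -
  let ?B = "\<lambda>z :: (real^'n) \<times> (real^('n + 'm)) \<times> (real^'n^('n + 'm)).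
     matrix (\<lambda>w. dif (transition d b) (fst (snd z)) (snd (snd z) *v w))"
  let ?U = "snd d ` (fst d \<inter> fst b)"
  let ?S = "(snd c ` fst c) \<times> (?U \<times> (UNIV :: (real^'n^('n + 'm)) set))"
  note tc = manifold_chart[OF M c] and td = manifold_chart[OF E d]
  have o: "open ?S" by (intro open_Times chart_open(2)[OF tc] open_overlap[OF E d b] open_UNIV)
  have l1: "linear (\<lambda>z :: (real^'n) \<times> (real^('n + 'm)) \<times> (real^'n^('n + 'm)). fst (snd z))"
    using linear_compose[OF linear_snd linear_fst] by (simp add: o_def)
  have s1: "smooth_on ?S (\<lambda>z. fst (snd z))" by (rule smooth_on_linear[OF l1])
  have s2: "smooth_on ?S (\<lambda>z. transition d b (fst (snd z)))"
    by (rule smooth_on_compose[OF smooth_transition[OF E d b] s1 o open_overlap[OF E d b]]) auto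
  have s3: "smooth_on ?S ?B"
  proof (rule smooth_on_matrix[OF o])
    fix j
    have "linear (\<lambda>z :: (real^'n) \<times> (real^('n + 'm)) \<times> (real^'n^('n + 'm)). snd (snd z) *v axis j 1)"
      by (auto intro!: linearI simp: matrix_vector_mult_add_rdistrib scaleR_matrix_vector_assoc)
    then have "smooth_on ?S (\<lambda>z. snd (snd z) *v axis j 1)" by (rule smooth_on_linear)
    then show "smooth_on ?S (\<lambda>z. dif (transition d b) (fst (snd z)) (snd (snd z) *v axis j 1))"
      by (rule smooth_on_dif_apply[OF smooth_transition[OF E d b] s1 _ o open_overlap[OF E d b]]) auto
  qed
  have embedding: "prE M E 1 (mjet M E 1 t y) \<in> fst (jet1_chart E b) \<longleftrightarrow> t y \<in> fst b \<and>
        det (hmat (matrix (dif (rep c b t) (snd c y)))) \<noteq> 0" (is ?dom)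
    "t y \<in> fst b \<Longrightarrow> det (hmat (matrix (dif (rep c b t) (snd c y)))) \<noteq> 0 \<Longrightarrow>
      snd (jet1_chart E b) (prE M E 1 (mjet M E 1 t y))
       = (snd b (t y), slope (matrix (dif (rep c b t) (snd c y))))"
    if t: "smooth_at M E t y" "immersive_at M E t y" "y \<in> fst c" for t y
  proof -
    obtain U where U: "y \<in> U" "smooth_embedding_on M E U t" by (rule immersion_locally_embedding[OF M E t(1,2)])
    note par = embedding_parametrizes[OF U(2) c] and sub = embedding_submanifold[OF U(2)]
    have y: "snd c y \<in> snd c ` (U \<inter> fst c)" using U(1) t(3) by blast
    note ci = chart_inv_works(1)[OF tc t(3)]
    show ?dom using jet1_chart_dom[OF E b sub par y] unfolding ci prE_mjet[OF U(2,1)] .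
    show "snd (jet1_chart E b) (prE M E 1 (mjet M E 1 t y))
       = (snd b (t y), slope (matrix (dif (rep c b t) (snd c y))))"
      if "t y \<in> fst b" "det (hmat (matrix (dif (rep c b t) (snd c y)))) \<noteq> 0"
      using jet1_chart_val[OF E b sub par y] that unfolding ci prE_mjet[OF U(2,1)] by blast
  qed
  have rep: "dif (rep c b t) (snd c y)
      = (\<lambda>w. dif (transition d b) (snd d (t y)) (matrix (dif (rep c d t) (snd c y)) *v w))"
    if t: "smooth_at M E t y" "y \<in> fst c" "t y \<in> fst d" "t y \<in> fst b" for t y
    using dif_rep_change[OF M E t(1) c t(2) c t(2) d t(3) b t(4)] dif_transition_self[OF M c t(2)]
      matrix_dif_works[OF rep_differentiable[OF M E t(1) c t(2) d t(3)]] by (simp add: fun_eq_iff)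
  note val = mjet1_chart_val[OF M E s(1) c s(3) d s(4)]
  have sb: "s x \<in> fst b" using embedding(1)[OF s(1-3)] dom by simp
  show ?thesis
  proof (rule slope_differentiable[OF o s2 s3])
    show "snd (mjet1_chart M E c d) (mjet M E 1 s x) \<in> ?S" unfolding val using s(3,4) sb by auto
    show "det (hmat (?B (snd (mjet1_chart M E c d) (mjet M E 1 s x)))) \<noteq> 0"
      using embedding(1)[OF s(1-3)] dom rep[OF s(1,3,4) sb] unfolding val by simp
    fix z assume z: "z \<in> ?S" "det (hmat (?B z)) \<noteq> 0"
    then obtain y q u where y: "y \<in> fst c" "q \<in> fst d" "q \<in> fst b" "z = (snd c y, snd d q, u)" by auto
    obtain t where t: "smooth_at M E t y" "t y = q" "matrix (dif (rep c d t) (snd c y)) = u"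
      by (rule exists_affine_map[OF M E c y(1) d y(2)])
    have td: "t y \<in> fst d" and tb: "t y \<in> fst b" using t y by auto
    have zt: "z = (snd c y, snd d (t y), matrix (dif (rep c d t) (snd c y)))"
      using y(4) t by simp
    have mj: "chart_inv (mjet1_chart M E c d) z = mjet M E 1 t y"
      unfolding zt by (rule mjet1_chart_inv[OF M E t(1) c y(1) d td])
    have Bz: "?B z = matrix (dif (rep c b t) (snd c y))"
      unfolding rep[OF t(1) y(1) td tb] using y(4) t by simp
    obtain U0 where U0: "y \<in> U0" "smooth_into E (snd c ` U0) (\<lambda>y. t (chart_inv c y))"
      by (rule smooth_at_chart[OF M E t(1) c y(1)]) (rule that; assumption)
    note ci = chart_inv_works(1)[OF tc y(1)]
    have "inj (\<lambda>w. horiz (matrix (dif (rep c b t) (snd c y)) *v w))"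
      using z(2) unfolding Bz det_hmat_iff .
    then have "inj (dif (rep c b t) (snd c y))"
      unfolding matrix_dif_works[OF rep_differentiable[OF M E t(1) c y(1) b tb]] by (auto simp: inj_def)
    then have "inj (push E (\<lambda>y. t (chart_inv c y)) (snd c y))"
      using inj_push_iff[OF E b U0(2), of "snd c y"] U0(1) tb ci by simp
    then have "immersive_at M E t y" using immersive_at_iff[OF M E t(1) c y(1)] by simp
    from embedding(2)[OF t(1) this y(1) tb] z(2)
    have "snd (jet1_chart E b) (prE M E 1 (mjet M E 1 t y)) = (snd b (t y), slope (?B z))" unfolding Bz by blast
    moreover have "snd b (t y) = transition d b (fst (snd z))"
      using y(4) t(2) transition_snd[OF manifold_chart[OF E d] y(2), of b] by simp
    ultimately show "snd (jet1_chart E b) (prE M E 1 (chart_inv (mjet1_chart M E c d) z))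
        = (transition d b (fst (snd z)), slope (?B z))" unfolding mj by simp
  qed
qed

text \<open>
  The projection intertwines the prolongation of \<open>s\<close> with the prolongation of its image, both parametrized by the
  coordinates of \<open>M\<close>; the theorem is the derivative of this identity.
\<close>

theorem tangent_map_prE:
  assumes s: "smooth_embedding_on M E U s" "x \<in> U" and c: "c \<in> M" "x \<in> fst c"
  shows "tangent_map (mjet1_atlas M E) (jet1_atlas E) (prE M E 1) (mjet M E 1 s x)
       (push (mjet1_atlas M E) (\<lambda>y. mjet M E 1 s (chart_inv c y)) (snd c x) w)
     = push (jet1_atlas E) (\<lambda>y. jet E 1 (s ` U) (s (chart_inv c y))) (snd c x) w"
proof
  fix D
  note e = embeddingD[OF s(1)]
  let ?P = "\<lambda>y. mjet M E 1 s (chart_inv c y)" and ?Q = "\<lambda>y. jet E 1 (s ` U) (s (chart_inv c y))"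
  let ?\<theta> = "mjet M E 1 s x"
  note tc = manifold_chart[OF M c(1)]
  note ci = chart_inv_works(1)[OF tc c(2)]
  define C where "C = (SOME C. C \<in> mjet1_atlas M E \<and> ?\<theta> \<in> fst C)"
  obtain d0 where d0: "d0 \<in> E" "s x \<in> fst d0" using manifold_cover[OF E] by blast
  have "mjet1_chart M E c d0 \<in> mjet1_atlas M E \<and> ?\<theta> \<in> fst (mjet1_chart M E c d0)"
    unfolding mjet1_chart_dom[OF M E e(4)[OF s(2)]] mjet1_atlas_def using c d0 by blast
  then have "C \<in> mjet1_atlas M E \<and> ?\<theta> \<in> fst C" unfolding C_def by (rule someI)
  then obtain a d where a: "a \<in> M" and d: "d \<in> E" and C: "C = mjet1_chart M E a d" "C \<in> mjet1_atlas M E" "?\<theta> \<in> fst C"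
    unfolding mjet1_atlas_def by blast
  have xa: "x \<in> fst a" "s x \<in> fst d" using C(3) mjet1_chart_dom[OF M E e(4)[OF s(2)]] unfolding C(1) by auto
  have PQ: "prE M E 1 (?P y) = ?Q y" if y: "y \<in> snd c ` (U \<inter> fst c)" for y
  proof -
    obtain q where q: "q \<in> U" "q \<in> fst c" "y = snd c q" using y by blast
    then show ?thesis using prE_mjet[OF s(1) q(1)] chart_inv_works(1)[OF tc q(2)] by simp
  qed
  have x0: "snd c x \<in> snd c ` (U \<inter> fst c)" using s(2) c(2) by blast
  note P = smooth_into_mjet_lift[OF M E e(2,1) c(1)]
  have Px: "?P (snd c x) = ?\<theta>" by (simp add: ci)
  show "tangent_map (mjet1_atlas M E) (jet1_atlas E) (prE M E 1) ?\<theta> (push (mjet1_atlas M E) ?P (snd c x) w) D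
     = push (jet1_atlas E) ?Q (snd c x) w D"
  proof (cases "D \<in> jet1_atlas E \<and> prE M E 1 ?\<theta> \<in> fst D")
    case True
    then obtain b where b: "b \<in> E" "D = jet1_chart E b" "prE M E 1 ?\<theta> \<in> fst (jet1_chart E b)"
      unfolding jet1_atlas_def by blast
    let ?\<Phi> = "\<lambda>z. snd D (prE M E 1 (chart_inv C z))"
    have PC: "?P (snd c x) \<in> fst C" using C(3) Px by simp
    have d\<Phi>: "?\<Phi> differentiable (at (snd C (?P (snd c x))))"
      unfolding Px C(1) b(2) by (rule prE_differentiable[OF a d b(1) e(4)[OF s(2)] e(3)[OF s(2)] xa b(3)])
    have "push (mjet1_atlas M E) ?P (snd c x) w C = dif (\<lambda>y. snd C (?P y)) (snd c x) w"
      using C(2) PC by (simp add: push_def)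
    then have "dif ?\<Phi> (snd C ?\<theta>) (push (mjet1_atlas M E) ?P (snd c x) w C)
        = dif ?\<Phi> (snd C (?P (snd c x))) (dif (\<lambda>y. snd C (?P y)) (snd c x) w)"
      by (simp only: Px)
    also have "\<dots> = dif (\<lambda>y. ?\<Phi> (snd C (?P y))) (snd c x) w"
      by (rule dif_compose[OF smooth_into_differentiable[OF P C(2) x0 PC] d\<Phi>, symmetric])
    also have "\<dots> = dif (\<lambda>y. snd D (?Q y)) (snd c x) w"
    proof (rule arg_cong[where f="\<lambda>f. f w"], rule dif_cong_open[OF smooth_intoD(1)[OF P C(2)]])
      show "snd c x \<in> {y \<in> snd c ` (U \<inter> fst c). ?P y \<in> fst C}" using x0 PC by simp
      fix y assume y: "y \<in> {y \<in> snd c ` (U \<inter> fst c). ?P y \<in> fst C}"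
      then obtain q where q: "q \<in> U" "q \<in> fst c" "y = snd c q" by blast
      note sq = e(4)[OF q(1)] and cq = chart_inv_works(1)[OF tc q(2)]
      have "mjet M E 1 s q \<in> fst C" using y q cq by simp
      then have qa: "q \<in> fst a" "s q \<in> fst d" unfolding C(1) mjet1_chart_dom[OF M E sq] by auto
      have "chart_inv C (snd C (?P y)) = ?P y"
        using mjet1_chart_inv[OF M E sq a qa(1) d qa(2)] mjet1_chart_val[OF M E sq a qa(1) d qa(2)] q cq
        unfolding C(1) by simp
      then show "?\<Phi> (snd C (?P y)) = snd D (?Q y)" using PQ y by simp
    qed
    finally show ?thesis
      using True PQ[OF x0] Px
      unfolding tangent_map_def Let_def C_def[symmetric] push_def[of "jet1_atlas E"] by (simp add: o_def)
  next
    case False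
    then show ?thesis
      using PQ[OF x0] Px by (auto simp: tangent_map_def Let_def push_def)
  qed
qed

section \<open>Parametrized geodesics have totally geodesic images\<close>

lemma dif2_linear_comp:
  assumes "open S" "smooth_on S f" "x \<in> S" "linear h"
  shows "dif2 (\<lambda>x. h (f x)) x a b = h (dif2 f x a b)"
proof -
  have "dif2 (\<lambda>x. h (f x)) x a b = dif (\<lambda>y. h (dif f y b)) x a"
    by (rule arg_cong[where f="\<lambda>f. f a"], rule dif_cong_open[OF assms(1,3)])
       (rule dif_linear_comp[OF assms(4) smooth_onD[OF assms(2)]])
  also have "\<dots> = h (dif2 f x a b)"
    by (rule dif_linear_comp[OF assms(4) smooth_onD[OF smooth_on_dif[OF assms(2)] assms(3)]])
  finally show ?thesis .
qed

text \<open>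
  In a chart where the image is the graph of \<open>f\<close>, the identity \<open>vert s = f (horiz s)\<close> is differentiated twice. This
  expresses the second derivative of \<open>f\<close> by that of \<open>s\<close> modulo the tangent plane, which contains the
  derivative of \<open>s\<close> and hence the term with \<open>\<Theta>\<close>.
\<close>

theorem param_geodesic_image:
  assumes \<Gamma>: "linear_connection E \<Gamma>" and s: "smooth_embedding_on M E U s" "x \<in> U"
    and geo: "param_geodesic_at M E \<Theta> \<Gamma> s x"
  shows "second_fundamental_form_vanishes E \<Gamma> (s ` U) (s x)"
proof -
  note e = embeddingD[OF s(1)]
  obtain c where c: "c \<in> M" "x \<in> fst c" using manifold_cover[OF M] by blast
  note ci = chart_inv_works(1)[OF manifold_chart[OF M c(1)] c(2)]
  note par = embedding_parametrizes[OF s(1) c(1)] and sub = embedding_submanifold[OF s(1)]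
  let ?G = "\<lambda>y. s (chart_inv c y)" and ?\<Omega> = "snd c ` (U \<inter> fst c)" and ?x = "snd c x"
  have x0: "?x \<in> ?\<Omega>" using s(2) c by blast
  have Gx: "?G ?x = s x" by (simp add: ci)
  obtain d f0 where d: "d \<in> E" and f0: "graph_at d (s ` U) (s x) f0"
    using sub s(2) submanifold_iff_graph[OF E] by blast
  have sd: "s x \<in> fst d" using graph_atD[OF f0] by simp
  have Gd: "?G ?x \<in> fst d" using sd Gx by simp
  let ?F = "\<lambda>y. snd d (?G y)"
  have Fd: "?F differentiable (at ?x)" by (rule rep_differentiable[OF M E e(4)[OF s(2)] c d sd])
  have "det (hmat (matrix (dif ?F ?x))) \<noteq> 0" using graph_at_iff_det[OF E d sub par x0] f0 Gx by auto
  then have inj: "inj (\<lambda>w. horiz (dif ?F ?x w))" unfolding det_hmat_iff matrix_dif_works[OF Fd] .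
  obtain f S V where f: "graph_at d (s ` U) (?G ?x) f" and S: "open S" "?x \<in> S" "S \<subseteq> {y \<in> ?\<Omega>. ?G y \<in> fst d}"
    and V: "open V" "smooth_on V f"
    and fS: "\<And>y. y \<in> S \<Longrightarrow> horiz (?F y) \<in> V \<and> vert (?F y) = f (horiz (?F y))"
  proof (rule parametrizes_graph[OF E d par x0 Gd inj])
    fix f S V g
    assume *: "graph_at d (s ` U) (?G ?x) f" "open S" "?x \<in> S" "S \<subseteq> {y \<in> ?\<Omega>. ?G y \<in> fst d}" "open V" "smooth_on V f"
      "\<And>y. y \<in> S \<Longrightarrow> horiz (?F y) \<in> V \<and> g (horiz (?F y)) = y \<and> vert (?F y) = f (horiz (?F y))"
    show thesis by (rule that[OF *(1-6)]) (use *(7) in blast)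
  qed
  have Fs: "smooth_on S ?F"
    by (rule smooth_on_subset[OF smooth_intoD(2)[OF parametrizesD(2)[OF par] d] S(3)])
  let ?D = "dif ?F ?x" and ?z = "horiz (snd d (s x))"
  let ?Df = "dif f ?z"
  have D: "linear ?D" by (rule linear_dif[OF Fd])
  have hF: "smooth_on S (\<lambda>y. horiz (?F y))" by (rule smooth_on_linear_comp[OF linear_horiz S(1) Fs])
  have hx: "horiz (?F ?x) = ?z" by (simp add: Gx)
  have dh: "dif (\<lambda>y. horiz (?F y)) ?x a = horiz (?D a)" for a by (rule dif_linear_comp[OF linear_horiz Fd])
  have zV: "?z \<in> V" using fS[OF S(2)] hx by simp
  have fd: "f differentiable (at ?z)" by (rule smooth_onD[OF V(2) zV])
  have Df: "linear ?Df" by (rule linear_dif[OF fd])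
  have fS2: "vert (?F y) = f (horiz (?F y))" if "y \<in> S" for y using fS[OF that] by simp
  have d1: "dif (\<lambda>y. vert (?F y)) y = dif (\<lambda>y. f (horiz (?F y))) y" if "y \<in> S" for y
    by (rule dif_cong_open[OF S(1) that fS2])
  \<comment> \<open>the first derivative: the range of the derivative of \<open>s\<close> is the graph of the derivative of \<open>f\<close>\<close>
  have vD: "vert (?D a) = ?Df (horiz (?D a))" for a
  proof -
    have "vert (?D a) = dif (\<lambda>y. f (horiz (?F y))) ?x a"
      using dif_linear_comp[OF linear_vert Fd] d1[OF S(2)] by metis
    also have "\<dots> = dif f (horiz (?F ?x)) (dif (\<lambda>y. horiz (?F y)) ?x a)"
      by (rule dif_compose[OF smooth_onD[OF hF S(2)]]) (use fd hx in simp)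
    finally show ?thesis unfolding hx dh .
  qed
  \<comment> \<open>the second derivative of \<open>vert s = f (horiz s)\<close>\<close>
  have d2: "vert (dif2 ?F ?x a b) = dif2 f ?z (horiz (?D a)) (horiz (?D b)) + ?Df (horiz (dif2 ?F ?x a b))" for a b
  proof -
    have "vert (dif2 ?F ?x a b) = dif2 (\<lambda>y. vert (?F y)) ?x a b"
      by (rule dif2_linear_comp[OF S(1) Fs S(2) linear_vert, symmetric])
    also have "\<dots> = dif2 (\<lambda>y. f (horiz (?F y))) ?x a b"
      by (rule arg_cong[where f="\<lambda>f. f a"], rule dif_cong_open[OF S(1,2)]) (simp add: d1)
    also have "\<dots> = dif2 f (horiz (?F ?x)) (dif (\<lambda>y. horiz (?F y)) ?x a) (dif (\<lambda>y. horiz (?F y)) ?x b)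
        + dif f (horiz (?F ?x)) (dif2 (\<lambda>y. horiz (?F y)) ?x a b)"
      by (rule dif2_compose[where f="\<lambda>y. horiz (?F y)", OF V _ S(1) hF S(2)]) (use zV hx in simp)
    also have "dif2 (\<lambda>y. horiz (?F y)) ?x a b = horiz (dif2 ?F ?x a b)"
      by (rule dif2_linear_comp[OF S(1) Fs S(2) linear_horiz])
    finally show ?thesis unfolding hx dh .
  qed
  have f': "graph_at d (s ` U) (s x) f" using f Gx by simp
  have lh: "linear (\<lambda>w. horiz (?D w))" using linear_compose[OF D linear_horiz] by (simp add: o_def)
  show ?thesis unfolding second_fundamental_form_chart[OF E d \<Gamma> f']
  proof (intro allI)
    fix a' b'
    have "surj (\<lambda>w. horiz (?D w))" by (rule linear_inj_imp_surj[OF lh inj])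
    then obtain a b where ab: "a' = horiz (?D a)" "b' = horiz (?D b)"
      unfolding surj_def by blast
    have J: "join (horiz (?D a)) (?Df (horiz (?D a))) = ?D a" for a by (simp add: join_eq_iff[of _ "?D a"] vD)
    have "hess M E \<Theta> \<Gamma> c d s x a b = 0" using geo c d sd unfolding param_geodesic_at_def[OF M E] by blast
    then have h: "dif2 ?F ?x a b + gam E \<Gamma> d (s x) (?D a) (?D b) = ?D (gam M \<Theta> c x a b)"
      unfolding hess_def[OF M E] Let_def by simp
    have "vert (dif2 ?F ?x a b) + vert (gam E \<Gamma> d (s x) (?D a) (?D b))
        = ?Df (horiz (dif2 ?F ?x a b)) + ?Df (horiz (gam E \<Gamma> d (s x) (?D a) (?D b)))"
      using vD[of "gam M \<Theta> c x a b"] unfolding h[symmetric]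
      by (simp add: linear_add[OF linear_vert] linear_add[OF linear_horiz] linear_add[OF Df])
    then show "sff_chart E \<Gamma> d (s x) f a' b' = 0"
      unfolding sff_chart_def Let_def ab J d2 by (simp add: algebra_simps)
  qed
qed

section \<open>The covering\<close>

text \<open>
  The representative \<open>s\<close> of the second order jet is the one that defines the plane of the parametrized equation, and the
  image of \<open>s\<close> represents the second order jet that the unparametrized equation assigns to the projected jet.
\<close>

theorem covering:
  assumes \<Theta>: "linear_connection M \<Theta>" "torsion_free M \<Theta>" and \<Gamma>: "linear_connection E \<Gamma>" "torsion_free E \<Gamma>"
    and \<theta>: "\<theta> \<in> ImmJet M E 1"
  shows "dim (R_plane_param2 M E (ddot_param M E \<Theta> \<Gamma> \<theta>)) = CARD('n)"
    and "dim (R_plane2 E (ddot E \<Gamma> (prE M E 1 \<theta>))) = CARD('n)"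
    and "maps_isomorphically_onto (tangent_map (mjet1_atlas M E) (jet1_atlas E) (prE M E 1) \<theta>)
      (R_plane_param2 M E (ddot_param M E \<Theta> \<Gamma> \<theta>)) (R_plane2 E (ddot E \<Gamma> (prE M E 1 \<theta>)))"
proof -
  obtain s0 x where s0: "smooth_at M E s0 x" "immersive_at M E s0 x" "param_geodesic_at M E \<Theta> \<Gamma> s0 x"
      "\<theta> = mjet M E 1 s0 x" "ddot_param M E \<Theta> \<Gamma> \<theta> = mjet M E 2 s0 x"
    by (rule ddot_param_cases[OF M E \<Theta> \<Gamma> \<theta>])
  define s where "s = mjet_rep (mjet M E 2 s0 x)"
  note r = mjet_rep[OF M E s0(1), of 2, folded s_def]
  have s: "smooth_at M E s x" "immersive_at M E s x" "param_geodesic_at M E \<Theta> \<Gamma> s x"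
    using r(1) immersive_at_cong[OF M E mcontact_2_imp_1[OF M E r(2)]] s0(2) param_geodesic_at_cong[OF M E r(2) s0(3)]
    by auto
  have \<theta>s: "\<theta> = mjet M E 1 s x"
    unfolding s0(4) using mjet_eq_iff[OF M E s0(1) s(1)] mcontact_2_imp_1[OF M E r(2)] by simp
  obtain U where U: "x \<in> U" "smooth_embedding_on M E U s" by (rule immersion_locally_embedding[OF M E s(1,2)])
  note e = embeddingD[OF U(2)] and sub = embedding_submanifold[OF U(2)]
  obtain c where c: "c \<in> M" "x \<in> fst c" using manifold_cover[OF M] by blast
  note ci = chart_inv_works(1)[OF manifold_chart[OF M c(1)] c(2)]
  let ?P = "push (mjet1_atlas M E) (\<lambda>y. mjet M E 1 s (chart_inv c y)) (snd c x)"
  let ?Q = "push (jet1_atlas E) (\<lambda>y. jet E 1 (s ` U) (s (chart_inv c y))) (snd c x)"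
  have x0: "snd c x \<in> snd c ` (U \<inter> fst c)" using U(1) c(2) by blast
  note par = embedding_parametrizes[OF U(2) c(1)]
  have sx: "s x \<in> s ` U" using U(1) by blast
  have R1: "R_plane_param2 M E (ddot_param M E \<Theta> \<Gamma> \<theta>) = range ?P"
    unfolding s0(5) R_plane_param2_def Let_def s_def[symmetric] mjet_proj_mjet_2[OF M E s0(1)]
    using tangent_to_mjet_prolongation(1)[OF M E e(2,1) U(1) c] \<theta>s s0(4) by simp
  have prE: "prE M E 1 \<theta> = jet E 1 (s ` U) (s x)" unfolding \<theta>s by (rule prE_mjet[OF U(2,1)])
  have R2: "R_plane2 E (ddot E \<Gamma> (prE M E 1 \<theta>)) = range ?Q"
    unfolding prE ddot_eq[OF E \<Gamma>(1) sub sx param_geodesic_image[OF \<Gamma>(1) U(2,1) s(3)]] R_plane2_jet[OF E sub sx] plane2_def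
    using tangent_to_prolongation(1)[OF E sub par x0] by (simp add: ci)
  have P: "linear ?P" "inj ?P"
    by (rule linear_push[OF smooth_into_mjet_lift[OF M E e(2,1) c(1)] x0])
       (rule tangent_to_mjet_prolongation(2)[OF M E e(2,1) U(1) c])
  have Q: "linear ?Q" "inj ?Q"
    by (rule linear_push[OF smooth_into_jet_lift[OF E sub par] x0])
       (rule tangent_to_prolongation(2)[OF E sub par x0])
  note T = tangent_map_prE[OF U(2,1) c, folded \<theta>s]
  show "dim (R_plane_param2 M E (ddot_param M E \<Theta> \<Gamma> \<theta>)) = CARD('n)"
    unfolding R1 by (rule range_linear_inj(2)[OF P])
  show "dim (R_plane2 E (ddot E \<Gamma> (prE M E 1 \<theta>))) = CARD('n)"
    unfolding R2 by (rule range_linear_inj(2)[OF Q])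
  show "maps_isomorphically_onto (tangent_map (mjet1_atlas M E) (jet1_atlas E) (prE M E 1) \<theta>)
      (R_plane_param2 M E (ddot_param M E \<Theta> \<Gamma> \<theta>)) (R_plane2 E (ddot E \<Gamma> (prE M E 1 \<theta>)))"
    unfolding R1 R2 maps_isomorphically_onto_def
  proof (intro conjI ballI allI)
    let ?T = "tangent_map (mjet1_atlas M E) (jet1_atlas E) (prE M E 1) \<theta>"
    show "subspace (range ?P)" by (rule range_linear_inj(1)[OF P])
    show "subspace (range ?Q)" by (rule range_linear_inj(1)[OF Q])
    show "bij_betw ?T (range ?P) (range ?Q)"
      unfolding bij_betw_def
    proof
      show "inj_on ?T (range ?P)"
      proof (rule inj_onI)
        fix v w assume "v \<in> range ?P" "w \<in> range ?P" and eq: "?T v = ?T w"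
        then obtain a b where ab: "v = ?P a" "w = ?P b" by blast
        then have "?Q a = ?Q b" using eq unfolding ab T by blast
        then show "v = w" unfolding ab using injD[OF Q(2)] by blast
      qed
      show "?T ` range ?P = range ?Q" unfolding image_image T ..
    qed
    fix v assume "v \<in> range ?P"
    then obtain a where a: "v = ?P a" by blast
    show "?T (v + w) = ?T v + ?T w" if "w \<in> range ?P" for w
    proof -
      obtain b where b: "w = ?P b" using \<open>w \<in> range ?P\<close> by blast
      show ?thesis unfolding a b linear_add[OF P(1), symmetric] T linear_add[OF Q(1)] ..
    qed
    show "?T (r *\<^sub>R v) = r *\<^sub>R ?T v" for r
      unfolding a linear_cmul[OF P(1), symmetric] T linear_cmul[OF Q(1)] ..
  qed
qed

end

theorem theorem6:
  fixes AtM :: "('x::{t2_space, second_countable_topology}, real^'n::finite) chart set"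
    and AtE :: "('e::{t2_space, second_countable_topology}, real^('n + 'm::finite)) chart set"
    and \<Theta> :: "('x, real^'n) connection"
    and \<Gamma> :: "('e, real^('n + 'm)) connection"
  assumes "smooth_manifold AtM" and "smooth_manifold AtE"
    and "linear_connection AtM \<Theta>" and "torsion_free AtM \<Theta>"
    and "linear_connection AtE \<Gamma>" and "torsion_free AtE \<Gamma>"
  shows "section_with_image (ddot AtE \<Gamma>) (jet_proj AtE 1)
           (Jet AtE 1) (Jet AtE 2) (geod_eq AtE \<Gamma>) \<and>
         section_with_image (ddot_param AtM AtE \<Theta> \<Gamma>) (mjet_proj AtM AtE 1)
           (ImmJet AtM AtE 1) (ImmJet AtM AtE 2) (geod_eq_param AtM AtE \<Theta> \<Gamma>) \<and>
         prE AtM AtE 1 ` ImmJet AtM AtE 1 = Jet AtE 1 \<and>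
         (\<forall>\<theta>\<in>ImmJet AtM AtE 1.
            dim (R_plane_param2 AtM AtE (ddot_param AtM AtE \<Theta> \<Gamma> \<theta>)) = CARD('n) \<and>
            dim (R_plane2 AtE (ddot AtE \<Gamma> (prE AtM AtE 1 \<theta>))) = CARD('n) \<and>
            maps_isomorphically_onto
              (tangent_map (mjet1_atlas AtM AtE) (jet1_atlas AtE) (prE AtM AtE 1) \<theta>)
              (R_plane_param2 AtM AtE (ddot_param AtM AtE \<Theta> \<Gamma> \<theta>))
              (R_plane2 AtE (ddot AtE \<Gamma> (prE AtM AtE 1 \<theta>))))"
  using section_ddot[OF assms(2,5,6)] section_ddot_param[OF assms(1-6)] prE_surj[OF assms(1,2)]
    covering[OF assms] by blast

end
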